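(* Let $d\ge1$. Let $\Omega\in L^\infty(S^{2d-1})$ have mean zero, $\int_{S^{2d-1}}\Omega\,d\sigma=0$, and satisfy the following geometric non-degeneracy condition (with $\Omega$ extended to $\mathbb R^{2d}\setminus\{0\}$ homogeneously of degree zero): there exist a measurable set $F\subset S^{d-1}$ with $\sigma(F)>0$, constants $\delta,\kappa>0$, and $\lambda\in\mathbb C$ with $|\lambda|=1$ such that $$\operatorname{Re}[\lambda\,\Omega(\theta+h,\theta-h)]\ge\kappa\quad\text{for a.e. }(\theta,h)\in F\times B(0,\delta),\qquad B(0,\delta)\subset\mathbb R^d.$$ Let $b_1,b_2\in L^2_{\mathrm{loc}}(\mathbb R^d)$ be complex-valued. (i) We have $$S_{2,2}(b_1,b_2)+T_1(b_1,b_2)\lesssim_\Omega\|C_{\vec b}^{1,2}(T_\Omega)\|_{L^2\times L^2\to L^1}.$$ (ii) If additionally $b_1b_2\in L^2_{\mathrm{loc}}(\mathbb R^d)$, then $$S_{2,2}(b_1,b_2)+T_2(b_1,b_2)\lesssim_\Omega\|C_{\vec b}^{1,1}(T_\Omega^{*2})\|_{L^2\times L^\infty\to L^2}=\|C_{\vec b}^{2,2}(T_\Omega^{*1})\|_{L^\infty\times L^2\to L^2}.$$ The implied constants depend only on the dimension, the kernel $\Omega$, and the non-degeneracy data $(F,\delta,\kappa,\lambda)$.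
   Context: Cubes in $\mathbb R^d$ have sides parallel to the axes; $\langle f\rangle_Q=\frac1{|Q|}\int_Q f$ and $\langle |f|\rangle_{r,Q}=\bigl(\frac1{|Q|}\int_Q|f|^r\bigr)^{1/r}$. The pairing is $\langle F,h\rangle=\int_{\mathbb R^d}Fh$, without complex conjugation. $\sigma$ is surface measure (counting measure on $S^0$ when $d=1$). $L^\infty_c$ denotes bounded compactly supported functions. Joint oscillations (suprema over all cubes $Q$), for $1\le r,t,u<\infty$: $$S_{r,t}(b_1,b_2)=\sup_Q\langle|b_1-\langle b_1\rangle_Q|\rangle_{r,Q}\,\langle|b_2-\langle b_2\rangle_Q|\rangle_{t,Q},\qquad T_u(b_1,b_2)=\sup_Q\bigl\langle|b_1-\langle b_1\rangle_Q|\,|b_2-\langle b_2\rangle_Q|\bigr\rangle_{u,Q}.$$ The operator is $$T_\Omega(f_1,f_2)(x)=\mathrm{p.v.}\iint_{\mathbb R^d\times\mathbb R^d}\frac{\Omega((y_1,y_2)/|(y_1,y_2)|)}{|(y_1,y_2)|^{2d}}f_1(x-y_1)f_2(x-y_2)\,dy_1\,dy_2 ,$$ understood through its trilinear form: fix a nonincreasing $\chi\in C^\infty([0,\infty))$, $0\le\chi\le1$, $\chi=1$ on $[0,1/4]$, $\chi=0$ on $[1/2,\infty)$; for integers $\mu<\nu$ let $T_{\Omega,\mu}^\nu$ be defined as $T_\Omega$ with kernel multiplied by $\chi(2^{-\nu}|(y_1,y_2)|)-\chi(2^{-\mu}|(y_1,y_2)|)$; then $\langle T_\Omega(h_1,h_2),h_3\rangle:=\lim_{\mu\to-\infty,\,\nu\to+\infty}\langle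 T_{\Omega,\mu}^\nu(h_1,h_2),h_3\rangle$, which exists for $h_j\in L^{q_j}$ with $1<q_j<\infty$, $\sum_j1/q_j=1$. Partial transposes with respect to the bilinear pairing: $\langle T^{*1}(f_1,f_2),h\rangle=\langle T(h,f_2),f_1\rangle$ and $\langle T^{*2}(f_1,f_2),h\rangle=\langle T(f_1,h),f_2\rangle$. Commutators: $[b,T]_1(f_1,f_2)=bT(f_1,f_2)-T(bf_1,f_2)$, $[b,T]_2(f_1,f_2)=bT(f_1,f_2)-T(f_1,bf_2)$, $C_{\vec b}^{i,j}(T)=[b_1,[b_2,T]_j]_i$. The form $\langle C_{\vec b}^{i,j}(T)(f_1,f_2),h\rangle$ is defined by the four-term algebraic expansion, with output symbols moved onto $h$; e.g. $$\langle C_{\vec b}^{1,2}(T)(f_1,f_2),h\rangle=\langle T(f_1,f_2),b_1b_2h\rangle-\langle T(b_1f_1,f_2),b_2h\rangle-\langle T(f_1,b_2f_2),b_1h\rangle+\langle T(b_1f_1,b_2f_2),h\rangle.$$ Norms are those of the trilinear forms: $\|C_{\vec b}^{i,j}(T)\|_{L^{p_1}\times L^{p_2}\to L^p}$ ($p\ge1$) is the least $N\in[0,\infty]$ such that $|\langle C_{\vec b}^{i,j}(T)(f_1,f_2),h\rangle|\le N\|f_1\|_{p_1}\|f_2\|_{p_2}\|h\|_{p'}$ for all admissible $f_1,f_2,h$, where $f$ is admissible if $f\in L^\infty_c$ and the symbol-weighted functions $b_1f$, $b_2f$, $b_1b_2f$ are bounded; it is $+\infty$ if no finite bound exists. Equivalently,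 it is the norm of the corresponding bounded realization. *)

theory Defs
  imports "HOL-Analysis.Analysis" "HOL-Probability.Essential_Supremum"
begin

section \<open>Lebesgue spaces, averages and cubes\<close>

text \<open>Functions on \<open>\<real>\<^sup>d\<close> are Lebesgue measurable functions, considered up to null sets.\<close>

definition ennreal_rpow :: "ennreal \<Rightarrow> real \<Rightarrow> ennreal" where
  "ennreal_rpow x a = (if x = \<infinity> then \<infinity> else ennreal (enn2real x powr a))"
  \<comment> \<open>only used for \<open>a > 0\<close>\<close>

definition Lp_norm :: "ennreal \<Rightarrow> ('a::euclidean_space \<Rightarrow> complex) \<Rightarrow> ennreal" where
  "Lp_norm p f =
    (if p = \<infinity> then esssup lebesgue (\<lambda>x. ennreal (cmod (f x)))
     else ennreal_rpow (\<integral>\<^sup>+x. ennreal (cmod (f x) powr enn2real p) \<partial>lebesgue) (1 / enn2real p))"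

definition conj_exponent :: "ennreal \<Rightarrow> ennreal" where
  "conj_exponent p = inverse (1 - inverse p)"
  \<comment> \<open>in \<open>[1,\<infinity>]\<close>: here \<open>inverse 0 = \<infinity>\<close> and \<open>inverse \<infinity> = 0\<close>\<close>

definition Linf :: "'a measure \<Rightarrow> ('a \<Rightarrow> complex) \<Rightarrow> bool" where
  "Linf M f \<longleftrightarrow> f \<in> borel_measurable M \<and> (\<exists>B. AE x in M. cmod (f x) \<le> B)"

definition Linf_c :: "('a::euclidean_space \<Rightarrow> complex) \<Rightarrow> bool" where
  "Linf_c f \<longleftrightarrow> Linf lebesgue f \<and> (\<exists>K. compact K \<and> (AE x in lebesgue. x \<notin> K \<longrightarrow> f x = 0))"

definition L2_loc :: "('a::euclidean_space \<Rightarrow> complex) \<Rightarrow> bool" where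
  "L2_loc b \<longleftrightarrow> b \<in> borel_measurable lebesgue \<and>
     (\<forall>K. compact K \<longrightarrow> set_integrable lebesgue K (\<lambda>x. (cmod (b x))\<^sup>2))"

definition cubes :: "'a::euclidean_space set set" where
  "cubes = {cbox a (a + l *\<^sub>R One) | a l. l > 0}"

definition avg :: "('a::euclidean_space \<Rightarrow> complex) \<Rightarrow> 'a set \<Rightarrow> complex" where
  "avg f Q = (LINT x:Q|lebesgue. f x) /\<^sub>R measure lebesgue Q"

definition avg_abs :: "real \<Rightarrow> ('a::euclidean_space \<Rightarrow> complex) \<Rightarrow> 'a set \<Rightarrow> ennreal" where
  "avg_abs r f Q =
     ennreal_rpow ((\<integral>\<^sup>+x\<in>Q. ennreal (cmod (f x) powr r) \<partial>lebesgue) / emeasure lebesgue Q) (1 / r)"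

definition osc_S :: "real \<Rightarrow> real \<Rightarrow> ('a::euclidean_space \<Rightarrow> complex) \<Rightarrow> ('a \<Rightarrow> complex) \<Rightarrow> ennreal" where
  "osc_S r t b1 b2 =
     (SUP Q\<in>cubes. avg_abs r (\<lambda>x. b1 x - avg b1 Q) Q * avg_abs t (\<lambda>x. b2 x - avg b2 Q) Q)"

definition osc_T :: "real \<Rightarrow> ('a::euclidean_space \<Rightarrow> complex) \<Rightarrow> ('a \<Rightarrow> complex) \<Rightarrow> ennreal" where
  "osc_T u b1 b2 = (SUP Q\<in>cubes. avg_abs u (\<lambda>x. (b1 x - avg b1 Q) * (b2 x - avg b2 Q)) Q)"

section \<open>Surface measure\<close>

text \<open>
  Polar coordinates: the surface measure of \<open>A\<close> is \<open>n\<close> times the Lebesgue measure of the cone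
  \<open>{r x | x \<in> A, 0 < r < 1}\<close>, where \<open>n\<close> is the dimension of the ambient space. For \<open>n = 1\<close> this is
  counting measure on \<open>{-1, 1}\<close>. The measure is completed, so that its measurable sets are all
  Lebesgue measurable subsets of the sphere.
\<close>

definition sphere_measure :: "'a::euclidean_space measure" where
  "sphere_measure = completion (scale_measure (of_nat DIM('a))
     (distr (restrict_space lebesgue (ball 0 1 - {0})) (restrict_space borel (sphere 0 1))
       (\<lambda>x. x /\<^sub>R norm x)))"

section \<open>The rough bilinear singular integral and its form\<close>

text \<open>
  \<open>\<real>\<^sup>2\<^sup>d\<close> is \<open>\<real>\<^sup>d \<times> \<real>\<^sup>d\<close>, whose product norm is Euclidean. Of \<open>\<Omega>\<close> only the values on the unit
  sphere are used.
\<close>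

definition hom0 :: "('b::real_normed_vector \<Rightarrow> complex) \<Rightarrow> 'b \<Rightarrow> complex" where
  "hom0 \<Omega> y = \<Omega> (y /\<^sub>R norm y)"

text \<open>
  The functions \<open>D k\<close> are the successive derivatives of \<open>\<eta>\<close> on \<open>[0,\<infinity>)\<close>, one-sided at \<open>0\<close>.
\<close>

definition is_cutoff :: "(real \<Rightarrow> real) \<Rightarrow> bool" where
  "is_cutoff \<eta> \<longleftrightarrow>
     (\<exists>D. D 0 = \<eta> \<and>
        (\<forall>k::nat. \<forall>x\<ge>0. (D k has_real_derivative D (Suc k) x) (at x within {0..}))) \<and>
     antimono_on {0..} \<eta> \<and> (\<forall>x\<ge>0. 0 \<le> \<eta> x \<and> \<eta> x \<le> 1) \<and>
     (\<forall>x\<in>{0..1/4}. \<eta> x = 1) \<and> (\<forall>x\<ge>1/2. \<eta> x = 0)"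

definition kernel :: "('a::euclidean_space \<times> 'a \<Rightarrow> complex) \<Rightarrow> 'a \<times> 'a \<Rightarrow> complex" where
  "kernel \<Omega> y = hom0 \<Omega> y / of_real (norm y ^ (2 * DIM('a)))"

definition T_trunc :: "(real \<Rightarrow> real) \<Rightarrow> ('a::euclidean_space \<times> 'a \<Rightarrow> complex) \<Rightarrow> int \<Rightarrow> int \<Rightarrow>
    ('a \<Rightarrow> complex) \<Rightarrow> ('a \<Rightarrow> complex) \<Rightarrow> 'a \<Rightarrow> complex" where
  "T_trunc \<eta> \<Omega> \<mu> \<nu> f1 f2 x =
     (LINT y|lebesgue. kernel \<Omega> y * of_real (\<eta> (2 powi (- \<nu>) * norm y) - \<eta> (2 powi (- \<mu>) * norm y))
        * f1 (x - fst y) * f2 (x - snd y))"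

definition pairing :: "('a::euclidean_space \<Rightarrow> complex) \<Rightarrow> ('a \<Rightarrow> complex) \<Rightarrow> complex" where
  "pairing F h = (LINT x|lebesgue. F x * h x)"

type_synonym 'a form = "('a \<Rightarrow> complex) \<Rightarrow> ('a \<Rightarrow> complex) \<Rightarrow> ('a \<Rightarrow> complex) \<Rightarrow> complex"

text \<open>A bilinear operator \<open>T\<close> is represented by its trilinear form, \<open>\<Lambda> f1 f2 h = \<langle>T(f1, f2), h\<rangle>\<close>.\<close>

definition T_form :: "(real \<Rightarrow> real) \<Rightarrow> ('a::euclidean_space \<times> 'a \<Rightarrow> complex) \<Rightarrow> 'a form" where
  "T_form \<eta> \<Omega> h1 h2 h3 =
     Lim (at_bot \<times>\<^sub>F at_top) (\<lambda>(\<mu>, \<nu>). pairing (T_trunc \<eta> \<Omega> \<mu> \<nu> h1 h2) h3)"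

definition transpose1 :: "'a form \<Rightarrow> 'a form" where
  "transpose1 \<Lambda> f1 f2 h = \<Lambda> h f2 f1"

definition transpose2 :: "'a form \<Rightarrow> 'a form" where
  "transpose2 \<Lambda> f1 f2 h = \<Lambda> f1 h f2"

section \<open>Commutators\<close>

text \<open>
  The forms of \<open>[b, T]\<^sub>1\<close> and \<open>[b, T]\<^sub>2\<close>, with the symbol acting on the output moved onto \<open>h\<close>.
  Their composition is the four-term expansion of the iterated commutator.
\<close>

definition comm1 :: "('a \<Rightarrow> complex) \<Rightarrow> 'a form \<Rightarrow> 'a form" where
  "comm1 b \<Lambda> f1 f2 h = \<Lambda> f1 f2 (\<lambda>x. b x * h x) - \<Lambda> (\<lambda>x. b x * f1 x) f2 h"

definition comm2 :: "('a \<Rightarrow> complex) \<Rightarrow> 'a form \<Rightarrow> 'a form" where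
  "comm2 b \<Lambda> f1 f2 h = \<Lambda> f1 f2 (\<lambda>x. b x * h x) - \<Lambda> f1 (\<lambda>x. b x * f2 x) h"

definition admissible :: "('a::euclidean_space \<Rightarrow> complex) \<Rightarrow> ('a \<Rightarrow> complex) \<Rightarrow> ('a \<Rightarrow> complex) \<Rightarrow> bool" where
  "admissible b1 b2 f \<longleftrightarrow> Linf_c f \<and> Linf lebesgue (\<lambda>x. b1 x * f x) \<and>
     Linf lebesgue (\<lambda>x. b2 x * f x) \<and> Linf lebesgue (\<lambda>x. b1 x * b2 x * f x)"

text \<open>The norm \<open>L\<^sup>p\<^sup>1 \<times> L\<^sup>p\<^sup>2 \<rightarrow> L\<^sup>p\<close>, tested on functions admissible for the symbols \<open>b1, b2\<close>.\<close>

definition form_norm :: "('a::euclidean_space \<Rightarrow> complex) \<Rightarrow> ('a \<Rightarrow> complex) \<Rightarrow>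
    ennreal \<Rightarrow> ennreal \<Rightarrow> ennreal \<Rightarrow> 'a form \<Rightarrow> ennreal" where
  "form_norm b1 b2 p1 p2 p \<Lambda> = Inf {N. \<forall>f1 f2 h.
     admissible b1 b2 f1 \<and> admissible b1 b2 f2 \<and> admissible b1 b2 h \<longrightarrow>
     ennreal (cmod (\<Lambda> f1 f2 h)) \<le> N * Lp_norm p1 f1 * Lp_norm p2 f2 * Lp_norm (conj_exponent p) h}"

end

theory Submission
  imports Defs "HOL-Probability.Probability"
begin

text \<open>
  The oscillations on a cube \<open>Q\<close> are found by testing the commutator on functions of \<open>z1\<close> and \<open>z2\<close>
  in \<open>Q\<close> and of \<open>x\<close> in a ball \<open>Q'\<close> that lies far from \<open>Q\<close>, in the direction of a density point
  of \<open>F\<close>. With \<open>u = x - (z1 + z2) / 2\<close> and \<open>v = (z2 - z1) / 2\<close> the argument of the kernel is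
  \<open>(x - z1, x - z2) = (u + v, u - v)\<close>, and \<open>v\<close> is small against \<open>u\<close>. For all \<open>z1, z2\<close> the
  direction of \<open>u\<close> belongs to \<open>F\<close> for most \<open>x\<close>; there nondegeneracy bounds the real part of the
  kernel from below by a fixed fraction of the upper bound of its modulus. As \<open>Q\<close> and
  \<open>Q'\<close> have positive distance, the truncations of the form are eventually constant
  (\<open>T_form_separated\<close>), and the form of the commutator is the absolutely convergent integral of
  the kernel against
  \<open>(b1 x - b1 z1) (b2 x - b2 z2) f1 f2 h\<close> in the first part, and against
  \<open>(b1 z2 - b1 z1) (b2 z2 - b2 z1) f1 f2 h\<close> in the second, where the second input and the output
  have changed places.

  The phase of the kernel is uncontrolled apart from the sign of its real part, so the test
  functions must make this factor close, in modulus, to a nonnegative function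
  (\<open>kernel_perturbation\<close>). Let \<open>r1, r2\<close> be the quadratic oscillations of the symbols on \<open>Q\<close>.

  In the first part the points \<open>x\<close> are divided into finitely many classes, their number depending
  only on the kernel: either \<open>b1 x\<close> is within \<open>\<epsilon> r1\<close> of a fixed value \<open>c\<close>, and then
  \<open>f1 = cnj (c - b1)\<close> makes \<open>(b1 x - b1 z) f1 z\<close> close to \<open>\<bar>c - b1 z\<bar>\<^sup>2\<close>; or \<open>b1 x\<close> is very far from the
  mean \<open>a\<close> of \<open>b1\<close> on \<open>Q\<close>, and then \<open>(b1 x - b1 z) / (b1 x - a)\<close> is close to \<open>1\<close>. The same is done
  for \<open>b2\<close>. One class has a fixed share of \<open>Q'\<close>, and testing on it gives \<open>r1 r2 \<lesssim> N\<close>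
  (\<open>separated_oscillation_bound\<close>). By the Cauchy-Schwarz inequality this also bounds the average of
  \<open>\<bar>b1 - a1\<bar> \<bar>b2 - a2\<bar>\<close>.

  In the second part the class is a subset of \<open>Q\<close> itself, on which both symbols are nearly constant.
  With \<open>B1, B2\<close> the symbols minus these constants, two tests are made. The indicator of the class
  against \<open>cnj (B1 B2)\<close> bounds the norm of \<open>B1 B2\<close> by \<open>N\<close> and a small multiple of the product \<open>X\<close> of
  the norms of \<open>B1\<close> and \<open>B2\<close>; then \<open>cnj B1\<close> against \<open>cnj B2\<close> bounds \<open>X\<close> by \<open>N\<close> and the norm of
  \<open>B1 B2\<close>. Absorbing the small multiple bounds both (\<open>diagonal_oscillation_bound\<close>).
\<close>

section \<open>Square integrable functions\<close>

lemma integrable_dominated: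
  fixes g :: "'a \<Rightarrow> 'b::{banach, second_countable_topology}" and f :: "'a \<Rightarrow> real"
  assumes "integrable M f" "g \<in> borel_measurable M" "\<And>x. x \<in> space M \<Longrightarrow> norm (g x) \<le> f x"
  shows "integrable M g"
  by (rule Bochner_Integration.integrable_bound[OF assms(1,2)], rule AE_I2, insert assms(3))
     (metis abs_ge_self order_trans real_norm_def)

lemma borel_measurable_comp_continuous:
  "f \<in> borel_measurable borel \<Longrightarrow> continuous_on UNIV g \<Longrightarrow> (\<lambda>x. f (g x)) \<in> borel_measurable borel"
  by (rule measurable_compose[OF borel_measurable_continuous_onI])

definition square_integrable :: "'a measure \<Rightarrow> ('a \<Rightarrow> complex) \<Rightarrow> bool" where
  "square_integrable M f \<longleftrightarrow> f \<in> borel_measurable M \<and> integrable M (\<lambda>x. (cmod (f x))\<^sup>2)"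

definition l2norm :: "'a measure \<Rightarrow> ('a \<Rightarrow> complex) \<Rightarrow> real" where
  "l2norm M f = sqrt (\<integral>x. (cmod (f x))\<^sup>2 \<partial>M)"

lemma l2norm_nonneg [simp]: "0 \<le> l2norm M f"
  by (simp add: l2norm_def)

lemma l2norm_squared: "(l2norm M f)\<^sup>2 = (\<integral>x. (cmod (f x))\<^sup>2 \<partial>M)"
  by (simp add: l2norm_def)

lemma square_integrable_bound:
  assumes "square_integrable M f" "g \<in> borel_measurable M" "\<And>x. cmod (g x) \<le> cmod (f x)"
  shows "square_integrable M g" "l2norm M g \<le> l2norm M f"
proof -
  have *: "integrable M (\<lambda>x. (cmod (g x))\<^sup>2)"
  proof (rule integrable_dominated)
    show "integrable M (\<lambda>x. (cmod (f x))\<^sup>2)" using assms(1) by (simp add: square_integrable_def)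
    show "(\<lambda>x. (cmod (g x))\<^sup>2) \<in> borel_measurable M" using assms(2) by simp
  qed (use assms(3) in \<open>simp add: power_mono\<close>)
  then show "square_integrable M g" using assms by (simp add: square_integrable_def)
  show "l2norm M g \<le> l2norm M f"
    unfolding l2norm_def using assms *
    by (intro real_sqrt_le_mono integral_mono) (simp_all add: square_integrable_def power_mono)
qed

lemma square_integrable_mult:
  assumes "square_integrable M f" "square_integrable M g"
  shows "integrable M (\<lambda>x. f x * g x)"
    and "(\<integral>x. cmod (f x) * cmod (g x) \<partial>M) \<le> l2norm M f * l2norm M g"
proof -
  have [measurable]: "f \<in> borel_measurable M" "g \<in> borel_measurable M"
    using assms by (auto simp: square_integrable_def)
  have fi: "integrable M (\<lambda>x. (cmod (f x))\<^sup>2)" and gi: "integrable M (\<lambda>x. (cmod (g x))\<^sup>2)"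
    using assms by (auto simp: square_integrable_def)
  have bd: "cmod (f x) * cmod (g x) \<le> (cmod (f x))\<^sup>2 + (cmod (g x))\<^sup>2" for x
    using sum_squares_bound[of "cmod (f x)" "cmod (g x)"] mult_nonneg_nonneg[OF norm_ge_zero[of "f x"] norm_ge_zero[of "g x"]]
    by linarith
  have ai: "integrable M (\<lambda>x. cmod (f x) * cmod (g x))"
    by (rule integrable_dominated[OF Bochner_Integration.integrable_add[OF fi gi]])
       (use bd in simp_all)
  then show "integrable M (\<lambda>x. f x * g x)"
    by (rule integrable_dominated) (simp_all add: norm_mult)
  have nn: "(\<integral>\<^sup>+x. ennreal (cmod (f x)) * ennreal (cmod (g x)) \<partial>M)
      = ennreal (\<integral>x. cmod (f x) * cmod (g x) \<partial>M)"
    using nn_integral_eq_integral[OF ai] by (simp add: ennreal_mult)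
  have nn2: "(\<integral>\<^sup>+x. (ennreal (cmod (f x)))\<^sup>2 \<partial>M) = ennreal ((l2norm M f)\<^sup>2)"
    if "integrable M (\<lambda>x. (cmod (f x))\<^sup>2)" for f :: "'a \<Rightarrow> complex"
    using nn_integral_eq_integral[OF that] by (simp add: ennreal_power l2norm_squared)
  have "ennreal ((\<integral>x. cmod (f x) * cmod (g x) \<partial>M)\<^sup>2) = (\<integral>\<^sup>+x. ennreal (cmod (f x)) * ennreal (cmod (g x)) \<partial>M)\<^sup>2"
    unfolding nn by (simp add: ennreal_power)
  also have "\<dots> \<le> (\<integral>\<^sup>+x. (ennreal (cmod (f x)))\<^sup>2 \<partial>M) * (\<integral>\<^sup>+x. (ennreal (cmod (g x)))\<^sup>2 \<partial>M)"
    by (rule Cauchy_Schwarz_nn_integral) auto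
  also have "\<dots> = ennreal ((l2norm M f * l2norm M g)\<^sup>2)"
    by (simp add: nn2[OF fi] nn2[OF gi] power_mult_distrib ennreal_mult')
  finally show "(\<integral>x. cmod (f x) * cmod (g x) \<partial>M) \<le> l2norm M f * l2norm M g"
    by (metis ennreal_le_iff l2norm_nonneg mult_nonneg_nonneg power2_le_imp_le zero_le_power2)
qed

lemma (in prob_space) square_integrable_const [simp]: "square_integrable M (\<lambda>_. c)"
  by (simp add: square_integrable_def)

lemma (in prob_space) l2norm_const [simp]: "l2norm M (\<lambda>_. c) = cmod c"
  by (simp add: l2norm_def prob_space)

lemma (in prob_space) square_integrable_integrable:
  assumes "square_integrable M f"
  shows "integrable M f" and "(\<integral>x. cmod (f x) \<partial>M) \<le> l2norm M f"
  using square_integrable_mult[OF assms square_integrable_const[of 1]] by simp_all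

lemma square_integrable_add:
  assumes "square_integrable M f" "square_integrable M g"
  shows "square_integrable M (\<lambda>x. f x + g x)" "l2norm M (\<lambda>x. f x + g x) \<le> l2norm M f + l2norm M g"
proof -
  have [measurable]: "f \<in> borel_measurable M" "g \<in> borel_measurable M"
    using assms by (auto simp: square_integrable_def)
  have fi: "integrable M (\<lambda>x. (cmod (f x))\<^sup>2)" and gi: "integrable M (\<lambda>x. (cmod (g x))\<^sup>2)"
    using assms by (auto simp: square_integrable_def)
  have fgi: "integrable M (\<lambda>x. cmod (f x) * cmod (g x))"
    using integrable_norm[OF square_integrable_mult(1)[OF assms]] by (simp add: norm_mult)
  have bd: "(cmod (f x + g x))\<^sup>2 \<le> (cmod (f x))\<^sup>2 + (cmod (g x))\<^sup>2 + 2 * (cmod (f x) * cmod (g x))" for x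
    using power_mono[OF norm_triangle_ineq[of "f x" "g x"], of 2]
    by (simp add: power2_sum)
  have bi: "integrable M (\<lambda>x. (cmod (f x))\<^sup>2 + (cmod (g x))\<^sup>2 + 2 * (cmod (f x) * cmod (g x)))"
    using fi gi fgi by auto
  have si: "integrable M (\<lambda>x. (cmod (f x + g x))\<^sup>2)"
    by (rule integrable_dominated[OF bi]) (use bd in simp_all)
  then show "square_integrable M (\<lambda>x. f x + g x)" by (simp add: square_integrable_def)
  have "(l2norm M (\<lambda>x. f x + g x))\<^sup>2 \<le> (\<integral>x. (cmod (f x))\<^sup>2 + (cmod (g x))\<^sup>2 + 2 * (cmod (f x) * cmod (g x)) \<partial>M)"
    unfolding l2norm_squared by (rule integral_mono[OF si bi bd])
  also have "\<dots> \<le> (l2norm M f)\<^sup>2 + (l2norm M g)\<^sup>2 + 2 * (l2norm M f * l2norm M g)"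
    using fi gi fgi square_integrable_mult(2)[OF assms] by (simp add: l2norm_squared)
  also have "\<dots> = (l2norm M f + l2norm M g)\<^sup>2" by (simp add: power2_sum)
  finally show "l2norm M (\<lambda>x. f x + g x) \<le> l2norm M f + l2norm M g"
    by (rule power2_le_imp_le) simp
qed

lemma square_integrable_cmult:
  assumes "square_integrable M f"
  shows "square_integrable M (\<lambda>x. c * f x)" "l2norm M (\<lambda>x. c * f x) = cmod c * l2norm M f"
  using assms by (auto simp: square_integrable_def l2norm_def norm_mult power_mult_distrib real_sqrt_mult)

lemma (in prob_space) square_integrable_diff_const:
  "square_integrable M f \<Longrightarrow> square_integrable M (\<lambda>x. f x - c)"
  using square_integrable_add(1)[of M f "\<lambda>_. -c"] by simp

lemma borel_measurable_cnj [measurable (raw)]: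
  "f \<in> borel_measurable M \<Longrightarrow> (\<lambda>x. cnj (f x)) \<in> borel_measurable M"
  by (rule borel_measurable_continuous_on[OF continuous_on_cnj[OF continuous_on_id]])

lemma square_integrable_cnj:
  "square_integrable M f \<Longrightarrow> square_integrable M (\<lambda>x. cnj (f x))" "l2norm M (\<lambda>x. cnj (f x)) = l2norm M f"
  unfolding square_integrable_def l2norm_def complex_mod_cnj using borel_measurable_cnj by blast+

text \<open>
  The cross term between \<open>f\<close> minus its mean and a constant integrates to zero. The oscillation
  about the mean is thus a lower bound for the deviation from the other constants that serve as
  centres of classes.
\<close>

lemma (in prob_space) l2norm_mean_le:
  assumes "square_integrable M f"
  shows "l2norm M (\<lambda>x. f x - (\<integral>x. f x \<partial>M)) \<le> l2norm M (\<lambda>x. f x - c)"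
proof -
  define a where "a = (\<integral>x. f x \<partial>M)"
  have fi: "integrable M f" by (rule square_integrable_integrable(1)[OF assms])
  have s: "integrable M (\<lambda>x. (cmod (f x - a))\<^sup>2)"
    using square_integrable_diff_const[OF assms] by (simp add: square_integrable_def)
  have ex: "(cmod (f x - c))\<^sup>2 = (cmod (f x - a))\<^sup>2 + 2 * Re ((f x - a) * cnj (a - c)) + (cmod (a - c))\<^sup>2" for x
    unfolding cmod_power2 by (simp add: power2_eq_square algebra_simps)
  have "(\<integral>x. (cmod (f x - c))\<^sup>2 \<partial>M) = (\<integral>x. (cmod (f x - a))\<^sup>2 \<partial>M) + (cmod (a - c))\<^sup>2"
  proof -
    have i2: "integrable M (\<lambda>x. (f x - a) * cnj (a - c))" using fi by auto
    have "(\<integral>x. Re ((f x - a) * cnj (a - c)) \<partial>M) = Re (\<integral>x. (f x - a) * cnj (a - c) \<partial>M)"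
      by (rule integral_Re[OF i2])
    also have "(\<integral>x. (f x - a) * cnj (a - c) \<partial>M) = 0" using fi by (simp add: a_def prob_space)
    finally have z: "(\<integral>x. Re ((f x - a) * cnj (a - c)) \<partial>M) = 0" by simp
    have i3: "integrable M (\<lambda>x. 2 * Re ((f x - a) * cnj (a - c)))"
      using i2 by (intro integrable_mult_right integrable_Re)
    show ?thesis unfolding ex
      by (subst Bochner_Integration.integral_add)
         (use s i3 z in \<open>auto simp: prob_space simp del: times_complex.sel\<close>)
  qed
  then show ?thesis unfolding l2norm_def a_def[symmetric] by simp
qed

section \<open>Averages against a kernel with large real part\<close>

lemma (in pair_sigma_finite) integral_tensor:
  fixes f :: "'a \<Rightarrow> real" and g :: "'b \<Rightarrow> real"
  assumes "integrable M1 f" "integrable M2 g"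
  shows "integrable (M1 \<Otimes>\<^sub>M M2) (\<lambda>w. f (fst w) * g (snd w))"
    and "(\<integral>w. f (fst w) * g (snd w) \<partial>(M1 \<Otimes>\<^sub>M M2)) = (\<integral>x. f x \<partial>M1) * (\<integral>y. g y \<partial>M2)"
proof -
  have [measurable]: "f \<in> borel_measurable M1" "g \<in> borel_measurable M2" using assms by auto
  show i: "integrable (M1 \<Otimes>\<^sub>M M2) (\<lambda>w. f (fst w) * g (snd w))"
  proof (rule Fubini_integrable)
    show "integrable M1 (\<lambda>x. \<integral>y. norm (f (fst (x, y)) * g (snd (x, y))) \<partial>M2)"
      using assms by (simp add: abs_mult)
    show "AE x in M1. integrable M2 (\<lambda>y. f (fst (x, y)) * g (snd (x, y)))"
      using assms by simp
  qed measurable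
  show "(\<integral>w. f (fst w) * g (snd w) \<partial>(M1 \<Otimes>\<^sub>M M2)) = (\<integral>x. f x \<partial>M1) * (\<integral>y. g y \<partial>M2)"
    using integral_fst'[OF i] by simp
qed

text \<open>
  What remains of the rough kernel on \<open>Q' \<times> Q \<times> Q\<close> after multiplication by a constant: a bound for
  the modulus and, for every pair \<open>z = (z1, z2)\<close>, a real part of at least \<open>1\<close> off a small set of
  points \<open>x\<close>. The measures \<open>P\<close> and \<open>P'\<close> stand for the uniform distributions on \<open>Q\<close> and \<open>Q'\<close>.
\<close>

locale averaged_kernel = P: prob_space P + P': prob_space P'
  for P :: "'b measure" and P' :: "'c measure" +
  fixes k :: "'c \<times> 'b \<times> 'b \<Rightarrow> complex" and L e :: real
  assumes k_measurable [measurable]: "k \<in> borel_measurable (P' \<Otimes>\<^sub>M (P \<Otimes>\<^sub>M P))"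
    and k_bound: "cmod (k w) \<le> L"
    and L_ge_1: "1 \<le> L"
    and k_bad: "z \<in> space (P \<Otimes>\<^sub>M P) \<Longrightarrow> measure P' {x \<in> space P'. Re (k (x, z)) < 1} \<le> e"
begin

sublocale PP: pair_prob_space P P ..
sublocale T: pair_prob_space P' "P \<Otimes>\<^sub>M P" ..

abbreviation T where "T \<equiv> P' \<Otimes>\<^sub>M (P \<Otimes>\<^sub>M P)"

lemma integrable_indicator_P' [simp]: "A \<in> sets P' \<Longrightarrow> integrable P' (indicat_real A)"
  by (rule integrable_real_indicator) (simp_all add: P'.emeasure_eq_measure)

text \<open>
  The integration over \<open>x\<close> comes first. The weight \<open>u\<close> does not depend on \<open>x\<close>, and on the exceptional
  set the real part is still at least \<open>-L\<close>, which loses at most \<open>1 + L\<close> times its measure.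
\<close>

lemma kernel_lower_bound:
  assumes E [measurable]: "E \<in> sets P'" and u: "integrable (P \<Otimes>\<^sub>M P) u"
    and u0: "\<And>z. z \<in> space (P \<Otimes>\<^sub>M P) \<Longrightarrow> 0 \<le> u z"
  shows "integrable T (\<lambda>w. Re (k w) * indicator E (fst w) * u (snd w))"
    and "(measure P' E - (1 + L) * e) * (\<integral>z. u z \<partial>(P \<Otimes>\<^sub>M P))
      \<le> (\<integral>w. Re (k w) * indicator E (fst w) * u (snd w) \<partial>T)"
proof -
  have [measurable]: "u \<in> borel_measurable (P \<Otimes>\<^sub>M P)" using u by auto
  have uT: "integrable T (\<lambda>w. u (snd w))"
    using T.integral_tensor(1)[of "\<lambda>_. 1" u] u by simp
  show i: "integrable T (\<lambda>w. Re (k w) * indicator E (fst w) * u (snd w))"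
  proof (rule integrable_dominated[of T "\<lambda>w. L * u (snd w)"])
    fix w assume "w \<in> space T"
    then have "0 \<le> u (snd w)" using u0 by (auto simp: space_pair_measure)
    moreover have "\<bar>Re (k w) * indicator E (fst w)\<bar> \<le> L * 1"
      unfolding abs_mult
      by (intro mult_mono) (use k_bound[of w] L_ge_1 abs_Re_le_cmod[of "k w"] in \<open>auto split: split_indicator\<close>)
    ultimately show "norm (Re (k w) * indicator E (fst w) * u (snd w)) \<le> L * u (snd w)"
      by (simp add: abs_mult mult_right_mono)
  qed (use uT in simp_all)
  have inner: "measure P' E - (1 + L) * e \<le> (\<integral>x. Re (k (x, z)) * indicator E x \<partial>P')"
    if z: "z \<in> space (P \<Otimes>\<^sub>M P)" for z
  proof -
    define B where "B = {x \<in> space P'. Re (k (x, z)) < 1}"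
    have [measurable]: "(\<lambda>x. k (x, z)) \<in> borel_measurable P'"
      by (rule measurable_compose[OF measurable_Pair2'[OF z] k_measurable])
    have B [measurable]: "B \<in> sets P'" unfolding B_def by measurable
    have "measure P' E - (1 + L) * e \<le> measure P' E - (1 + L) * measure P' B"
      using k_bad[OF z] L_ge_1 by (simp add: B_def mult_left_mono)
    also have "\<dots> = (\<integral>x. indicator E x - (1 + L) * indicator B x \<partial>P')"
      by (subst Bochner_Integration.integral_diff) auto
    also have "\<dots> \<le> (\<integral>x. Re (k (x, z)) * indicator E x \<partial>P')"
    proof (rule integral_mono)
      show "integrable P' (\<lambda>x. indicator E x - (1 + L) * indicator B x)"
        by (intro Bochner_Integration.integrable_diff integrable_mult_right) auto
      show "integrable P' (\<lambda>x. Re (k (x, z)) * indicator E x)"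
      proof (rule integrable_dominated[of P' "\<lambda>_. L"])
        show "norm (Re (k (x, z)) * indicator E x) \<le> L" for x
          using k_bound[of "(x,z)"] L_ge_1 abs_Re_le_cmod[of "k (x,z)"] by (auto split: split_indicator)
      qed simp_all
      show "indicator E x - (1 + L) * indicator B x \<le> Re (k (x, z)) * indicator E x"
        if "x \<in> space P'" for x
        using that k_bound[of "(x,z)"] L_ge_1 abs_Re_le_cmod[of "k (x,z)"]
        by (auto simp: B_def split: split_indicator)
    qed
    finally show ?thesis .
  qed
  have i': "integrable T (case_prod (\<lambda>x z. Re (k (x, z)) * indicator E x * u z))"
    using i by (simp add: split_def)
  have "(measure P' E - (1 + L) * e) * (\<integral>z. u z \<partial>(P \<Otimes>\<^sub>M P))
      = (\<integral>z. (measure P' E - (1 + L) * e) * u z \<partial>(P \<Otimes>\<^sub>M P))" by simp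
  also have "\<dots> \<le> (\<integral>z. (\<integral>x. Re (k (x, z)) * indicator E x * u z \<partial>P') \<partial>(P \<Otimes>\<^sub>M P))"
  proof (rule integral_mono)
    show "integrable (P \<Otimes>\<^sub>M P) (\<lambda>z. (measure P' E - (1 + L) * e) * u z)" using u by simp
    show "integrable (P \<Otimes>\<^sub>M P) (\<lambda>z. (\<integral>x. Re (k (x, z)) * indicator E x * u z \<partial>P'))"
      by (rule T.integrable_snd[OF i'])
    show "(measure P' E - (1 + L) * e) * u z \<le> (\<integral>x. Re (k (x, z)) * indicator E x * u z \<partial>P')"
      if "z \<in> space (P \<Otimes>\<^sub>M P)" for z
      using mult_right_mono[OF inner[OF that] u0[OF that]] by simp
  qed
  also have "\<dots> = (\<integral>w. Re (k w) * indicator E (fst w) * u (snd w) \<partial>T)"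
    using T.integral_snd[OF i'] by (simp add: split_def)
  finally show "(measure P' E - (1 + L) * e) * (\<integral>z. u z \<partial>(P \<Otimes>\<^sub>M P))
      \<le> (\<integral>w. Re (k w) * indicator E (fst w) * u (snd w) \<partial>T)" .
qed

text \<open>
  The source of all lower bounds: an integrand close to \<open>k\<close> times a nonnegative weight. The error
  \<open>v\<close> is measured in modulus, since a kernel of varying phase allows no cancellation in it.
\<close>

lemma kernel_perturbation:
  assumes \<Phi> [measurable]: "\<Phi> \<in> borel_measurable T"
    and E [measurable]: "E \<in> sets P'" and u: "integrable (P \<Otimes>\<^sub>M P) u" and v: "integrable (P \<Otimes>\<^sub>M P) v"
    and u0: "\<And>z. z \<in> space (P \<Otimes>\<^sub>M P) \<Longrightarrow> 0 \<le> u z"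
    and \<Phi>_near: "\<And>x z. x \<in> space P' \<Longrightarrow> z \<in> space (P \<Otimes>\<^sub>M P) \<Longrightarrow>
      cmod (\<Phi> (x, z) - k (x, z) * of_real (indicator E x * u z)) \<le> L * (indicator E x * v z)"
  shows "integrable T \<Phi>"
    and "(measure P' E - (1 + L) * e) * (\<integral>z. u z \<partial>(P \<Otimes>\<^sub>M P)) - L * measure P' E * (\<integral>z. v z \<partial>(P \<Otimes>\<^sub>M P))
      \<le> cmod (\<integral>w. \<Phi> w \<partial>T)"
proof -
  have [measurable]: "u \<in> borel_measurable (P \<Otimes>\<^sub>M P)" "v \<in> borel_measurable (P \<Otimes>\<^sub>M P)"
    using u v by auto
  have uT: "integrable T (\<lambda>w. u (snd w))" using T.integral_tensor(1)[of "\<lambda>_. 1" u] u by simp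
  have vT: "integrable T (\<lambda>w. indicator E (fst w) * v (snd w))"
    and vI: "(\<integral>w. indicator E (fst w) * v (snd w) \<partial>T) = measure P' E * (\<integral>z. v z \<partial>(P \<Otimes>\<^sub>M P))"
    using T.integral_tensor[of "indicator E" v] v by auto
  have near: "cmod (\<Phi> w - k w * of_real (indicator E (fst w) * u (snd w))) \<le> L * (indicator E (fst w) * v (snd w))"
    if "w \<in> space T" for w using \<Phi>_near[of "fst w" "snd w"] that by (auto simp: space_pair_measure)
  show \<Phi>i: "integrable T \<Phi>"
  proof (rule integrable_dominated[of T "\<lambda>w. L * (indicator E (fst w) * v (snd w)) + L * u (snd w)"])
    fix w assume w: "w \<in> space T"
    have uw: "0 \<le> u (snd w)" using w u0 by (auto simp: space_pair_measure)
    have "cmod (\<Phi> w) \<le> cmod (\<Phi> w - k w * of_real (indicator E (fst w) * u (snd w)))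
        + cmod (k w * of_real (indicator E (fst w) * u (snd w)))"
      using norm_triangle_ineq[of "\<Phi> w - k w * of_real (indicator E (fst w) * u (snd w))"
          "k w * of_real (indicator E (fst w) * u (snd w))"] by simp
    also have "cmod (k w * of_real (indicator E (fst w) * u (snd w))) \<le> L * u (snd w)"
      unfolding norm_mult using uw L_ge_1
      by (intro mult_mono[OF k_bound]) (auto split: split_indicator)
    finally show "norm (\<Phi> w) \<le> L * (indicator E (fst w) * v (snd w)) + L * u (snd w)"
      using near[OF w] by simp
  qed (use uT vT in simp_all)
  note kl = kernel_lower_bound[OF E u u0]
  have "(measure P' E - (1 + L) * e) * (\<integral>z. u z \<partial>(P \<Otimes>\<^sub>M P)) - L * measure P' E * (\<integral>z. v z \<partial>(P \<Otimes>\<^sub>M P))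
      \<le> (\<integral>w. Re (k w) * indicator E (fst w) * u (snd w) \<partial>T) - (\<integral>w. L * (indicator E (fst w) * v (snd w)) \<partial>T)"
    using kl(2) vI by simp
  also have "\<dots> = (\<integral>w. Re (k w) * indicator E (fst w) * u (snd w) - L * (indicator E (fst w) * v (snd w)) \<partial>T)"
    by (rule Bochner_Integration.integral_diff[symmetric]) (use kl(1) vT in auto)
  also have "\<dots> \<le> (\<integral>w. Re (\<Phi> w) \<partial>T)"
  proof (rule integral_mono)
    fix w assume w: "w \<in> space T"
    have "Re (k w * of_real (indicator E (fst w) * u (snd w)) - \<Phi> w) \<le> L * (indicator E (fst w) * v (snd w))"
      using near[OF w] complex_Re_le_cmod order_trans by (metis norm_minus_commute)
    then show "Re (k w) * indicator E (fst w) * u (snd w) - L * (indicator E (fst w) * v (snd w)) \<le> Re (\<Phi> w)"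
      by simp
  next
    show "integrable T (\<lambda>w. Re (k w) * indicator E (fst w) * u (snd w) - L * (indicator E (fst w) * v (snd w)))"
      using kl(1) vT by (intro Bochner_Integration.integrable_diff integrable_mult_right) auto
  qed (use \<Phi>i in \<open>rule integrable_Re\<close>)
  also have "\<dots> = Re (\<integral>w. \<Phi> w \<partial>T)" by (rule integral_Re[OF \<Phi>i])
  also have "\<dots> \<le> cmod (\<integral>w. \<Phi> w \<partial>T)" by (rule complex_Re_le_cmod)
  finally show "(measure P' E - (1 + L) * e) * (\<integral>z. u z \<partial>(P \<Otimes>\<^sub>M P)) - L * measure P' E * (\<integral>z. v z \<partial>(P \<Otimes>\<^sub>M P))
      \<le> cmod (\<integral>w. \<Phi> w \<partial>T)" .
qed

end

section \<open>Oscillations tested from a distance\<close>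

lemma (in prob_space) pigeonhole_prob:
  assumes "finite I" and A: "\<And>i. i \<in> I \<Longrightarrow> A i \<in> events" and B: "B \<subseteq> (\<Union>i\<in>I. A i)" and p: "0 < p" "p \<le> prob B"
  shows "\<exists>i\<in>I. p / card I \<le> prob (A i)"
proof (rule ccontr)
  assume "\<not> ?thesis"
  then have lt: "prob (A i) < p / card I" if "i \<in> I" for i using that by force
  have U: "(\<Union>i\<in>I. A i) \<in> events" using assms by auto
  have "p \<le> prob (\<Union>i\<in>I. A i)" using p finite_measure_mono[OF B U] by simp
  also have "\<dots> \<le> (\<Sum>i\<in>I. prob (A i))"
    using assms by (intro finite_measure_subadditive_finite) auto
  finally have le: "p \<le> (\<Sum>i\<in>I. prob (A i))" .
  then have "I \<noteq> {}" using p by auto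
  then have "(\<Sum>i\<in>I. prob (A i)) < (\<Sum>i\<in>I. p / card I)" using \<open>finite I\<close> lt by (intro sum_strict_mono) auto
  also have "\<dots> = p" using \<open>I \<noteq> {}\<close> \<open>finite I\<close> by simp
  finally show False using le by simp
qed

text \<open>
  The classes of values of a symbol with mean \<open>a\<close> and oscillation \<open>r\<close>: finitely many small discs on
  the scale \<open>r\<close>, and one class for everything far away. The values on the distant ball have no
  relation to those on the cube, so the unbounded class cannot be avoided. It is kept whole, because
  the factor \<open>1 / (w - a)\<close> normalises both the size and the phase of \<open>w - a\<close>.
\<close>

definition symbol_class :: "complex \<Rightarrow> real \<Rightarrow> real \<Rightarrow> real \<Rightarrow> complex option \<Rightarrow> complex set" where
  "symbol_class a r \<epsilon> R s = (case s of None \<Rightarrow> {w. R * r < cmod (w - a)}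
     | Some c \<Rightarrow> {w. cmod (w - (a + of_real r * c)) \<le> \<epsilon> * r})"

lemma symbol_class_borel [measurable]: "symbol_class a r \<epsilon> R s \<in> sets borel"
  by (auto simp: symbol_class_def split: option.split intro!: borel_open borel_closed
      open_Collect_less closed_Collect_le continuous_intros)

lemma symbol_class_near:
  assumes net: "cball 0 R \<subseteq> (\<Union>c\<in>C0. cball c \<epsilon>)" and "0 < r" and "cmod (w - a) \<le> R * r"
  shows "\<exists>c\<in>C0. w \<in> symbol_class a r \<epsilon> R (Some c)"
proof -
  have "cmod ((w - a) / of_real r) \<le> R"
    using assms(2,3) by (simp add: norm_divide field_simps)
  then have "(w - a) / of_real r \<in> cball 0 R" by simp
  then have "(w - a) / of_real r \<in> (\<Union>c\<in>C0. cball c \<epsilon>)" using net by blast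
  then obtain c where c: "c \<in> C0" "cmod (c - (w - a) / of_real r) \<le> \<epsilon>"
    by (auto simp: dist_norm)
  have "cmod (w - (a + of_real r * c)) = r * cmod (c - (w - a) / of_real r)"
  proof -
    have "w - (a + of_real r * c) = - of_real r * (c - (w - a) / of_real r)"
      using \<open>0 < r\<close> by (simp add: field_simps)
    then show ?thesis using \<open>0 < r\<close> by (simp add: norm_mult)
  qed
  also have "\<dots> \<le> \<epsilon> * r" using c(2) \<open>0 < r\<close> by (simp add: mult.commute)
  finally show ?thesis using c(1) by (auto simp: symbol_class_def)
qed

lemma symbol_class_cover:
  assumes "cball 0 R \<subseteq> (\<Union>c\<in>C0. cball c \<epsilon>)" "0 < r"
  shows "\<exists>s\<in>insert None (Some ` C0). w \<in> symbol_class a r \<epsilon> R s"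
proof (cases "cmod (w - a) \<le> R * r")
  case True then show ?thesis using symbol_class_near[OF assms True] by blast
next
  case False then show ?thesis by (auto simp: symbol_class_def)
qed

text \<open>
  The test function \<open>f\<close> on the cube and the weight \<open>\<phi>\<close> on the distant ball that serve all values
  \<open>w\<close> of one class. In a disc with centre \<open>c'\<close> the factor \<open>w - b z\<close> is nearly \<open>c' - b z\<close>, whose
  product with its conjugate is nonnegative. Far away \<open>w - b z\<close> is nearly \<open>w - a\<close>, and the weight
  \<open>1 / (w - a)\<close> turns it into nearly \<open>1\<close>. The last inequality before positivity is the gain: the norms
  spent on \<open>f\<close> and \<open>\<phi>\<close> are smaller than the integral obtained by a factor \<open>r\<close>.
\<close>

lemma (in prob_space) class_test_functions:
  assumes b: "square_integrable M b" and r: "r = l2norm M (\<lambda>z. b z - (\<integral>z. b z \<partial>M))" "0 < r"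
    and R: "1 \<le> R" "1 / R \<le> \<epsilon>"
  obtains f \<phi> g G S where "square_integrable M f" "\<phi> \<in> borel_measurable borel"
    "integrable M g" "\<And>z. 0 \<le> g z" "integrable M G" "\<And>z. 0 \<le> G z"
    "0 \<le> S" "\<And>w. w \<in> symbol_class (\<integral>z. b z \<partial>M) r \<epsilon> R s \<Longrightarrow> cmod (\<phi> w) \<le> S"
    "\<And>w z. w \<in> symbol_class (\<integral>z. b z \<partial>M) r \<epsilon> R s \<Longrightarrow> cmod ((w - b z) * f z * \<phi> w - of_real (g z)) \<le> \<epsilon> * G z"
    "(\<integral>z. G z \<partial>M) \<le> (\<integral>z. g z \<partial>M)" "r * l2norm M f * S \<le> (\<integral>z. g z \<partial>M)" "0 < (\<integral>z. g z \<partial>M)"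
proof (cases s)
  case (Some c)
  define a where "a = (\<integral>z. b z \<partial>M)"
  define c' where "c' = a + of_real r * c"
  define f where "f z = cnj (c' - b z)" for z
  have bc: "square_integrable M (\<lambda>z. b z - c')" by (rule square_integrable_diff_const[OF b])
  have f: "square_integrable M f"
    using square_integrable_cmult(1)[OF square_integrable_cnj(1)[OF bc], of "-1"] by (simp add: f_def[abs_def])
  have rf: "r \<le> l2norm M f"
  proof -
    have "l2norm M f = l2norm M (\<lambda>z. b z - c')"
      unfolding l2norm_def f_def complex_mod_cnj by (simp add: norm_minus_commute)
    then show ?thesis using l2norm_mean_le[OF b, of c'] r by simp
  qed
  have If: "(\<integral>z. (cmod (f z))\<^sup>2 \<partial>M) = (l2norm M f)\<^sup>2" by (simp add: l2norm_squared)
  show ?thesis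
  proof (rule that[of f "\<lambda>_. 1" "\<lambda>z. (cmod (f z))\<^sup>2" "\<lambda>z. r * cmod (f z)" 1])
    show "integrable M (\<lambda>z. (cmod (f z))\<^sup>2)" using f by (simp add: square_integrable_def)
    show "integrable M (\<lambda>z. r * cmod (f z))"
      using square_integrable_integrable(1)[OF f] by auto
    show "cmod ((w - b z) * f z * 1 - of_real ((cmod (f z))\<^sup>2)) \<le> \<epsilon> * (r * cmod (f z))"
      if "w \<in> symbol_class (\<integral>z. b z \<partial>M) r \<epsilon> R s" for w z
    proof -
      have w: "cmod (w - c') \<le> \<epsilon> * r" using that Some by (simp add: symbol_class_def c'_def a_def)
      have "of_real ((cmod (f z))\<^sup>2) = (c' - b z) * f z"
        unfolding f_def complex_mod_cnj by (simp only: complex_norm_square)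
      then have "(w - b z) * f z * 1 - of_real ((cmod (f z))\<^sup>2) = (w - c') * f z" by (simp add: algebra_simps)
      then show ?thesis using mult_right_mono[OF w, of "cmod (f z)"] by (simp add: norm_mult mult.assoc)
    qed
    have "(\<integral>z. r * cmod (f z) \<partial>M) \<le> r * l2norm M f"
      using square_integrable_integrable(2)[OF f] r(2) by simp
    also have le: "\<dots> \<le> (l2norm M f)\<^sup>2" using rf by (simp add: power2_eq_square mult_right_mono)
    finally show "(\<integral>z. r * cmod (f z) \<partial>M) \<le> (\<integral>z. (cmod (f z))\<^sup>2 \<partial>M)" by (simp add: If)
    show "r * l2norm M f * 1 \<le> (\<integral>z. (cmod (f z))\<^sup>2 \<partial>M)" using le by (simp add: If)
    show "0 < (\<integral>z. (cmod (f z))\<^sup>2 \<partial>M)" using rf r(2) by (simp add: If)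
  qed (use f r in auto)
next
  case None
  define a where "a = (\<integral>z. b z \<partial>M)"
  have ba: "square_integrable M (\<lambda>z. b z - a)" by (rule square_integrable_diff_const[OF b])
  show ?thesis
  proof (rule that[of "\<lambda>_. 1" "\<lambda>w. 1 / (w - a)" "\<lambda>_. 1" "\<lambda>z. cmod (b z - a) / r" "1 / (R * r)"])
    show "integrable M (\<lambda>z. cmod (b z - a) / r)"
      using square_integrable_integrable(1)[OF ba] by auto
    have Rr: "0 < R * r" using R r by simp
    show "cmod (1 / (w - a)) \<le> 1 / (R * r)" if "w \<in> symbol_class (\<integral>z. b z \<partial>M) r \<epsilon> R s" for w
      using that None Rr by (auto simp: symbol_class_def a_def norm_divide intro!: frac_le)
    show "cmod ((w - b z) * 1 * (1 / (w - a)) - of_real 1) \<le> \<epsilon> * (cmod (b z - a) / r)"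
      if "w \<in> symbol_class (\<integral>z. b z \<partial>M) r \<epsilon> R s" for w z
    proof -
      have w: "R * r < cmod (w - a)" using that None by (simp add: symbol_class_def a_def)
      then have "w \<noteq> a" using Rr by auto
      then have "(w - b z) * 1 * (1 / (w - a)) - of_real 1 = (a - b z) / (w - a)" by (simp add: field_simps)
      then have "cmod ((w - b z) * 1 * (1 / (w - a)) - of_real 1) = cmod (b z - a) / cmod (w - a)"
        by (simp add: norm_divide norm_minus_commute)
      also have "\<dots> \<le> cmod (b z - a) / (R * r)" using w Rr less_trans[OF Rr w] R(1) r(2)
          by (intro divide_left_mono mult_pos_pos) auto
      also have "\<dots> = 1 / R * (cmod (b z - a) / r)" by simp
      also have "\<dots> \<le> \<epsilon> * (cmod (b z - a) / r)" using R r by (intro mult_right_mono) auto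
      finally show ?thesis .
    qed
    show "(\<integral>z. cmod (b z - a) / r \<partial>M) \<le> (\<integral>z. 1 \<partial>M)"
      using square_integrable_integrable(2)[OF ba] r by (simp add: a_def prob_space)
    show "r * l2norm M (\<lambda>_. 1) * (1 / (R * r)) \<le> (\<integral>z. 1 \<partial>M)" using R r by (simp add: prob_space)
    show "0 < (\<integral>z. (1::real) \<partial>M)" by (simp add: prob_space)
  qed (use r R in auto)
qed

text \<open>
  The test inequality for a kernel \<open>K\<close> that includes the differences of symbols. As the test functions
  may be unbounded, convergence of the integral is one of its premises.
\<close>

definition trilinear_bound :: "'c measure \<Rightarrow> 'b measure \<Rightarrow> ('c \<times> 'b \<times> 'b \<Rightarrow> complex) \<Rightarrow> real \<Rightarrow> bool" where
  "trilinear_bound P' P K N \<longleftrightarrow> (\<forall>f1 f2 h s. square_integrable P f1 \<longrightarrow> square_integrable P f2 \<longrightarrow>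
     h \<in> borel_measurable P' \<longrightarrow> (\<forall>x. cmod (h x) \<le> s) \<longrightarrow>
     integrable (P' \<Otimes>\<^sub>M (P \<Otimes>\<^sub>M P)) (\<lambda>w. K w * (f1 (fst (snd w)) * f2 (snd (snd w)) * h (fst w))) \<longrightarrow>
     cmod (\<integral>w. K w * (f1 (fst (snd w)) * f2 (snd (snd w)) * h (fst w)) \<partial>(P' \<Otimes>\<^sub>M (P \<Otimes>\<^sub>M P)))
       \<le> N * l2norm P f1 * l2norm P f2 * s)"

lemma trilinear_boundD:
  assumes "trilinear_bound P' P K N" "square_integrable P f1" "square_integrable P f2"
    "h \<in> borel_measurable P'" "\<And>x. cmod (h x) \<le> s"
    "integrable (P' \<Otimes>\<^sub>M (P \<Otimes>\<^sub>M P)) (\<lambda>w. K w * (f1 (fst (snd w)) * f2 (snd (snd w)) * h (fst w)))"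
  shows "cmod (\<integral>w. K w * (f1 (fst (snd w)) * f2 (snd (snd w)) * h (fst w)) \<partial>(P' \<Otimes>\<^sub>M (P \<Otimes>\<^sub>M P)))
       \<le> N * l2norm P f1 * l2norm P f2 * s"
  using assms unfolding trilinear_bound_def by blast

context averaged_kernel begin

text \<open>
  One pair of classes has mass at least \<open>p\<close> among the points \<open>x\<close>. On it the two pairs of test
  functions make the integrand nearly \<open>k g1 g2\<close>, and the gains of both symbols together produce the
  factor \<open>r1 r2\<close>. The exceptional proportion \<open>e\<close> has to be small compared with \<open>p\<close>, hence is chosen
  after the net.
\<close>

lemma separated_oscillation_bound:
  fixes C0 :: "complex set"
  assumes b1: "square_integrable P b1" and b2: "square_integrable P b2"
    and c1 [measurable]: "c1 \<in> borel_measurable P'" and c2 [measurable]: "c2 \<in> borel_measurable P'"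
    and r1: "r1 = l2norm P (\<lambda>z. b1 z - (\<integral>z. b1 z \<partial>P))" "0 < r1"
    and r2: "r2 = l2norm P (\<lambda>z. b2 z - (\<integral>z. b2 z \<partial>P))" "0 < r2"
    and R: "96 * L\<^sup>2 \<le> R" and net: "finite C0" "cball 0 R \<subseteq> (\<Union>c\<in>C0. cball c (1 / R))"
    and p: "p = 1 / (real (card C0) + 1)\<^sup>2" and e: "(1 + L) * e \<le> p / 4"
    and N0: "0 \<le> N"
    and bound: "trilinear_bound P' P (\<lambda>w. k w * ((c1 (fst w) - b1 (fst (snd w))) * (c2 (fst w) - b2 (snd (snd w))))) N"
  shows "r1 * r2 \<le> 2 * N / p"
proof -
  define \<epsilon> where "\<epsilon> = 1 / R"
  have "L * 1 \<le> L\<^sup>2" using L_ge_1 by (simp add: power2_eq_square)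
  then have RL: "12 * L \<le> R" using R L_ge_1 by simp
  then have R1: "1 \<le> R" "1 / R \<le> \<epsilon>" using L_ge_1 by (auto simp: \<epsilon>_def)
  have \<epsilon>: "0 < \<epsilon>" "\<epsilon> \<le> 1" "L * \<epsilon> \<le> 1 / 12" using R1 RL by (auto simp: \<epsilon>_def field_simps)
  have net': "cball 0 R \<subseteq> (\<Union>c\<in>C0. cball c \<epsilon>)" using net(2) by (simp add: \<epsilon>_def)
  define I where "I = insert None (Some ` C0) \<times> insert None (Some ` C0)"
  define A where "A s = {x \<in> space P'. c1 x \<in> symbol_class (\<integral>z. b1 z \<partial>P) r1 \<epsilon> R (fst s)
      \<and> c2 x \<in> symbol_class (\<integral>z. b2 z \<partial>P) r2 \<epsilon> R (snd s)}" for s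
  have cardI: "real (card I) = (real (card C0) + 1)\<^sup>2"
  proof -
    have "card (insert None (Some ` C0)) = card C0 + 1"
      using net(1) by (subst card_insert_disjoint) (auto simp: card_image)
    then show ?thesis unfolding I_def card_cartesian_product by (simp add: power2_eq_square algebra_simps)
  qed
  have p0: "0 < p" by (simp add: p)
  have "\<exists>s\<in>I. 1 / real (card I) \<le> P'.prob (A s)"
  proof (rule P'.pigeonhole_prob)
    show "finite I" using net(1) by (simp add: I_def)
    show "A s \<in> P'.events" for s unfolding A_def by measurable
    show "space P' \<subseteq> (\<Union>s\<in>I. A s)"
    proof
      fix x assume x: "x \<in> space P'"
      obtain s1 s2 where "s1 \<in> insert None (Some ` C0)" "c1 x \<in> symbol_class (\<integral>z. b1 z \<partial>P) r1 \<epsilon> R s1"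
        "s2 \<in> insert None (Some ` C0)" "c2 x \<in> symbol_class (\<integral>z. b2 z \<partial>P) r2 \<epsilon> R s2"
        using symbol_class_cover[OF net'] r1(2) r2(2) by metis
      then have "(s1, s2) \<in> I" "x \<in> A (s1, s2)" using x by (auto simp: I_def A_def)
      then show "x \<in> (\<Union>s\<in>I. A s)" by blast
    qed
  qed (simp_all add: P'.prob_space)
  then obtain s where "1 / real (card I) \<le> P'.prob (A s)" by blast
  then have pE: "p \<le> P'.prob (A s)" by (simp add: p cardI)
  define E where "E = A s"
  have E [measurable]: "E \<in> sets P'" unfolding E_def A_def by measurable
  obtain f1 \<phi>1 g1 G1 S1 where 1: "square_integrable P f1" "\<phi>1 \<in> borel_measurable borel"
    "integrable P g1" "\<And>z. 0 \<le> g1 z" "integrable P G1" "\<And>z. 0 \<le> G1 z"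
    "0 \<le> S1" "\<And>w. w \<in> symbol_class (\<integral>z. b1 z \<partial>P) r1 \<epsilon> R (fst s) \<Longrightarrow> cmod (\<phi>1 w) \<le> S1"
    "\<And>w z. w \<in> symbol_class (\<integral>z. b1 z \<partial>P) r1 \<epsilon> R (fst s) \<Longrightarrow> cmod ((w - b1 z) * f1 z * \<phi>1 w - of_real (g1 z)) \<le> \<epsilon> * G1 z"
    "(\<integral>z. G1 z \<partial>P) \<le> (\<integral>z. g1 z \<partial>P)" "r1 * l2norm P f1 * S1 \<le> (\<integral>z. g1 z \<partial>P)" "0 < (\<integral>z. g1 z \<partial>P)"
    using P.class_test_functions[OF b1 r1 R1] by metis
  obtain f2 \<phi>2 g2 G2 S2 where 2: "square_integrable P f2" "\<phi>2 \<in> borel_measurable borel"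
    "integrable P g2" "\<And>z. 0 \<le> g2 z" "integrable P G2" "\<And>z. 0 \<le> G2 z"
    "0 \<le> S2" "\<And>w. w \<in> symbol_class (\<integral>z. b2 z \<partial>P) r2 \<epsilon> R (snd s) \<Longrightarrow> cmod (\<phi>2 w) \<le> S2"
    "\<And>w z. w \<in> symbol_class (\<integral>z. b2 z \<partial>P) r2 \<epsilon> R (snd s) \<Longrightarrow> cmod ((w - b2 z) * f2 z * \<phi>2 w - of_real (g2 z)) \<le> \<epsilon> * G2 z"
    "(\<integral>z. G2 z \<partial>P) \<le> (\<integral>z. g2 z \<partial>P)" "r2 * l2norm P f2 * S2 \<le> (\<integral>z. g2 z \<partial>P)" "0 < (\<integral>z. g2 z \<partial>P)"
    using P.class_test_functions[OF b2 r2 R1] by metis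
  have [measurable]: "f1 \<in> borel_measurable P" "f2 \<in> borel_measurable P" "b1 \<in> borel_measurable P" "b2 \<in> borel_measurable P"
    "\<phi>1 \<in> borel_measurable borel" "\<phi>2 \<in> borel_measurable borel"
    using 1 2 b1 b2 by (auto simp: square_integrable_def)
  define m1 m2 where "m1 = (\<integral>z. g1 z \<partial>P)" and "m2 = (\<integral>z. g2 z \<partial>P)"
  define h where "h x = indicator E x * (\<phi>1 (c1 x) * \<phi>2 (c2 x))" for x
  define \<Phi> where "\<Phi> w = k w * ((c1 (fst w) - b1 (fst (snd w))) * (c2 (fst w) - b2 (snd (snd w))))
      * (f1 (fst (snd w)) * f2 (snd (snd w)) * h (fst w))" for w
  define u where "u z = g1 (fst z) * g2 (snd z)" for z
  define v where "v z = \<epsilon> * (g1 (fst z) * G2 (snd z)) + \<epsilon> * (G1 (fst z) * g2 (snd z)) + \<epsilon> * \<epsilon> * (G1 (fst z) * G2 (snd z))" for z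
  have [measurable]: "h \<in> borel_measurable P'" unfolding h_def by measurable
  have hS: "cmod (h x) \<le> S1 * S2" for x
    using 1(7,8) 2(7,8) by (auto simp: h_def E_def A_def norm_mult split: split_indicator intro!: mult_mono)
  have ui: "integrable (P \<Otimes>\<^sub>M P) u" and uI: "(\<integral>z. u z \<partial>(P \<Otimes>\<^sub>M P)) = m1 * m2"
    using PP.integral_tensor[OF 1(3) 2(3)] by (simp_all add: u_def[abs_def] m1_def m2_def)
  note t1 = PP.integral_tensor[OF 1(3) 2(5)] and t2 = PP.integral_tensor[OF 1(5) 2(3)] and t3 = PP.integral_tensor[OF 1(5) 2(5)]
  have vi: "integrable (P \<Otimes>\<^sub>M P) v"
    unfolding v_def[abs_def] using t1 t2 t3 by (intro Bochner_Integration.integrable_add integrable_mult_right) auto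
  have "(\<integral>z. v z \<partial>(P \<Otimes>\<^sub>M P)) = \<epsilon> * (m1 * (\<integral>z. G2 z \<partial>P)) + \<epsilon> * ((\<integral>z. G1 z \<partial>P) * m2)
      + \<epsilon> * \<epsilon> * ((\<integral>z. G1 z \<partial>P) * (\<integral>z. G2 z \<partial>P))"
    unfolding v_def[abs_def] using t1 t2 t3
    by (simp add: m1_def m2_def Bochner_Integration.integral_add Bochner_Integration.integrable_add)
  also have "\<dots> \<le> \<epsilon> * (m1 * m2) + \<epsilon> * (m1 * m2) + \<epsilon> * 1 * (m1 * m2)"
    using 1 2 \<epsilon> by (intro add_mono mult_mono) (auto simp: m1_def m2_def)
  finally have vI: "(\<integral>z. v z \<partial>(P \<Otimes>\<^sub>M P)) \<le> 3 * \<epsilon> * (m1 * m2)" by simp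
  have near: "cmod (\<Phi> (x, z) - k (x, z) * of_real (indicator E x * u z)) \<le> L * (indicator E x * v z)"
    if "x \<in> space P'" "z \<in> space (P \<Otimes>\<^sub>M P)" for x z
  proof (cases "x \<in> E")
    case True
    define A1 where "A1 = (c1 x - b1 (fst z)) * f1 (fst z) * \<phi>1 (c1 x)"
    define A2 where "A2 = (c2 x - b2 (snd z)) * f2 (snd z) * \<phi>2 (c2 x)"
    have d1: "cmod (A1 - of_real (g1 (fst z))) \<le> \<epsilon> * G1 (fst z)"
      unfolding A1_def by (rule 1(9)) (use True in \<open>auto simp: E_def A_def\<close>)
    have d2: "cmod (A2 - of_real (g2 (snd z))) \<le> \<epsilon> * G2 (snd z)"
      unfolding A2_def by (rule 2(9)) (use True in \<open>auto simp: E_def A_def\<close>)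
    have "\<Phi> (x, z) - k (x, z) * of_real (indicator E x * u z)
        = k (x, z) * (A1 * A2 - of_real (g1 (fst z)) * of_real (g2 (snd z)))"
      using True by (simp add: \<Phi>_def h_def u_def A1_def A2_def algebra_simps)
    moreover have "cmod (A1 * A2 - of_real (g1 (fst z)) * of_real (g2 (snd z))) \<le> v z"
    proof -
      have eq: "A1 * A2 - of_real (g1 (fst z)) * of_real (g2 (snd z))
          = of_real (g1 (fst z)) * (A2 - of_real (g2 (snd z))) + (A1 - of_real (g1 (fst z))) * of_real (g2 (snd z))
            + (A1 - of_real (g1 (fst z))) * (A2 - of_real (g2 (snd z)))" by (simp add: algebra_simps)
      have "cmod (A1 * A2 - of_real (g1 (fst z)) * of_real (g2 (snd z)))
          \<le> g1 (fst z) * (\<epsilon> * G2 (snd z)) + (\<epsilon> * G1 (fst z)) * g2 (snd z) + (\<epsilon> * G1 (fst z)) * (\<epsilon> * G2 (snd z))"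
        unfolding eq using 1(4,6) 2(4,6) d1 d2 \<epsilon>(1)
        by (intro order_trans[OF norm_triangle_ineq] add_mono) (auto simp: norm_mult intro!: mult_mono)
      then show ?thesis by (simp add: v_def algebra_simps)
    qed
    ultimately show ?thesis using True L_ge_1 by (auto simp: norm_mult intro!: mult_mono k_bound)
  next
    case False then show ?thesis by (simp add: \<Phi>_def h_def)
  qed
  have \<Phi>m: "\<Phi> \<in> borel_measurable T" unfolding \<Phi>_def[abs_def] by measurable
  have u0: "0 \<le> u z" for z using 1(4) 2(4) by (simp add: u_def)
  note kp = kernel_perturbation[OF \<Phi>m E ui vi u0 near]
  have m0: "0 < m1 * m2" using 1 2 by (simp add: m1_def m2_def)
  have "p / 2 * (m1 * m2) \<le> (measure P' E - p / 4 - measure P' E / 4) * (m1 * m2)"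
    using pE m0 by (intro mult_right_mono) (auto simp: E_def)
  also have "\<dots> \<le> (measure P' E - (1 + L) * e) * (m1 * m2) - L * measure P' E * (3 * \<epsilon> * (m1 * m2))"
  proof -
    have "L * measure P' E * (3 * \<epsilon> * (m1 * m2)) = 3 * (L * \<epsilon>) * measure P' E * (m1 * m2)" by simp
    also have "\<dots> \<le> 3 * (1 / 12) * measure P' E * (m1 * m2)"
      using \<epsilon>(3) m0 by (intro mult_right_mono) auto
    also have "\<dots> = measure P' E / 4 * (m1 * m2)" by simp
    finally show ?thesis using mult_right_mono[OF e, of "m1 * m2"] m0
      unfolding left_diff_distrib by linarith
  qed
  also have "\<dots> \<le> cmod (\<integral>w. \<Phi> w \<partial>T)"
  proof -
    have "L * measure P' E * (\<integral>z. v z \<partial>(P \<Otimes>\<^sub>M P)) \<le> L * measure P' E * (3 * \<epsilon> * (m1 * m2))"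
      using vI L_ge_1 by (intro mult_left_mono) auto
    then show ?thesis using kp(2) unfolding uI by linarith
  qed
  also have "\<dots> \<le> N * l2norm P f1 * l2norm P f2 * (S1 * S2)"
    unfolding \<Phi>_def by (rule trilinear_boundD[OF bound 1(1) 2(1) _ hS]) (use kp(1) in \<open>simp_all add: \<Phi>_def[abs_def]\<close>)
  finally have main: "p / 2 * (m1 * m2) \<le> N * l2norm P f1 * l2norm P f2 * (S1 * S2)" .
  have "(r1 * r2) * (p / 2) * (m1 * m2) \<le> (r1 * r2) * (N * l2norm P f1 * l2norm P f2 * (S1 * S2))"
    using main r1 r2 by (simp add: mult.assoc mult_left_mono)
  also have "\<dots> = N * ((r1 * l2norm P f1 * S1) * (r2 * l2norm P f2 * S2))" by simp
  also have "\<dots> \<le> N * (m1 * m2)"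
    using 1 2 r1 r2 N0 by (intro mult_left_mono mult_mono) (auto simp: m1_def m2_def)
  finally have "(r1 * r2) * (p / 2) \<le> N" using m0 by (rule mult_right_le_imp_le)
  then show ?thesis using p0 by (simp add: field_simps)
qed

end

section \<open>Oscillations tested within one cube\<close>

text \<open>
  Chebyshev's inequality.
\<close>

lemma (in prob_space) prob_le_l2norm:
  assumes f: "square_integrable M f" and t: "0 < t"
  shows "prob {z \<in> space M. t < cmod (f z)} \<le> (l2norm M f)\<^sup>2 / t\<^sup>2"
proof -
  have [measurable]: "f \<in> borel_measurable M" using f by (simp add: square_integrable_def)
  let ?A = "{z \<in> space M. t < cmod (f z)}"
  have A: "?A \<in> events" by measurable
  have Ai: "integrable M (indicat_real ?A)" using A by (intro integrable_real_indicator) (auto simp: emeasure_eq_measure)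
  have "t\<^sup>2 * prob ?A = (\<integral>z. t\<^sup>2 * indicator ?A z \<partial>M)" using A by simp
  also have "\<dots> \<le> (\<integral>z. (cmod (f z))\<^sup>2 \<partial>M)"
  proof (rule integral_mono)
    show "t\<^sup>2 * indicator ?A z \<le> (cmod (f z))\<^sup>2" for z
      using t by (auto split: split_indicator intro!: power_mono)
  qed (use f Ai in \<open>simp_all add: square_integrable_def\<close>)
  finally show ?thesis using t by (simp add: l2norm_squared field_simps)
qed

text \<open>
  With \<open>b\<close> small against \<open>1 / L\<close>, inserting the bound for \<open>r\<close> into the second inequality leaves on
  the right less than a third of \<open>X\<^sup>2 / 2\<close>, apart from terms that contain \<open>N\<close>.
\<close>

lemma quadratic_absorption:
  fixes X r N a b L :: real
  assumes "0 < X" "0 \<le> r" "0 \<le> N" "1 \<le> L" "1 \<le> a" "0 \<le> b" "b * L \<le> 1 / 16"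
    and r: "r \<le> a * N + b * X" and X: "X\<^sup>2 / 2 \<le> N * X + L * (2 * r * X + r\<^sup>2)"
  shows "X \<le> 13 * L * a * N"
proof (rule ccontr)
  assume "\<not> ?thesis"
  then have n: "13 * L * (a * N) < X" by simp
  define n where "n = a * N"
  have n0: "0 \<le> n" "N \<le> n" using assms mult_right_mono[of 1 a N] by (auto simp: n_def)
  have b1: "b \<le> 1 / 16" using assms mult_left_mono[of 1 L b] by simp
  have "r\<^sup>2 \<le> (n + b * X)\<^sup>2" using assms by (intro power_mono) (auto simp: n_def)
  also have "\<dots> \<le> 2 * n\<^sup>2 + 2 * (b * X)\<^sup>2"
    using sum_squares_bound[of n "b * X"] by (simp add: power2_sum)
  finally have "L * r\<^sup>2 \<le> L * (2 * n\<^sup>2 + 2 * (b * X)\<^sup>2)" using assms by (intro mult_left_mono) auto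
  moreover have "L * (2 * (b * X)\<^sup>2) \<le> X\<^sup>2 / 128"
  proof -
    have "L * (2 * (b * X)\<^sup>2) = 2 * (b * L) * b * X\<^sup>2" by (simp add: power2_eq_square)
    also have "\<dots> \<le> 2 * (1 / 16) * (1 / 16) * X\<^sup>2" using assms b1 by (intro mult_right_mono mult_mono) auto
    finally show ?thesis by simp
  qed
  moreover have "L * (2 * r * X) \<le> 2 * L * n * X + X\<^sup>2 / 8"
  proof -
    have "L * (2 * r * X) \<le> L * (2 * (n + b * X) * X)"
      using assms by (intro mult_left_mono mult_right_mono) (auto simp: n_def)
    also have "\<dots> = 2 * L * n * X + 2 * (b * L) * X\<^sup>2" by (simp add: algebra_simps power2_eq_square)
    also have "2 * (b * L) * X\<^sup>2 \<le> 2 * (1 / 16) * X\<^sup>2" using assms by (intro mult_right_mono) auto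
    finally show ?thesis by simp
  qed
  moreover have "N * X \<le> L * n * X"
  proof -
    have "N \<le> L * n" using n0 assms mult_right_mono[of 1 L n] by simp
    then show ?thesis using assms by (intro mult_right_mono) auto
  qed
  ultimately have m: "X\<^sup>2 / 4 \<le> 3 * (L * n) * X + 2 * L * n\<^sup>2 + X\<^sup>2 * (1 / 8 + 1 / 128 - 1 / 4)"
    using X by (simp add: algebra_simps)
  have Ln: "13 * (L * n) \<le> X" using n by (simp add: n_def)
  then have "13 * (L * n) * X \<le> X * X" using assms by (intro mult_right_mono) auto
  moreover have "169 * (L * n\<^sup>2) \<le> X\<^sup>2"
  proof -
    have "169 * (L * n\<^sup>2) \<le> L * (169 * (L * n\<^sup>2))"
      using mult_right_mono[of 1 L "169 * (L * n\<^sup>2)"] assms by simp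
    also have "\<dots> = (13 * (L * n))\<^sup>2" by (simp add: power2_eq_square)
    also have "\<dots> \<le> X\<^sup>2" using Ln n0 assms by (intro power_mono) auto
    finally show ?thesis .
  qed
  moreover have "0 < X\<^sup>2" using assms by simp
  ultimately show False using m by (simp add: power2_eq_square)
qed

context averaged_kernel begin

text \<open>
  Both differences compare the points \<open>z1\<close> and \<open>z2\<close> of one cube. Chebyshev's inequality therefore
  removes the unbounded classes, and a class with mass at least \<open>p / 2\<close> remains, on which \<open>b1\<close> and
  \<open>b2\<close> are nearly constant. Subtracting these constants changes no difference. Of the four products
  \<open>B1 z2 * B2 z2\<close>, \<open>B1 z2 * B2 z1\<close>, \<open>B1 z1 * B2 z2\<close>, \<open>B1 z1 * B2 z1\<close> in the expansion the first is
  dominant when \<open>z1\<close> is in the class, and the third one when the test functions are conjugates of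
  \<open>B1\<close> and \<open>B2\<close>, provided that \<open>B1 * B2\<close> is under control.
\<close>

lemma diagonal_oscillation_bound:
  fixes C0 :: "complex set"
  assumes b1: "square_integrable P b1" and b2: "square_integrable P b2"
    and b12: "square_integrable P (\<lambda>z. b1 z * b2 z)"
    and r1: "r1 = l2norm P (\<lambda>z. b1 z - (\<integral>z. b1 z \<partial>P))" "0 < r1"
    and r2: "r2 = l2norm P (\<lambda>z. b2 z - (\<integral>z. b2 z \<partial>P))" "0 < r2"
    and R: "96 * L\<^sup>2 \<le> R" and net: "finite C0" "C0 \<subseteq> cball 0 R" "cball 0 R \<subseteq> (\<Union>c\<in>C0. cball c (1 / R))"
    and p: "p = 1 / (real (card C0) + 1)\<^sup>2" and e: "(1 + L) * e \<le> p / 4"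
    and N0: "0 \<le> N"
    and bound: "trilinear_bound P' P (\<lambda>w. k w * ((b1 (snd (snd w)) - b1 (fst (snd w))) * (b2 (snd (snd w)) - b2 (fst (snd w))))) N"
  shows "r1 * r2 \<le> 52 * L / p * N"
    and "l2norm P (\<lambda>z. (b1 z - (\<integral>z. b1 z \<partial>P)) * (b2 z - (\<integral>z. b2 z \<partial>P))) \<le> 212 * R\<^sup>2 * L / p * N"
proof -
  define a1 a2 where "a1 = (\<integral>z. b1 z \<partial>P)" and "a2 = (\<integral>z. b2 z \<partial>P)"
  define \<epsilon> where "\<epsilon> = 1 / R"
  have "L * 1 \<le> L\<^sup>2" using L_ge_1 by (simp add: power2_eq_square)
  then have R96: "96 \<le> R" using R L_ge_1 by simp
  have \<epsilon>: "0 < \<epsilon>" "\<epsilon> \<le> 1" using R96 by (auto simp: \<epsilon>_def)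
  have L\<epsilon>: "6 * L * \<epsilon> * L \<le> 1 / 16" using R96 R by (simp add: \<epsilon>_def field_simps power2_eq_square)
  have p01: "0 < p" "p \<le> 1"
    using one_le_power[of "real (card C0) + 1" 2] by (simp_all add: p divide_le_eq_1)
  have [measurable]: "b1 \<in> borel_measurable P" "b2 \<in> borel_measurable P"
    using b1 b2 by (auto simp: square_integrable_def)
  define A where "A s = {z \<in> space P. b1 z \<in> symbol_class a1 r1 \<epsilon> R (Some (fst s))
      \<and> b2 z \<in> symbol_class a2 r2 \<epsilon> R (Some (snd s))}" for s :: "complex \<times> complex"
  define B where "B = {z \<in> space P. cmod (b1 z - a1) \<le> R * r1 \<and> cmod (b2 z - a2) \<le> R * r2}"
  have [measurable]: "A s \<in> sets P" "B \<in> sets P" for s unfolding A_def B_def by measurable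
  have far: "P.prob {z \<in> space P. R * r < cmod (b z - (\<integral>z. b z \<partial>P))} \<le> 1 / 4"
    if "square_integrable P b" "r = l2norm P (\<lambda>z. b z - (\<integral>z. b z \<partial>P))" "0 < r" for b r
  proof -
    have "P.prob {z \<in> space P. R * r < cmod (b z - (\<integral>z. b z \<partial>P))} \<le> r\<^sup>2 / (R * r)\<^sup>2"
      using P.prob_le_l2norm[OF P.square_integrable_diff_const[OF that(1)], of "R * r"] that R96 by simp
    also have "\<dots> = 1 / R\<^sup>2" using that R96 by (simp add: power_mult_distrib)
    also have "\<dots> \<le> 1 / 2\<^sup>2" using R96 by (intro divide_left_mono power_mono) auto
    finally show ?thesis by simp
  qed
  have Bhalf: "1 / 2 \<le> P.prob B"
  proof -
    have "P.prob (space P - B) \<le> P.prob ({z \<in> space P. R * r1 < cmod (b1 z - a1)} \<union> {z \<in> space P. R * r2 < cmod (b2 z - a2)})"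
      by (rule P.finite_measure_mono) (auto simp: B_def)
    also have "\<dots> \<le> P.prob {z \<in> space P. R * r1 < cmod (b1 z - a1)} + P.prob {z \<in> space P. R * r2 < cmod (b2 z - a2)}"
      by (rule measure_Un_le) measurable
    also have "\<dots> \<le> 1 / 4 + 1 / 4" unfolding a1_def a2_def by (intro add_mono far b1 b2 r1 r2)
    finally show ?thesis using P.prob_compl[of B] by simp
  qed
  have net': "cball 0 R \<subseteq> (\<Union>c\<in>C0. cball c \<epsilon>)" using net(3) by (simp add: \<epsilon>_def)
  have "\<exists>s\<in>C0 \<times> C0. (1 / 2) / real (card (C0 \<times> C0)) \<le> P.prob (A s)"
  proof (rule P.pigeonhole_prob)
    show "B \<subseteq> (\<Union>s\<in>C0 \<times> C0. A s)"
    proof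
      fix z assume z: "z \<in> B"
      obtain s1 s2 where "s1 \<in> C0" "b1 z \<in> symbol_class a1 r1 \<epsilon> R (Some s1)"
        "s2 \<in> C0" "b2 z \<in> symbol_class a2 r2 \<epsilon> R (Some s2)"
        using symbol_class_near[OF net' r1(2)] symbol_class_near[OF net' r2(2)] z unfolding B_def by blast
      then have "(s1, s2) \<in> C0 \<times> C0" "z \<in> A (s1, s2)" using z by (auto simp: A_def B_def)
      then show "z \<in> (\<Union>s\<in>C0 \<times> C0. A s)" by blast
    qed
  qed (use net(1) Bhalf in auto)
  then obtain s where s: "s \<in> C0 \<times> C0" "(1 / 2) / real (card (C0 \<times> C0)) \<le> P.prob (A s)" by blast
  define E where "E = A s"
  have [measurable]: "E \<in> sets P" by (simp add: E_def)
  define q where "q = P.prob E"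
  have pq: "p / 2 \<le> q"
  proof -
    have "0 < card C0" using s net(1) by (auto simp: card_gt_0_iff)
    then have "p \<le> 1 / (real (card C0))\<^sup>2"
      unfolding p by (intro divide_left_mono power_mono) auto
    then have "p / 2 \<le> (1 / 2) / real (card (C0 \<times> C0))"
      unfolding card_cartesian_product by (simp add: power2_eq_square)
    then show ?thesis using s(2) by (simp add: q_def E_def)
  qed
  have q01: "0 < q" "q \<le> 1" using pq p01 by (auto simp: q_def)
  \<comment> \<open>the means of \<open>B1\<close> and \<open>B2\<close> are \<open>- d1\<close> and \<open>- d2\<close>; their size, at most \<open>R r1\<close> and \<open>R r2\<close>, enters when the
    product of the centred symbols is recovered at the end\<close>
  define d1 d2 where "d1 = of_real r1 * fst s" and "d2 = of_real r2 * snd s"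
  define B1 B2 where "B1 z = b1 z - (a1 + d1)" and "B2 z = b2 z - (a2 + d2)" for z
  have [measurable]: "B1 \<in> borel_measurable P" "B2 \<in> borel_measurable P"
    unfolding B1_def[abs_def] B2_def[abs_def] by measurable
  have E1: "cmod (B1 z) \<le> \<epsilon> * r1" "cmod (B2 z) \<le> \<epsilon> * r2" if "z \<in> E" for z
    using that by (auto simp: E_def A_def symbol_class_def B1_def B2_def d1_def d2_def)
  have S1: "square_integrable P B1" and S2: "square_integrable P B2"
    unfolding B1_def[abs_def] B2_def[abs_def] by (intro P.square_integrable_diff_const b1 b2)+
  have S12: "square_integrable P (\<lambda>z. B1 z * B2 z)"
  proof -
    have "square_integrable P (\<lambda>z. b1 z * b2 z + ((- (a2 + d2)) * b1 z + ((- (a1 + d1)) * b2 z + (a1 + d1) * (a2 + d2))))"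
      by (intro square_integrable_add square_integrable_cmult P.square_integrable_const b1 b2 b12)
    then show ?thesis by (simp add: B1_def B2_def algebra_simps)
  qed
  define X1 X2 r where "X1 = l2norm P B1" and "X2 = l2norm P B2" and "r = l2norm P (\<lambda>z. B1 z * B2 z)"
  define X where "X = X1 * X2"
  have rX1: "r1 \<le> X1" "r2 \<le> X2"
    using P.l2norm_mean_le[OF b1] P.l2norm_mean_le[OF b2]
    by (simp_all add: r1(1) r2(1) X1_def X2_def B1_def[abs_def] B2_def[abs_def])
  have X0: "0 < X1" "0 < X2" "0 < X" "0 \<le> r" using rX1 r1(2) r2(2) by (auto simp: X_def r_def)
  have rX: "r1 * r2 \<le> X" "r1 * X2 \<le> X" "X1 * r2 \<le> X"
    using rX1 X0 r1(2) r2(2) by (auto simp: X_def intro!: mult_mono)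
  have half: "1 / 2 \<le> measure P' (space P') - (1 + L) * e" using e p01 by (simp add: P'.prob_space)
  have i12: "integrable P (\<lambda>z. (cmod (B1 z * B2 z))\<^sup>2)" using S12 by (simp add: square_integrable_def)
  have cs1: "integrable P (\<lambda>z. cmod (B1 z * B2 z) * cmod (B1 z))" "(\<integral>z. cmod (B1 z * B2 z) * cmod (B1 z) \<partial>P) \<le> r * X1"
    using integrable_norm[OF square_integrable_mult(1)[OF S12 S1]] square_integrable_mult(2)[OF S12 S1]
    by (simp_all add: norm_mult r_def X1_def)
  have cs2: "integrable P (\<lambda>z. cmod (B1 z * B2 z) * cmod (B2 z))" "(\<integral>z. cmod (B1 z * B2 z) * cmod (B2 z) \<partial>P) \<le> r * X2"
    using integrable_norm[OF square_integrable_mult(1)[OF S12 S2]] square_integrable_mult(2)[OF S12 S2]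
    by (simp_all add: norm_mult r_def X2_def)
  have n1: "integrable P (\<lambda>z. cmod (B1 z))" "(\<integral>z. cmod (B1 z) \<partial>P) \<le> X1"
    using integrable_norm[OF P.square_integrable_integrable(1)[OF S1]] P.square_integrable_integrable(2)[OF S1] by (simp_all add: X1_def)
  have n2: "integrable P (\<lambda>z. cmod (B2 z))" "(\<integral>z. cmod (B2 z) \<partial>P) \<le> X2"
    using integrable_norm[OF P.square_integrable_integrable(1)[OF S2]] P.square_integrable_integrable(2)[OF S2] by (simp_all add: X2_def)
  have n12: "integrable P (\<lambda>z. cmod (B1 z * B2 z))" "(\<integral>z. cmod (B1 z * B2 z) \<partial>P) \<le> r"
    using integrable_norm[OF P.square_integrable_integrable(1)[OF S12]] P.square_integrable_integrable(2)[OF S12] by (simp_all add: r_def)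
  have m1: "integrable P (\<lambda>z. (cmod (B1 z))\<^sup>2)" and m2: "integrable P (\<lambda>z. (cmod (B2 z))\<^sup>2)"
    using S1 S2 by (simp_all add: square_integrable_def)
  \<comment> \<open>first test: the indicator of the class against the conjugate of the product\<close>
  have r_le: "r \<le> 4 / p * N + 6 * L * \<epsilon> * X"
  proof (cases "r = 0")
    case True
    have "0 \<le> 4 / p * N + 6 * L * \<epsilon> * X" using N0 p01 L_ge_1 \<epsilon> X0 by (intro add_nonneg_nonneg mult_nonneg_nonneg) auto
    then show ?thesis using True by simp
  next
    case False
    then have rp: "0 < r" using X0 by simp
    define f1 :: "'b \<Rightarrow> complex" where "f1 = indicator E"
    define f2 where "f2 z = cnj (B1 z * B2 z)" for z
    have f1: "square_integrable P f1"
      by (rule square_integrable_bound(1)[OF P.square_integrable_const[of 1]]) (auto simp: f1_def split: split_indicator)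
    have f1n: "l2norm P f1 = sqrt q"
    proof -
      have "(cmod (f1 z))\<^sup>2 = indicator E z" for z by (simp add: f1_def split: split_indicator)
      then show ?thesis by (simp add: l2norm_def q_def)
    qed
    have f2: "square_integrable P f2" "l2norm P f2 = r"
      using square_integrable_cnj(1)[OF S12] by (simp_all add: f2_def[abs_def] r_def square_integrable_cnj(2) del: complex_cnj_mult)
    have [measurable]: "f1 \<in> borel_measurable P" "f2 \<in> borel_measurable P"
      using f1 f2 by (auto simp: square_integrable_def)
    define \<Phi> where "\<Phi> w = k w * ((b1 (snd (snd w)) - b1 (fst (snd w))) * (b2 (snd (snd w)) - b2 (fst (snd w))))
      * (f1 (fst (snd w)) * f2 (snd (snd w)) * 1)" for w
    define V where "V z = \<epsilon> * r1 * (cmod (B1 z * B2 z) * cmod (B2 z)) + \<epsilon> * r2 * (cmod (B1 z * B2 z) * cmod (B1 z))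
        + \<epsilon> * r1 * (\<epsilon> * r2) * cmod (B1 z * B2 z)" for z
    have Vi: "integrable P V" unfolding V_def[abs_def]
      using cs1(1) cs2(1) n12(1) by (intro Bochner_Integration.integrable_add integrable_mult_right)
    have "(\<integral>z. V z \<partial>P) = \<epsilon> * r1 * (\<integral>z. cmod (B1 z * B2 z) * cmod (B2 z) \<partial>P)
        + \<epsilon> * r2 * (\<integral>z. cmod (B1 z * B2 z) * cmod (B1 z) \<partial>P) + \<epsilon> * r1 * (\<epsilon> * r2) * (\<integral>z. cmod (B1 z * B2 z) \<partial>P)"
      unfolding V_def[abs_def] using cs1(1) cs2(1) n12(1)
      by (simp add: Bochner_Integration.integral_add Bochner_Integration.integrable_add del: norm_mult)
    also have "\<dots> \<le> \<epsilon> * r1 * (r * X2) + \<epsilon> * r2 * (r * X1) + \<epsilon> * r1 * (\<epsilon> * r2) * r"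
      using cs1(2) cs2(2) n12(2) \<epsilon> r1(2) r2(2) by (intro add_mono mult_left_mono) auto
    also have "\<dots> = \<epsilon> * r * (r1 * X2) + \<epsilon> * r * (X1 * r2) + \<epsilon> * (\<epsilon> * r * (r1 * r2))" by simp
    also have "\<dots> \<le> \<epsilon> * r * X + \<epsilon> * r * X + 1 * (\<epsilon> * r * X)"
      using rX \<epsilon> X0 r1(2) r2(2) by (intro add_mono mult_mono) auto
    finally have VI: "(\<integral>z. V z \<partial>P) \<le> 3 * \<epsilon> * r * X" by (simp add: mult_ac)
    have Ei: "integrable P (indicat_real E)" by (intro integrable_real_indicator) (auto simp: P.emeasure_eq_measure)
    note tu = PP.integral_tensor[OF Ei i12] and tv = PP.integral_tensor[OF Ei Vi]
    have \<Phi>m: "\<Phi> \<in> borel_measurable T" unfolding \<Phi>_def[abs_def] by measurable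
    have near: "cmod (\<Phi> (x, z) - k (x, z) * of_real (indicator (space P') x * (indicator E (fst z) * (cmod (B1 (snd z) * B2 (snd z)))\<^sup>2)))
        \<le> L * (indicator (space P') x * (indicator E (fst z) * V (snd z)))"
      if "x \<in> space P'" for x z
    proof (cases "fst z \<in> E")
      case True
      obtain z1 z2 where z: "z = (z1, z2)" by fastforce
      have eq: "\<Phi> (x, z) - k (x, z) * of_real ((cmod (B1 z2 * B2 z2))\<^sup>2)
          = k (x, z) * (cnj (B1 z2 * B2 z2) * (B1 z1 * B2 z1 - B1 z1 * B2 z2 - B1 z2 * B2 z1))"
        unfolding complex_norm_square using True
        by (simp add: \<Phi>_def z f1_def f2_def B1_def B2_def algebra_simps)
      have "cmod (B1 z1 * B2 z1 - B1 z1 * B2 z2 - B1 z2 * B2 z1)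
          \<le> cmod (B1 z1 * B2 z1) + cmod (B1 z1 * B2 z2) + cmod (B1 z2 * B2 z1)"
        by (intro order_trans[OF norm_triangle_ineq4] add_mono) auto
      also have "\<dots> \<le> \<epsilon> * r1 * (\<epsilon> * r2) + \<epsilon> * r1 * cmod (B2 z2) + cmod (B1 z2) * (\<epsilon> * r2)"
        unfolding norm_mult using E1[of z1] True z \<epsilon> r1(2) r2(2) by (intro add_mono mult_mono) auto
      finally have le: "cmod (B1 z1 * B2 z1 - B1 z1 * B2 z2 - B1 z2 * B2 z1)
          \<le> \<epsilon> * r1 * (\<epsilon> * r2) + \<epsilon> * r1 * cmod (B2 z2) + cmod (B1 z2) * (\<epsilon> * r2)" .
      have "cmod (cnj (B1 z2 * B2 z2) * (B1 z1 * B2 z1 - B1 z1 * B2 z2 - B1 z2 * B2 z1)) \<le> V z2"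
        unfolding norm_mult[of "cnj (B1 z2 * B2 z2)"] complex_mod_cnj
        by (rule order_trans[OF mult_left_mono[OF le]]) (simp_all add: V_def algebra_simps)
      then show ?thesis using that True z L_ge_1 eq by (simp add: norm_mult[of "k (x, (z1,z2))"] mult_mono k_bound)
    qed (simp add: \<Phi>_def f1_def)
    note kp = kernel_perturbation[OF \<Phi>m sets.top tu(1) tv(1) _ near]
    have "q * r\<^sup>2 / 2 - L * (q * (3 * \<epsilon> * r * X)) \<le> cmod (\<integral>w. \<Phi> w \<partial>T)"
    proof -
      have "q * r\<^sup>2 / 2 \<le> (measure P' (space P') - (1 + L) * e) * (q * r\<^sup>2)"
        using mult_right_mono[OF half, of "q * r\<^sup>2"] q01 by simp
      moreover have "L * (q * (\<integral>z. V z \<partial>P)) \<le> L * (q * (3 * \<epsilon> * r * X))"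
        using VI L_ge_1 q01 by (intro mult_left_mono) auto
      ultimately show ?thesis using kp(2) unfolding tu(2) tv(2)
        by (simp add: P'.prob_space q_def[symmetric] r_def l2norm_squared)
    qed
    also have "\<dots> \<le> N * l2norm P f1 * l2norm P f2 * 1"
      unfolding \<Phi>_def by (rule trilinear_boundD[OF bound f1 f2(1), of "\<lambda>_. 1"]) (use kp(1) in \<open>simp_all add: \<Phi>_def[abs_def]\<close>)
    finally have "q * r\<^sup>2 / 2 \<le> N * sqrt q * r + L * (q * (3 * \<epsilon> * r * X))" using f1n f2(2) by simp
    then have "(q * r / 2) * r \<le> (N * sqrt q + L * (q * (3 * \<epsilon> * X))) * r"
      by (simp add: algebra_simps power2_eq_square)
    then have 1: "q * r / 2 \<le> N * sqrt q + L * (q * (3 * \<epsilon> * X))" using rp by (rule mult_right_le_imp_le)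
    have "N * sqrt q \<le> q * (2 / p * N)"
    proof -
      have "sqrt q \<le> 1" using q01 by simp
      also have "1 \<le> q * (2 / p)" using pq p01 by (simp add: field_simps)
      finally have "N * sqrt q \<le> N * (q * (2 / p))" using N0 by (intro mult_left_mono) auto
      also have "\<dots> = q * (2 / p * N)" by simp
      finally show ?thesis .
    qed
    then have "q * r / 2 \<le> q * (2 / p * N) + L * (q * (3 * \<epsilon> * X))" using 1 by linarith
    also have "\<dots> = (2 / p * N + L * (3 * \<epsilon> * X)) * q" by (simp add: distrib_right)
    finally have "(r / 2) * q \<le> (2 / p * N + L * (3 * \<epsilon> * X)) * q" by (simp add: mult.commute)
    then have "r / 2 \<le> 2 / p * N + L * (3 * \<epsilon> * X)" using q01(1) by (rule mult_right_le_imp_le)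
    then show ?thesis by simp
  qed
  \<comment> \<open>second test: the conjugates of the two symbols; the dominant product has a negative sign, and the
    constant \<open>-1\<close> as a function of \<open>x\<close> compensates for it\<close>
  have X_le: "X\<^sup>2 / 2 \<le> N * X + L * (2 * r * X + r\<^sup>2)"
  proof -
    define f1 where "f1 z = cnj (B1 z)" for z
    define f2 where "f2 z = cnj (B2 z)" for z
    have f1: "square_integrable P f1" "l2norm P f1 = X1"
      using square_integrable_cnj(1)[OF S1] by (simp_all add: f1_def[abs_def] X1_def square_integrable_cnj(2))
    have f2: "square_integrable P f2" "l2norm P f2 = X2"
      using square_integrable_cnj(1)[OF S2] by (simp_all add: f2_def[abs_def] X2_def square_integrable_cnj(2))
    have [measurable]: "f1 \<in> borel_measurable P" "f2 \<in> borel_measurable P"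
      using f1 f2 by (auto simp: square_integrable_def)
    define \<Phi> where "\<Phi> w = k w * ((b1 (snd (snd w)) - b1 (fst (snd w))) * (b2 (snd (snd w)) - b2 (fst (snd w))))
      * (f1 (fst (snd w)) * f2 (snd (snd w)) * (-1))" for w
    define v where "v z = cmod (B1 (fst z)) * (cmod (B1 (snd z) * B2 (snd z)) * cmod (B2 (snd z)))
        + cmod (B1 (fst z) * B2 (fst z)) * cmod (B1 (snd z) * B2 (snd z))
        + (cmod (B1 (fst z) * B2 (fst z)) * cmod (B1 (fst z))) * cmod (B2 (snd z))" for z
    note tu = PP.integral_tensor[OF m1 m2] and t1 = PP.integral_tensor[OF n1(1) cs2(1)]
      and t2 = PP.integral_tensor[OF n12(1) n12(1)] and t3 = PP.integral_tensor[OF cs1(1) n2(1)]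
    have vi: "integrable (P \<Otimes>\<^sub>M P) v" unfolding v_def[abs_def]
      using t1 t2 t3 by (intro Bochner_Integration.integrable_add) auto
    have "(\<integral>z. v z \<partial>(P \<Otimes>\<^sub>M P)) = (\<integral>z. cmod (B1 z) \<partial>P) * (\<integral>z. cmod (B1 z * B2 z) * cmod (B2 z) \<partial>P)
        + (\<integral>z. cmod (B1 z * B2 z) \<partial>P) * (\<integral>z. cmod (B1 z * B2 z) \<partial>P)
        + (\<integral>z. cmod (B1 z * B2 z) * cmod (B1 z) \<partial>P) * (\<integral>z. cmod (B2 z) \<partial>P)"
      unfolding v_def[abs_def] using t1 t2 t3
      by (simp add: Bochner_Integration.integral_add Bochner_Integration.integrable_add del: norm_mult)
    also have "\<dots> \<le> X1 * (r * X2) + r * r + (r * X1) * X2"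
      using cs1(2) cs2(2) n1(2) n2(2) n12(2) X0 by (intro add_mono mult_mono) auto
    also have "\<dots> = 2 * r * X + r\<^sup>2" by (simp add: X_def power2_eq_square)
    finally have vI: "(\<integral>z. v z \<partial>(P \<Otimes>\<^sub>M P)) \<le> 2 * r * X + r\<^sup>2" .
    have \<Phi>m: "\<Phi> \<in> borel_measurable T" unfolding \<Phi>_def[abs_def] by measurable
    have near: "cmod (\<Phi> (x, z) - k (x, z) * of_real (indicator (space P') x * ((cmod (B1 (fst z)))\<^sup>2 * (cmod (B2 (snd z)))\<^sup>2)))
        \<le> L * (indicator (space P') x * v z)"
      if "x \<in> space P'" for x z
    proof -
      obtain z1 z2 where z: "z = (z1, z2)" by fastforce
      have eq: "\<Phi> (x, z) - k (x, z) * of_real ((cmod (B1 z1))\<^sup>2 * (cmod (B2 z2))\<^sup>2)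
          = k (x, z) * (B1 z2 * cnj (B1 z1) * (B2 z1 * cnj (B2 z2)) - B1 z2 * B2 z2 * (cnj (B1 z1) * cnj (B2 z2))
              - B1 z1 * B2 z1 * (cnj (B1 z1) * cnj (B2 z2)))"
        unfolding complex_norm_square of_real_mult
        by (simp add: \<Phi>_def z f1_def f2_def B1_def B2_def algebra_simps)
      have "cmod (B1 z2 * cnj (B1 z1) * (B2 z1 * cnj (B2 z2)) - B1 z2 * B2 z2 * (cnj (B1 z1) * cnj (B2 z2))
              - B1 z1 * B2 z1 * (cnj (B1 z1) * cnj (B2 z2)))
          \<le> cmod (B1 z2 * cnj (B1 z1) * (B2 z1 * cnj (B2 z2))) + cmod (B1 z2 * B2 z2 * (cnj (B1 z1) * cnj (B2 z2)))
            + cmod (B1 z1 * B2 z1 * (cnj (B1 z1) * cnj (B2 z2)))"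
        by (intro order_trans[OF norm_triangle_ineq4] add_mono) auto
      also have "\<dots> = v z" by (simp add: v_def z norm_mult)
      finally show ?thesis using that z L_ge_1 eq by (simp add: norm_mult[of "k (x, (z1,z2))"] mult_mono k_bound)
    qed
    note kp = kernel_perturbation[OF \<Phi>m sets.top tu(1) vi _ near]
    have "X\<^sup>2 / 2 - L * (2 * r * X + r\<^sup>2) \<le> cmod (\<integral>w. \<Phi> w \<partial>T)"
    proof -
      have "X\<^sup>2 / 2 \<le> (measure P' (space P') - (1 + L) * e) * X\<^sup>2"
        using mult_right_mono[OF half, of "X\<^sup>2"] by simp
      moreover have "L * (\<integral>z. v z \<partial>(P \<Otimes>\<^sub>M P)) \<le> L * (2 * r * X + r\<^sup>2)"
        using vI L_ge_1 by (intro mult_left_mono) auto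
      ultimately show ?thesis using kp(2) unfolding tu(2)
        by (simp add: P'.prob_space X_def X1_def X2_def power_mult_distrib l2norm_squared)
    qed
    also have "\<dots> \<le> N * l2norm P f1 * l2norm P f2 * 1"
      unfolding \<Phi>_def by (rule trilinear_boundD[OF bound f1(1) f2(1), of "\<lambda>_. -1"]) (use kp(1) in \<open>simp_all add: \<Phi>_def[abs_def]\<close>)
    finally show ?thesis using f1 f2 by (simp add: X_def)
  qed
  have X_bd: "X \<le> 13 * L * (4 / p) * N"
  proof (rule quadratic_absorption[OF X0(3,4) N0 L_ge_1 _ _ L\<epsilon> r_le X_le])
    show "1 \<le> 4 / p" using p01 by simp
    show "0 \<le> 6 * L * \<epsilon>" using L_ge_1 \<epsilon> by simp
  qed
  then show "r1 * r2 \<le> 52 * L / p * N" using rX by simp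
  have r_bd: "r \<le> 14 * L * (4 / p) * N"
  proof -
    have "6 * L * \<epsilon> * X \<le> 1 * X"
    proof (rule mult_right_mono)
      have "6 * L * \<epsilon> \<le> 6 * L * \<epsilon> * L" using L_ge_1 \<epsilon> mult_left_mono[of 1 L "6 * L * \<epsilon>"] by simp
      then show "6 * L * \<epsilon> \<le> 1" using L\<epsilon> by simp
    qed (use X0 in simp)
    moreover have "4 / p * N \<le> L * (4 / p * N)" using L_ge_1 p01 N0 mult_right_mono[of 1 L "4 / p * N"] by simp
    ultimately show ?thesis using r_le X_bd by simp
  qed
  have d: "cmod d1 \<le> R * r1" "cmod d2 \<le> R * r2"
    using s(1) net(2) r1(2) r2(2) by (auto simp: d1_def d2_def norm_mult intro!: mult_left_mono)
  have R1: "1 \<le> R" using R96 by simp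
  have tri: "l2norm P (\<lambda>z. B1 z * B2 z + (d1 * B2 z + (d2 * B1 z + d1 * d2))) \<le> r + (cmod d1 * X2 + (cmod d2 * X1 + cmod (d1 * d2)))"
  proof -
    note s1 = square_integrable_cmult[OF S1] and s2 = square_integrable_cmult[OF S2] and c = P.square_integrable_const[of "d1 * d2"]
    note a = square_integrable_add[OF s1(1)[of d2] c]
    note a' = square_integrable_add[OF s2(1)[of d1] a(1)]
    note a'' = square_integrable_add[OF S12 a'(1)]
    show ?thesis using a''(2) a'(2) a(2) s1(2) s2(2) by (simp add: r_def X1_def X2_def)
  qed
  have "l2norm P (\<lambda>z. (b1 z - a1) * (b2 z - a2)) = l2norm P (\<lambda>z. B1 z * B2 z + (d1 * B2 z + (d2 * B1 z + d1 * d2)))"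
    by (simp add: B1_def B2_def algebra_simps)
  also note tri
  also have "r + (cmod d1 * X2 + (cmod d2 * X1 + cmod (d1 * d2))) \<le> r + (R\<^sup>2 * X + (R\<^sup>2 * X + R\<^sup>2 * X))"
  proof (intro add_left_mono add_mono)
    have RR: "R \<le> R\<^sup>2" using R1 by (simp add: power2_eq_square)
    have "cmod d1 * X2 \<le> (R * r1) * X2" using d X0 by (intro mult_right_mono) auto
    also have "\<dots> = R * (r1 * X2)" by simp
    also have "\<dots> \<le> R\<^sup>2 * X" using rX RR R1 r1(2) X0 by (intro mult_mono) auto
    finally show "cmod d1 * X2 \<le> R\<^sup>2 * X" .
    have "cmod d2 * X1 \<le> (R * r2) * X1" using d X0 by (intro mult_right_mono) auto
    also have "\<dots> = R * (X1 * r2)" by simp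
    also have "\<dots> \<le> R\<^sup>2 * X" using rX RR R1 r2(2) X0 by (intro mult_mono) auto
    finally show "cmod d2 * X1 \<le> R\<^sup>2 * X" .
    have "cmod (d1 * d2) \<le> (R * r1) * (R * r2)" unfolding norm_mult using d r1(2) R1 by (intro mult_mono) auto
    also have "\<dots> = R\<^sup>2 * (r1 * r2)" by (simp add: power2_eq_square)
    also have "\<dots> \<le> R\<^sup>2 * X" using rX by (intro mult_left_mono) auto
    finally show "cmod (d1 * d2) \<le> R\<^sup>2 * X" .
  qed
  also have "\<dots> \<le> 14 * L * (4 / p) * N + 3 * R\<^sup>2 * (13 * L * (4 / p) * N)"
  proof -
    have "3 * R\<^sup>2 * X \<le> 3 * R\<^sup>2 * (13 * L * (4 / p) * N)" using X_bd by (intro mult_left_mono) auto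
    then show ?thesis using r_bd by linarith
  qed
  also have "\<dots> \<le> R\<^sup>2 * (14 * L * (4 / p) * N) + 3 * R\<^sup>2 * (13 * L * (4 / p) * N)"
  proof -
    have "0 \<le> 14 * L * (4 / p) * N" using L_ge_1 p01 N0 by simp
    moreover have "1 \<le> R\<^sup>2" using R1 by simp
    ultimately show ?thesis using mult_right_mono[of 1 "R\<^sup>2" "14 * L * (4 / p) * N"] by linarith
  qed
  also have "\<dots> = 212 * R\<^sup>2 * L / p * N" by (simp add: field_simps)
  finally show "l2norm P (\<lambda>z. (b1 z - (\<integral>z. b1 z \<partial>P)) * (b2 z - (\<integral>z. b2 z \<partial>P))) \<le> 212 * R\<^sup>2 * L / p * N"
    by (simp add: a1_def a2_def)
qed

end

section \<open>Surface measure and cones\<close>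

lemma sigma_finite_completion:
  assumes "sigma_finite_measure M" shows "sigma_finite_measure (completion M)"
proof -
  interpret sigma_finite_measure M by fact
  obtain A where "countable A" "A \<subseteq> sets M" "\<Union>A = space M" "\<forall>a\<in>A. emeasure M a \<noteq> \<infinity>"
    using sigma_finite_countable by blast
  then show ?thesis
    by unfold_locales (rule exI[of _ A], auto)
qed

lemma AE_lebesgue_preimage:
  fixes f g :: "'a::euclidean_space \<Rightarrow> 'a"
  assumes "AE y in lebesgue. P y" "\<And>x. g (f x) = x" "g differentiable_on UNIV"
  shows "AE x in lebesgue. P (f x)"
proof -
  have "{y. \<not> P y} \<in> null_sets lebesgue" using assms(1) by (simp add: completion.AE_iff_null_sets)
  then have "negligible {y. \<not> P y}" by (simp add: negligible_iff_null_sets)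
  then have "negligible (g ` {y. \<not> P y})"
    by (rule negligible_differentiable_image_negligible[OF order_refl])
       (rule differentiable_on_subset[OF assms(3)], simp)
  then have "g ` {y. \<not> P y} \<in> null_sets lebesgue" by (simp add: negligible_iff_null_sets)
  then show ?thesis
    by (rule AE_I') (use assms(2) in \<open>force simp: image_iff\<close>)
qed

text \<open>
  The measure whose completion is surface measure. Its measurable sets are Borel sets, which makes it
  the source of Borel representatives.
\<close>

definition cone_measure :: "'a::euclidean_space measure" where
  "cone_measure = scale_measure (of_nat DIM('a))
     (distr (restrict_space lebesgue (ball 0 1 - {0})) (restrict_space borel (sphere 0 1)) (\<lambda>x. x /\<^sub>R norm x))"

lemma sphere_measure_eq: "sphere_measure = completion cone_measure"
  by (simp add: sphere_measure_def cone_measure_def)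

lemma space_cone_measure [simp]: "space cone_measure = sphere 0 1"
  by (simp add: cone_measure_def space_scale_measure space_restrict_space)

lemma sets_cone_measure [measurable_cong]: "sets cone_measure = sets (restrict_space borel (sphere 0 1))"
  by (simp add: cone_measure_def)

lemma normalize_measurable:
  "(\<lambda>x::'a::euclidean_space. x /\<^sub>R norm x) \<in> restrict_space lebesgue (ball 0 1 - {0}) \<rightarrow>\<^sub>M restrict_space borel (sphere 0 1)"
proof (rule measurable_restrict_space2)
  show "(\<lambda>x::'a. x /\<^sub>R norm x) \<in> space (restrict_space lebesgue (ball 0 1 - {0})) \<rightarrow> sphere 0 1"
    by (auto simp: space_restrict_space)
  have "(\<lambda>x::'a. x /\<^sub>R norm x) \<in> borel_measurable lborel" by measurable
  then show "(\<lambda>x::'a. x /\<^sub>R norm x) \<in> borel_measurable (restrict_space lebesgue (ball 0 1 - {0}))"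
    by (intro measurable_restrict_space1 measurable_completion)
qed

lemma cone_measure_cone:
  fixes N :: "'a::euclidean_space set"
  assumes "N \<in> sets cone_measure"
  shows "{x \<in> ball 0 1 - {0}. x /\<^sub>R norm x \<in> N} \<in> sets lebesgue"
    and "emeasure cone_measure N = of_nat DIM('a) * emeasure lebesgue {x \<in> ball 0 1 - {0}. x /\<^sub>R norm x \<in> N}"
proof -
  have N: "N \<in> sets (restrict_space borel (sphere 0 1))" using assms by (simp add: sets_cone_measure)
  have eq: "(\<lambda>x. x /\<^sub>R norm x) -` N \<inter> space (restrict_space lebesgue (ball 0 1 - {0})) = {x \<in> ball 0 1 - {0}. x /\<^sub>R norm x \<in> N}"
    by (auto simp: space_restrict_space)
  have B: "ball 0 1 - {0::'a} \<in> sets lebesgue" by simp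
  show 1: "{x \<in> ball 0 1 - {0}. x /\<^sub>R norm x \<in> N} \<in> sets lebesgue"
    using measurable_sets[OF normalize_measurable N] B unfolding eq
    by (subst (asm) sets_restrict_space_iff) auto
  show "emeasure cone_measure N = of_nat DIM('a) * emeasure lebesgue {x \<in> ball 0 1 - {0}. x /\<^sub>R norm x \<in> N}"
    unfolding cone_measure_def emeasure_scale_measure emeasure_distr[OF normalize_measurable N] eq
    by (subst emeasure_restrict_space) (use B in auto)
qed

text \<open>
  The cone over a null set of directions is null: within the unit ball by definition of the surface
  measure, and then everywhere by dilation.
\<close>

lemma AE_sphere_measure_cone:
  assumes "AE \<omega> in (sphere_measure :: 'a::euclidean_space measure). P \<omega>"
  shows "AE y in (lebesgue :: 'a measure). P (y /\<^sub>R norm y)"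
proof -
  have "AE \<omega> in (cone_measure :: 'a measure). P \<omega>"
    using assms unfolding sphere_measure_eq AE_completion_iff .
  then obtain N where N: "{\<omega> \<in> space cone_measure. \<not> P \<omega>} \<subseteq> N" "emeasure cone_measure N = 0"
    "N \<in> sets (cone_measure :: 'a measure)" by (rule AE_E)
  define Z where "Z = {x \<in> ball 0 1 - {0::'a}. x /\<^sub>R norm x \<in> N}"
  have "Z \<in> null_sets lebesgue"
    using cone_measure_cone[OF N(3)] N(2) by (auto simp: Z_def)
  then have "negligible Z" by (simp add: negligible_iff_null_sets)
  then have "negligible ((\<lambda>x. real n *\<^sub>R x) ` Z)" for n :: nat
    by (rule negligible_differentiable_image_negligible[OF order_refl])
       (intro derivative_intros)
  then have "negligible (\<Union>n::nat. (\<lambda>x. real n *\<^sub>R x) ` Z)" by (rule negligible_Union_nat)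
  then have "(\<Union>n::nat. (\<lambda>x. real n *\<^sub>R x) ` Z) \<union> {0} \<in> null_sets lebesgue"
    unfolding negligible_iff_null_sets by (intro null_sets.Un) auto
  then show ?thesis
  proof (rule AE_I')
    show "{y \<in> space lebesgue. \<not> P (y /\<^sub>R norm y)} \<subseteq> (\<Union>n::nat. (\<lambda>x. real n *\<^sub>R x) ` Z) \<union> {0}"
    proof
      fix y :: 'a assume "y \<in> {y \<in> space lebesgue. \<not> P (y /\<^sub>R norm y)}"
      then have P: "\<not> P (y /\<^sub>R norm y)" by simp
      show "y \<in> (\<Union>n::nat. (\<lambda>x. real n *\<^sub>R x) ` Z) \<union> {0}"
      proof (cases "y = 0")
        case False
        then have "y /\<^sub>R norm y \<in> N" using P N(1) by auto
        obtain n where n: "norm y < real n" using reals_Archimedean2 by blast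
        then have n0: "0 < real n" using norm_ge_zero[of y] by linarith
        define x where "x = (1 / real n) *\<^sub>R y"
        have "x /\<^sub>R norm x = y /\<^sub>R norm y" using n0 by (simp add: x_def inverse_eq_divide)
        moreover have "norm x < 1" "x \<noteq> 0" using n n0 False by (simp_all add: x_def)
        ultimately have "x \<in> Z" using \<open>y /\<^sub>R norm y \<in> N\<close> by (simp add: Z_def)
        moreover have "y = real n *\<^sub>R x" using n0 by (simp add: x_def)
        ultimately show ?thesis by blast
      qed simp
    qed
  qed
qed

lemma sigma_finite_sphere_measure: "sigma_finite_measure (sphere_measure :: 'a::euclidean_space measure)"
proof -
  have "finite_measure (cone_measure :: 'a measure)"
  proof
    have "sphere 0 1 \<in> sets (cone_measure :: 'a measure)" using sets.top[of "cone_measure :: 'a measure"] by simp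
    from cone_measure_cone(2)[OF this]
    have "emeasure cone_measure (sphere 0 (1::real) :: 'a set)
        = of_nat DIM('a) * emeasure lebesgue {x \<in> ball 0 1 - {0::'a}. x /\<^sub>R norm x \<in> sphere 0 1}" .
    also have "\<dots> \<le> of_nat DIM('a) * emeasure lebesgue (ball (0::'a) 1)"
      by (intro mult_left_mono emeasure_mono) auto
    also have "\<dots> < \<infinity>" using emeasure_lborel_ball_finite[of "0::'a" 1]
      by (simp add: ennreal_mult_less_top ennreal_of_nat_eq_real_of_nat)
    finally show "emeasure (cone_measure :: 'a measure) (space cone_measure) \<noteq> \<infinity>" by simp
  qed
  then show ?thesis unfolding sphere_measure_eq
    by (intro sigma_finite_completion finite_measure.sigma_finite_measure)
qed

lemma completion_ex_borel_measurable_complex: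
  fixes g :: "'a \<Rightarrow> complex"
  assumes "g \<in> borel_measurable (completion M)"
  obtains g' where "g' \<in> borel_measurable M" "AE x in M. g x = g' x"
proof -
  obtain r where r: "r \<in> borel_measurable M" "AE x in M. Re (g x) = r x"
    using completion_ex_borel_measurable_real[of "\<lambda>x. Re (g x)" M] assms by auto
  obtain i where i: "i \<in> borel_measurable M" "AE x in M. Im (g x) = i x"
    using completion_ex_borel_measurable_real[of "\<lambda>x. Im (g x)" M] assms by auto
  show thesis
  proof
    show "(\<lambda>x. Complex (r x) (i x)) \<in> borel_measurable M"
      using r(1) i(1) by (simp add: borel_measurable_complex_iff)
    show "AE x in M. g x = Complex (r x) (i x)" using r(2) i(2) by eventually_elim (simp add: complex_eq_iff)
  qed
qed

lemma hom0_borel_version: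
  fixes \<Omega> :: "'a::euclidean_space \<Rightarrow> complex"
  assumes "Linf sphere_measure \<Omega>"
  obtains \<omega> B where "\<omega> \<in> borel_measurable borel" "\<And>y. cmod (\<omega> y) \<le> B" "AE y in lebesgue. hom0 \<Omega> y = \<omega> y"
proof -
  obtain B0 where B0: "AE x in sphere_measure. cmod (\<Omega> x) \<le> B0" using assms by (auto simp: Linf_def)
  define B where "B = max B0 0"
  obtain \<Omega>' where \<Omega>': "\<Omega>' \<in> borel_measurable (cone_measure :: 'a measure)" "AE x in cone_measure. \<Omega> x = \<Omega>' x"
    using assms completion_ex_borel_measurable_complex[of \<Omega> cone_measure] by (auto simp: Linf_def sphere_measure_eq)
  define \<Omega>1 where "\<Omega>1 x = indicator (sphere 0 1) x *\<^sub>R \<Omega>' x" for x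
  have "\<Omega>' \<in> borel_measurable (restrict_space borel (sphere 0 1))"
    using \<Omega>'(1) measurable_cong_sets[OF sets_cone_measure refl] by blast
  then have [measurable]: "\<Omega>1 \<in> borel_measurable borel"
    unfolding \<Omega>1_def by (subst (asm) borel_measurable_restrict_space_iff) auto
  define \<omega> where "\<omega> y = (if cmod (\<Omega>1 (y /\<^sub>R norm y)) \<le> B then \<Omega>1 (y /\<^sub>R norm y) else 0)" for y :: 'a
  show thesis
  proof
    show "\<omega> \<in> borel_measurable borel" unfolding \<omega>_def by measurable
    show "cmod (\<omega> y) \<le> B" for y by (simp add: \<omega>_def B_def)
    have "AE x in sphere_measure. cmod (\<Omega> x) \<le> B0 \<and> \<Omega> x = \<Omega>' x"
      using B0 \<Omega>'(2) unfolding sphere_measure_eq AE_completion_iff by eventually_elim simp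
    then have "AE y in (lebesgue :: 'a measure). cmod (\<Omega> (y /\<^sub>R norm y)) \<le> B0 \<and> \<Omega> (y /\<^sub>R norm y) = \<Omega>' (y /\<^sub>R norm y)"
      by (rule AE_sphere_measure_cone)
    moreover have "AE y in (lebesgue :: 'a measure). y \<noteq> 0"
      by (rule AE_I'[of "{0}"]) auto
    ultimately show "AE y in lebesgue. hom0 \<Omega> y = \<omega> y"
      by eventually_elim (auto simp: hom0_def \<omega>_def \<Omega>1_def B_def)
  qed
qed

text \<open>
  The set \<open>F\<close> is measurable only for the completed measure, so \<open>G\<close> is the cone over its Borel main
  part.
\<close>

lemma cone_over_directions:
  fixes F :: "'a::euclidean_space set"
  assumes "F \<in> sets sphere_measure" "emeasure sphere_measure F > 0"
  obtains G where "G \<in> sets (borel :: 'a measure)" "\<And>u. u \<in> G \<Longrightarrow> u \<noteq> 0" "\<And>u. u \<in> G \<Longrightarrow> u /\<^sub>R norm u \<in> F"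
    "\<And>u t. u \<in> G \<Longrightarrow> 0 < t \<Longrightarrow> t *\<^sub>R u \<in> G" "emeasure lborel (G \<inter> ball 0 1) > 0"
proof -
  have F: "F \<in> sets (completion cone_measure)" using assms(1) by (simp add: sphere_measure_eq)
  define F' where "F' = main_part cone_measure F"
  have F': "F' \<in> sets cone_measure" "F' \<subseteq> F"
    using main_part_sets[OF F] main_part_null_part_Un[OF F] by (auto simp: F'_def)
  have eF: "emeasure cone_measure F' > 0"
    using assms(2) emeasure_completion[OF F] by (simp add: sphere_measure_eq F'_def)
  have F'b: "F' \<in> sets borel"
    using F'(1) unfolding sets_cone_measure by (subst (asm) sets_restrict_space_iff) auto
  define G where "G = {u. u \<noteq> 0 \<and> u /\<^sub>R norm u \<in> F'}"
  show thesis
  proof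
    show Gb: "G \<in> sets borel"
    proof -
      have "(\<lambda>u::'a. u /\<^sub>R norm u) -` F' \<inter> space borel \<in> sets borel"
        by (rule measurable_sets[OF _ F'b]) measurable
      moreover have "G = ((\<lambda>u::'a. u /\<^sub>R norm u) -` F' \<inter> space borel) - {0}" by (auto simp: G_def)
      ultimately show ?thesis by auto
    qed
    show "u \<noteq> 0" "u /\<^sub>R norm u \<in> F" if "u \<in> G" for u using that F'(2) by (auto simp: G_def)
    show "t *\<^sub>R u \<in> G" if "u \<in> G" "0 < t" for u t
    proof -
      have "(t *\<^sub>R u) /\<^sub>R norm (t *\<^sub>R u) = u /\<^sub>R norm u" using that(2) by simp
      then show ?thesis using that by (simp add: G_def del: norm_scaleR scaleR_scaleR)
    qed
    have "{x \<in> ball 0 1 - {0}. x /\<^sub>R norm x \<in> F'} = G \<inter> ball 0 1" by (auto simp: G_def)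
    then have "emeasure cone_measure F' = of_nat DIM('a) * emeasure lebesgue (G \<inter> ball 0 1)"
      using cone_measure_cone(2)[OF F'(1)] by simp
    then have "emeasure lebesgue (G \<inter> ball 0 1) \<noteq> 0" using eF by force
    moreover have "emeasure lebesgue (G \<inter> ball 0 1) = emeasure lborel (G \<inter> ball 0 1)"
      using Gb by (intro emeasure_completion[THEN trans]) simp_all
    ultimately show "emeasure lborel (G \<inter> ball 0 1) > 0" by (simp add: zero_less_iff_neq_zero)
  qed
qed

lemma hom0_scaleR: "0 < c \<Longrightarrow> hom0 \<Omega> (c *\<^sub>R y) = hom0 \<Omega> y"
proof -
  assume "0 < c"
  then have "(c *\<^sub>R y) /\<^sub>R norm (c *\<^sub>R y) = y /\<^sub>R norm y" by simp
  then show ?thesis unfolding hom0_def by (rule arg_cong)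
qed

text \<open>
  The hypotheses on \<open>\<Omega>\<close> hold up to null sets, and a change on a null set of \<open>\<real>\<^sup>2\<^sup>d\<close> makes them hold
  everywhere for a Borel function. The pair \<open>(\<theta>, h)\<close> becomes \<open>(u, v) = \<bar>u\<bar> (\<theta>, h)\<close> by homogeneity;
  Fubini's theorem, applied to a Borel set, joins the exceptional sets for the single \<open>u\<close> into one null
  set of pairs.
\<close>

lemma nondegenerate_borel_symbol:
  fixes \<Omega> :: "'a::euclidean_space \<times> 'a \<Rightarrow> complex" and F :: "'a set"
  assumes \<Omega>: "Linf sphere_measure \<Omega>" and F: "F \<in> sets sphere_measure" "emeasure sphere_measure F > 0"
    and pos: "\<delta> > 0" "\<kappa> > 0" "cmod \<zeta> = 1"
    and nd: "AE (\<theta>, h) in sphere_measure \<Otimes>\<^sub>M lebesgue.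
           \<theta> \<in> F \<and> h \<in> ball 0 \<delta> \<longrightarrow> Re (\<zeta> * hom0 \<Omega> (\<theta> + h, \<theta> - h)) \<ge> \<kappa>"
  obtains \<omega> B G where "\<omega> \<in> borel_measurable borel" "\<kappa> \<le> B" "\<And>y. cmod (\<omega> y) \<le> B" "AE y in lebesgue. hom0 \<Omega> y = \<omega> y"
    "G \<in> sets (borel :: 'a measure)" "\<And>u. u \<in> G \<Longrightarrow> u \<noteq> 0" "\<And>u t. u \<in> G \<Longrightarrow> 0 < t \<Longrightarrow> t *\<^sub>R u \<in> G"
    "emeasure lborel (G \<inter> ball 0 1) > 0"
    "\<And>u v. u \<in> G \<Longrightarrow> norm v < \<delta> * norm u \<Longrightarrow> \<kappa> \<le> Re (\<zeta> * \<omega> (u + v, u - v))"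
proof -
  obtain \<omega>0 B0 where [measurable]: "\<omega>0 \<in> borel_measurable borel" and w0: "\<And>y. cmod (\<omega>0 y) \<le> B0"
    "AE y in lebesgue. hom0 \<Omega> y = \<omega>0 y" using hom0_borel_version[OF \<Omega>] by metis
  obtain G where G [measurable]: "G \<in> sets (borel :: 'a measure)" and G0: "\<And>u. u \<in> G \<Longrightarrow> u \<noteq> 0"
    and GF: "\<And>u. u \<in> G \<Longrightarrow> u /\<^sub>R norm u \<in> F"
    and Gt: "\<And>u t. u \<in> G \<Longrightarrow> 0 < t \<Longrightarrow> t *\<^sub>R u \<in> G" and Gp: "emeasure lborel (G \<inter> ball 0 1) > 0"
    by (rule cone_over_directions[OF F]) blast
  interpret S: sigma_finite_measure "sphere_measure :: 'a measure" by (rule sigma_finite_sphere_measure)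
  interpret Le: sigma_finite_measure "lebesgue :: 'a measure" by (rule sigma_finite_completion) (rule sigma_finite_lborel)
  interpret SL: pair_sigma_finite "sphere_measure :: 'a measure" "lebesgue :: 'a measure" ..
  have "AE \<theta> in sphere_measure. AE h in lebesgue. \<theta> \<in> F \<and> h \<in> ball 0 \<delta> \<longrightarrow> Re (\<zeta> * hom0 \<Omega> (\<theta> + h, \<theta> - h)) \<ge> \<kappa>"
    using SL.AE_pair[OF nd] by simp
  then have "AE u in (lebesgue :: 'a measure). AE h in lebesgue. u /\<^sub>R norm u \<in> F \<and> h \<in> ball 0 \<delta> \<longrightarrow>
      Re (\<zeta> * hom0 \<Omega> (u /\<^sub>R norm u + h, u /\<^sub>R norm u - h)) \<ge> \<kappa>"
    by (rule AE_sphere_measure_cone)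
  then have "AE u in lborel. AE h in (lebesgue :: 'a measure). u /\<^sub>R norm u \<in> F \<and> h \<in> ball 0 \<delta> \<longrightarrow>
      Re (\<zeta> * hom0 \<Omega> (u /\<^sub>R norm u + h, u /\<^sub>R norm u - h)) \<ge> \<kappa>"
    unfolding AE_completion_iff .
  then have 1: "AE u in (lborel :: 'a measure). AE v in (lborel :: 'a measure). u \<in> G \<and> norm v < \<delta> * norm u \<longrightarrow> \<kappa> \<le> Re (\<zeta> * hom0 \<Omega> (u + v, u - v))"
  proof eventually_elim
    case (elim u)
    show ?case
    proof (cases "u \<in> G")
      case True
      then have u: "0 < norm u" using G0 by simp
      have "AE v in lebesgue. (\<lambda>h. u /\<^sub>R norm u \<in> F \<and> h \<in> ball 0 \<delta> \<longrightarrow>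
         Re (\<zeta> * hom0 \<Omega> (u /\<^sub>R norm u + h, u /\<^sub>R norm u - h)) \<ge> \<kappa>) (v /\<^sub>R norm u)"
        by (rule AE_lebesgue_preimage[OF elim, of "\<lambda>x. norm u *\<^sub>R x"])
           (use u in \<open>auto intro!: linear_imp_differentiable_on linearI simp: algebra_simps\<close>)
      then have "AE v in lebesgue. u \<in> G \<and> norm v < \<delta> * norm u \<longrightarrow> \<kappa> \<le> Re (\<zeta> * hom0 \<Omega> (u + v, u - v))"
      proof eventually_elim
        case (elim v)
        have sc: "hom0 \<Omega> (u /\<^sub>R norm u + v /\<^sub>R norm u, u /\<^sub>R norm u - v /\<^sub>R norm u) = hom0 \<Omega> (u + v, u - v)"
          using hom0_scaleR[of "inverse (norm u)" \<Omega> "(u + v, u - v)"] u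
          by (simp add: scaleR_add_right scaleR_diff_right)
        show ?case
        proof
          assume "u \<in> G \<and> norm v < \<delta> * norm u"
          then show "\<kappa> \<le> Re (\<zeta> * hom0 \<Omega> (u + v, u - v))"
            using elim GF[of u] u unfolding sc by (auto simp: field_simps)
        qed
      qed
      then show ?thesis unfolding AE_completion_iff .
    qed simp
  qed
  have "AE w in (lebesgue :: ('a \<times> 'a) measure). hom0 \<Omega> (fst w + snd w, fst w - snd w) = \<omega>0 (fst w + snd w, fst w - snd w)"
    by (rule AE_lebesgue_preimage[OF w0(2), of "\<lambda>y. ((1/2) *\<^sub>R (fst y + snd y), (1/2) *\<^sub>R (fst y - snd y))"])
       (auto simp: algebra_simps scaleR_2[symmetric] intro!: linear_imp_differentiable_on linearI)
  then have "AE w in (lborel \<Otimes>\<^sub>M lborel :: ('a \<times> 'a) measure). hom0 \<Omega> (fst w + snd w, fst w - snd w) = \<omega>0 (fst w + snd w, fst w - snd w)"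
    unfolding lborel_prod AE_completion_iff .
  from lborel_pair.AE_pair[OF this]
  have 2: "AE u in (lborel :: 'a measure). AE v in (lborel :: 'a measure). hom0 \<Omega> (u + v, u - v) = \<omega>0 (u + v, u - v)" by simp
  have 3: "AE u in (lborel :: 'a measure). AE v in (lborel :: 'a measure).
      (u \<in> G \<and> norm v < \<delta> * norm u \<longrightarrow> \<kappa> \<le> Re (\<zeta> * \<omega>0 (u + v, u - v)))"
    using 1 2
  proof eventually_elim
    case (elim u)
    from elim(1,2) show ?case by eventually_elim auto
  qed
  have "AE w in (lborel \<Otimes>\<^sub>M lborel :: ('a \<times> 'a) measure).
      (fst w \<in> G \<and> norm (snd w) < \<delta> * norm (fst w) \<longrightarrow> \<kappa> \<le> Re (\<zeta> * \<omega>0 (fst w + snd w, fst w - snd w)))"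
  proof (rule lborel_pair.AE_pair_measure)
    show "{w \<in> space (lborel \<Otimes>\<^sub>M lborel). fst w \<in> G \<and> norm (snd w) < \<delta> * norm (fst w) \<longrightarrow> \<kappa> \<le> Re (\<zeta> * \<omega>0 (fst w + snd w, fst w - snd w))}
        \<in> sets ((lborel :: 'a measure) \<Otimes>\<^sub>M (lborel :: 'a measure))"
    proof -
      have "(\<lambda>w::'a \<times> 'a. (fst w + snd w, fst w - snd w)) \<in> borel \<rightarrow>\<^sub>M borel"
        by (intro borel_measurable_continuous_onI continuous_intros)
      then have [measurable]: "(\<lambda>w::'a \<times> 'a. \<omega>0 (fst w + snd w, fst w - snd w)) \<in> borel_measurable borel"
        by (rule measurable_compose) measurable
      have "{w. \<kappa> \<le> Re (\<zeta> * \<omega>0 (fst w + snd w, fst w - snd w))} \<in> sets (borel :: ('a \<times> 'a) measure)"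
        by measurable
      moreover have "{w::'a \<times> 'a. norm (snd w) < \<delta> * norm (fst w)} \<in> sets borel"
        by (intro borel_open open_Collect_less continuous_intros)
      moreover have "G \<times> UNIV \<in> sets (borel :: ('a \<times> 'a) measure)" by (intro borel_Times) auto
      ultimately have "(UNIV - (G \<times> UNIV \<inter> {w::'a \<times> 'a. norm (snd w) < \<delta> * norm (fst w)}))
          \<union> {w. \<kappa> \<le> Re (\<zeta> * \<omega>0 (fst w + snd w, fst w - snd w))} \<in> sets borel" by auto
      then show ?thesis unfolding lborel_prod sets_lborel by (rule back_subst[of "\<lambda>S. S \<in> sets borel"]) auto
    qed
  qed (use 3 in simp)
  then have 4: "AE w in (lebesgue :: ('a \<times> 'a) measure).
      (fst w \<in> G \<and> norm (snd w) < \<delta> * norm (fst w) \<longrightarrow> \<kappa> \<le> Re (\<zeta> * \<omega>0 (fst w + snd w, fst w - snd w)))"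
    unfolding lborel_prod AE_completion_iff .
  define U where "U y = (1/2) *\<^sub>R (fst y + snd y)" for y :: "'a \<times> 'a"
  define V where "V y = (1/2) *\<^sub>R (fst y - snd y)" for y :: "'a \<times> 'a"
  have UV: "U y + V y = fst y" "U y - V y = snd y" for y
    by (simp_all add: U_def V_def algebra_simps scaleR_2[symmetric] flip: scaleR_add_left)
  have [measurable]: "U \<in> borel_measurable borel" "V \<in> borel_measurable borel"
    unfolding U_def[abs_def] V_def[abs_def] by (intro borel_measurable_continuous_onI continuous_intros)+
  have "AE y in (lebesgue :: ('a \<times> 'a) measure). (\<lambda>w. fst w \<in> G \<and> norm (snd w) < \<delta> * norm (fst w) \<longrightarrow>
      \<kappa> \<le> Re (\<zeta> * \<omega>0 (fst w + snd w, fst w - snd w))) (U y, V y)"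
    by (rule AE_lebesgue_preimage[OF 4, of "\<lambda>w. (fst w + snd w, fst w - snd w)"])
       (auto simp: UV algebra_simps intro!: linear_imp_differentiable_on linearI)
  then have 5: "AE y in (lebesgue :: ('a \<times> 'a) measure). U y \<in> G \<and> norm (V y) < \<delta> * norm (U y) \<longrightarrow> \<kappa> \<le> Re (\<zeta> * \<omega>0 y)"
    by (simp add: UV)
  \<comment> \<open>on the exceptional set the value is chosen such that \<open>\<zeta>\<close> times it equals \<open>\<kappa>\<close>\<close>
  define \<omega> where "\<omega> y = (if U y \<in> G \<and> norm (V y) < \<delta> * norm (U y) \<and> Re (\<zeta> * \<omega>0 y) < \<kappa> then of_real \<kappa> * cnj \<zeta> else \<omega>0 y)" for y
  show thesis
  proof
    show "\<omega> \<in> borel_measurable borel" unfolding \<omega>_def by measurable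
    show "\<kappa> \<le> max B0 \<kappa>" by simp
    show "cmod (\<omega> y) \<le> max B0 \<kappa>" for y using w0(1)[of y] pos by (auto simp: \<omega>_def norm_mult)
    show "AE y in lebesgue. hom0 \<Omega> y = \<omega> y" using w0(2) 5 by eventually_elim (auto simp: \<omega>_def)
    show "\<kappa> \<le> Re (\<zeta> * \<omega> (u + v, u - v))" if "u \<in> G" "norm v < \<delta> * norm u" for u v
    proof -
      have UVuv: "U (u + v, u - v) = u" "V (u + v, u - v) = v"
        by (simp_all add: U_def V_def scaleR_2[symmetric])
      have w: "\<omega> (u + v, u - v) = (if Re (\<zeta> * \<omega>0 (u + v, u - v)) < \<kappa> then of_real \<kappa> * cnj \<zeta> else \<omega>0 (u + v, u - v))"
        unfolding \<omega>_def UVuv using that by (simp only: simp_thms)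
      have eq: "\<zeta> * (of_real \<kappa> * cnj \<zeta>) = of_real \<kappa>"
      proof -
        have "\<zeta> * cnj \<zeta> = 1" using pos(3) complex_norm_square[of \<zeta>] by simp
        then show ?thesis by (simp add: mult.left_commute)
      qed
      show ?thesis
      proof (cases "Re (\<zeta> * \<omega>0 (u + v, u - v)) < \<kappa>")
        case True show ?thesis unfolding w if_P[OF True] eq by simp
      next
        case False then show ?thesis unfolding w if_not_P[OF False] by linarith
      qed
    qed
  qed (use G G0 Gt Gp in auto)
qed

section \<open>Balls that almost lie in a set of positive measure\<close>

lemma emeasure_lborel_translate:
  assumes "A \<in> sets (borel :: 'a::euclidean_space measure)"
  shows "emeasure lborel {x. x + a \<in> A} = emeasure lborel A"
proof -
  have "emeasure lborel A = emeasure (distr lborel borel ((+) a)) A" by (simp add: lborel_distr_plus)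
  also have "\<dots> = emeasure lborel {x. x + a \<in> A}"
    using assms by (subst emeasure_distr) (auto simp: vimage_def add.commute)
  finally show ?thesis ..
qed

text \<open>
  A weak form of the Lebesgue density theorem, by averaging. Let \<open>K\<close> be a compact subset of \<open>G\<close> of
  positive measure, \<open>U\<close> an open set around it with little more measure, and \<open>\<rho>\<close> at most the distance
  from \<open>K\<close> to the complement of \<open>U\<close>. Shifts of \<open>K\<close> by less than \<open>\<rho>\<close> stay in \<open>U\<close>, so by Fubini's theorem
  the mean over \<open>u \<in> K\<close> of the measure of \<open>ball u \<rho> - K\<close> is small relative to that of the ball. Some
  \<open>u\<close> attains at most the mean.
\<close>

lemma almost_full_ball:
  fixes G :: "'a::euclidean_space set"
  assumes G: "G \<in> sets borel" "0 \<notin> G" "emeasure lborel (G \<inter> ball 0 1) > 0" and e: "0 < e" and c: "0 < c"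
  obtains u0 \<rho> where "u0 \<in> G" "0 < \<rho>" "\<rho> \<le> c * norm u0"
    "emeasure lborel (ball u0 \<rho> - G) \<le> ennreal e * emeasure lborel (ball u0 \<rho>)"
proof -
  define S where "S = G \<inter> ball 0 1"
  have Sb: "S \<in> sets borel" using G by (simp add: S_def)
  have Sfin: "emeasure lborel S < \<infinity>"
    using emeasure_mono[of S "ball 0 1" lborel] emeasure_lborel_ball_finite[of "0::'a" 1]
    by (simp add: S_def order_le_less_trans)
  have Slm: "S \<in> lmeasurable" using Sb Sfin by (simp add: fmeasurable_def)
  define s where "s = measure lborel S"
  have es: "emeasure lborel S = ennreal s" using Sfin by (simp add: s_def emeasure_eq_ennreal_measure)
  have s0: "0 < s" using G(3) es by (simp add: S_def)
  obtain K where K: "closed K" "K \<subseteq> S" "S - K \<in> lmeasurable" "emeasure lebesgue (S - K) < ennreal s"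
    using sets_lebesgue_inner_closed[of S s] Slm s0 by (auto simp: fmeasurable_def)
  have "bounded K" using K(2) bounded_subset[OF bounded_ball[of 0 1]] by (auto simp: S_def)
  then have Kc: "compact K" using K(1) by (simp add: compact_eq_bounded_closed)
  then have [measurable]: "K \<in> sets borel" by (simp add: borel_compact)
  have "emeasure lborel (S - K) < ennreal s" using K(4) Sb by simp
  moreover have "emeasure lborel S \<le> emeasure lborel (S - K) + emeasure lborel K"
    using emeasure_subadditive[of "S - K" lborel K] Sb K(2) by (simp add: Un_absorb2)
  ultimately have eK0: "emeasure lborel K \<noteq> 0" using es by force
  have Kfin: "emeasure lborel K < \<infinity>" using emeasure_compact_finite[OF Kc] by simp
  define \<kappa> where "\<kappa> = measure lborel K"
  have eK: "emeasure lborel K = ennreal \<kappa>" using Kfin by (simp add: \<kappa>_def emeasure_eq_ennreal_measure)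
  have \<kappa>0: "0 < \<kappa>" using eK0 eK by (simp add: \<kappa>_def zero_less_measure_iff)
  have "K \<noteq> {}" "0 \<notin> K" using eK0 K(2) G(2) by (auto simp: S_def)
  have "K \<in> sets lebesgue" by simp
  have "0 < e * \<kappa>" using e \<kappa>0 by simp
  obtain U where U: "open U" "K \<subseteq> U" "U - K \<in> lmeasurable" "emeasure lebesgue (U - K) < ennreal (e * \<kappa>)"
    by (rule sets_lebesgue_outer_open[OF \<open>K \<in> sets lebesgue\<close> \<open>0 < e * \<kappa>\<close>])
  have "closed (- U)" using U(1) by (rule closed_Compl)
  moreover have "K \<inter> - U = {}" using U(2) by blast
  ultimately obtain d where d0: "0 < d" "\<forall>x\<in>K. \<forall>y\<in>-U. d \<le> dist x y"
    using separate_compact_closed[OF Kc, of "- U"] by metis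
  have d: "d \<le> dist x y" if "x \<in> K" "y \<in> -U" for x y using d0(2) that by simp
  have "K \<inter> {0} = {}" using \<open>0 \<notin> K\<close> by simp
  from separate_compact_closed[OF Kc closed_singleton this]
  obtain r where r0: "0 < r" "\<forall>x\<in>K. \<forall>y\<in>{0}. r \<le> dist x y" by (elim exE conjE)
  have r: "r \<le> norm x" if "x \<in> K" for x using r0(2) that by simp
  define \<rho> where "\<rho> = min d (c * r)"
  have \<rho>: "0 < \<rho>" using d0(1) r0(1) c by (simp add: \<rho>_def)
  define \<beta> where "\<beta> = emeasure lborel (ball (0::'a) \<rho>)"
  have ball_eq: "emeasure lborel (ball u \<rho>) = \<beta>" for u :: 'a
  proof -
    have "ball (0::'a) \<rho> = {x. x + u \<in> ball u \<rho>}" by (auto simp: dist_norm norm_minus_commute)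
    then show ?thesis using emeasure_lborel_translate[of "ball u \<rho>" u] by (simp add: \<beta>_def)
  qed
  have \<beta>: "\<beta> \<noteq> 0" "\<beta> < \<infinity>"
    using \<rho> emeasure_lborel_ball_finite[of "0::'a" \<rho>] less_imp_neq[OF unit_ball_vol_pos[of "real DIM('a)"]]
    by (simp_all add: \<beta>_def emeasure_ball)
  have "\<exists>u\<in>K. emeasure lborel (ball u \<rho> - K) \<le> ennreal e * \<beta>"
  proof (rule ccontr)
    assume "\<not> ?thesis"
    then have gt: "ennreal e * \<beta> \<le> emeasure lborel (ball u \<rho> - K)" if "u \<in> K" for u using that by force
    define f :: "'a \<Rightarrow> 'a \<Rightarrow> ennreal" where "f u v = indicator K u * (indicator (ball 0 \<rho>) v * indicator (-K) (u + v))" for u v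
    have f [measurable]: "case_prod f \<in> borel_measurable (lborel \<Otimes>\<^sub>M lborel)"
    proof -
      have "(\<lambda>p::'a \<times> 'a. indicator K (fst p) :: ennreal) \<in> borel_measurable borel"
        by (rule borel_measurable_comp_continuous[of "indicator K"]) (auto intro!: continuous_intros)
      moreover have "(\<lambda>p::'a \<times> 'a. indicator (ball 0 \<rho>) (snd p) :: ennreal) \<in> borel_measurable borel"
        by (rule borel_measurable_comp_continuous[of "indicator (ball 0 \<rho>)"])
          (rule borel_measurable_indicator, simp, intro continuous_intros)
      moreover have "(\<lambda>p::'a \<times> 'a. indicator (- K) (fst p + snd p) :: ennreal) \<in> borel_measurable borel"
        by (rule borel_measurable_comp_continuous[of "indicator (- K)"]) (auto intro!: continuous_intros)
      ultimately show ?thesis unfolding lborel_prod f_def split_def by simp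
    qed
    have "ennreal e * \<beta> * emeasure lborel K = (\<integral>\<^sup>+u. ennreal e * \<beta> * indicator K u \<partial>lborel)"
      by (simp add: nn_integral_cmult_indicator)
    also have "\<dots> \<le> (\<integral>\<^sup>+u. \<integral>\<^sup>+v. f u v \<partial>lborel \<partial>lborel)"
    proof (rule nn_integral_mono)
      fix u :: 'a
      show "ennreal e * \<beta> * indicator K u \<le> (\<integral>\<^sup>+v. f u v \<partial>lborel)"
      proof (cases "u \<in> K")
        case True
        have eq: "{v. v + u \<in> ball u \<rho> - K} = {v. v \<in> ball 0 \<rho> \<and> u + v \<in> -K}"
          by (auto simp: dist_norm add.commute norm_minus_commute)
        have "emeasure lborel (ball u \<rho> - K) = emeasure lborel {v. v \<in> ball 0 \<rho> \<and> u + v \<in> -K}"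
          using emeasure_lborel_translate[of "ball u \<rho> - K" u] unfolding eq by simp
        also have "\<dots> = (\<integral>\<^sup>+v. indicator {v. v \<in> ball 0 \<rho> \<and> u + v \<in> -K} v \<partial>lborel)"
          by (rule nn_integral_indicator[symmetric]) measurable
        also have "\<dots> = (\<integral>\<^sup>+v. f u v \<partial>lborel)"
          using True by (intro nn_integral_cong) (auto simp: f_def split: split_indicator)
        finally show ?thesis using gt[OF True] True by simp
      qed simp
    qed
    also have "\<dots> = (\<integral>\<^sup>+v. \<integral>\<^sup>+u. f u v \<partial>lborel \<partial>lborel)"
      by (rule lborel_pair.Fubini'[symmetric]) (rule f)
    also have "\<dots> \<le> (\<integral>\<^sup>+v. emeasure lborel (U - K) * indicator (ball (0::'a) \<rho>) v \<partial>lborel)"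
    proof (rule nn_integral_mono)
      fix v :: 'a
      show "(\<integral>\<^sup>+u. f u v \<partial>lborel) \<le> emeasure lborel (U - K) * indicator (ball 0 \<rho>) v"
      proof (cases "v \<in> ball 0 \<rho>")
        case True
        have "(\<integral>\<^sup>+u. f u v \<partial>lborel) \<le> (\<integral>\<^sup>+u. indicator {u. u + v \<in> U - K} u \<partial>lborel)"
        proof (rule nn_integral_mono)
          fix u
          have "u + v \<in> U" if "u \<in> K"
            using d[OF that, of "u + v"] True by (force simp: \<rho>_def dist_norm)
          then show "f u v \<le> indicator {u. u + v \<in> U - K} u" by (auto simp: f_def split: split_indicator)
        qed
        also have "\<dots> = emeasure lborel {u. u + v \<in> U - K}"
        proof (rule nn_integral_indicator)
          have "(\<lambda>u. u + v) -` (U - K) \<inter> space borel \<in> sets borel"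
            by (rule measurable_sets[of _ borel borel]) (use U(1) in auto)
          then show "{u. u + v \<in> U - K} \<in> sets lborel" by (simp add: vimage_def)
        qed
        also have "\<dots> = emeasure lborel (U - K)"
          using U(1) by (intro emeasure_lborel_translate) auto
        finally show ?thesis using True by simp
      qed (simp add: f_def)
    qed
    also have "\<dots> = emeasure lborel (U - K) * \<beta>"
      by (subst nn_integral_cmult_indicator) (auto simp: \<beta>_def)
    also have "\<dots> < ennreal (e * \<kappa>) * \<beta>"
      using U(1,4) \<beta> by (intro ennreal_mult_strict_right_mono) (auto simp: zero_less_iff_neq_zero)
    finally show False using e \<kappa>0 by (simp add: eK ennreal_mult mult_ac)
  qed
  then obtain u0 where u0: "u0 \<in> K" "emeasure lborel (ball u0 \<rho> - K) \<le> ennreal e * \<beta>" by blast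
  show thesis
  proof
    show "u0 \<in> G" using u0 K(2) by (auto simp: S_def)
    show "0 < \<rho>" by fact
    show "\<rho> \<le> c * norm u0" using r[OF u0(1)] c by (simp add: \<rho>_def min.coboundedI2)
    have "emeasure lborel (ball u0 \<rho> - G) \<le> emeasure lborel (ball u0 \<rho> - K)"
      using K(2) by (intro emeasure_mono) (auto simp: S_def)
    then show "emeasure lborel (ball u0 \<rho> - G) \<le> ennreal e * emeasure lborel (ball u0 \<rho>)"
      using u0(2) by (simp add: ball_eq)
  qed
qed

section \<open>Averages as integrals\<close>

lemma borel_measurable_lebesgue_AE:
  assumes g: "g \<in> borel_measurable borel" and ae: "AE x in lebesgue. f x = g x"
  shows "f \<in> borel_measurable (lebesgue :: 'a::euclidean_space measure)"
proof (rule measurableI)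
  fix A :: "'b set" assume A: "A \<in> sets borel"
  have "g -` A \<inter> space lebesgue \<in> sets lebesgue"
    by (rule measurable_sets[OF measurable_completion A]) (use g in simp)
  moreover have "AE x in lebesgue. x \<in> g -` A \<inter> space lebesgue \<longleftrightarrow> x \<in> f -` A \<inter> space lebesgue"
    using ae by eventually_elim simp
  ultimately show "f -` A \<inter> space lebesgue \<in> sets lebesgue"
    using completion.in_sets_AE by blast
qed simp

lemma integral_lebesgue_AE_borel:
  fixes f g :: "'a::euclidean_space \<Rightarrow> complex"
  assumes g: "g \<in> borel_measurable borel" and ae: "AE x in lebesgue. f x = g x"
  shows "(LINT x|lebesgue. f x) = (LINT x|lborel. g x)"
proof -
  have "(LINT x|lebesgue. f x) = (LINT x|lebesgue. g x)"
    by (rule integral_cong_AE[OF borel_measurable_lebesgue_AE[OF g ae] _ ae])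
       (use g in \<open>simp add: measurable_completion\<close>)
  also have "\<dots> = (LINT x|lborel. g x)" using g by (intro integral_completion) simp
  finally show ?thesis .
qed

lemma integral_lborel_reflect:
  fixes f :: "'a::euclidean_space \<Rightarrow> complex"
  assumes "f \<in> borel_measurable borel"
  shows "(LINT y|lborel. f (a - y)) = (LINT y|lborel. f y)"
proof -
  have "lborel = distr lborel borel (\<lambda>x. a - x)"
    using lborel_affine[of "-1" a] by (simp add: density_1)
  then have "(LINT y|lborel. f y) = (LINT y|distr lborel borel (\<lambda>x. a - x). f y)" by simp
  also have "\<dots> = (LINT y|lborel. f (a - y))"
    using assms by (subst integral_distr) auto
  finally show ?thesis ..
qed

lemma AE_lebesgue_coordinates:
  assumes "AE z in (lebesgue :: 'a::euclidean_space measure). P z"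
  shows "AE y in (lebesgue :: ('a \<times> 'a) measure). P (x - fst y) \<and> P (x - snd y)"
proof -
  have P: "AE z in (lborel :: 'a measure). P z" using assms unfolding AE_completion_iff .
  then obtain N where N: "{z \<in> space lborel. \<not> P z} \<subseteq> N" "emeasure lborel N = 0" "N \<in> sets (lborel :: 'a measure)"
    by (rule AE_E)
  have null: "N \<in> null_sets lborel" using N by auto
  have "N \<times> UNIV \<in> null_sets (lborel \<Otimes>\<^sub>M lborel :: ('a \<times> 'a) measure)"
    "UNIV \<times> N \<in> null_sets (lborel \<Otimes>\<^sub>M lborel :: ('a \<times> 'a) measure)"
    using null by auto
  then have "N \<times> UNIV \<union> UNIV \<times> N \<in> null_sets (lborel :: ('a \<times> 'a) measure)" unfolding lborel_prod by auto
  then have "AE y in (lborel :: ('a \<times> 'a) measure). P (fst y) \<and> P (snd y)"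
    by (rule AE_I') (use N(1) in auto)
  then have "AE y in (lebesgue :: ('a \<times> 'a) measure). P (fst y) \<and> P (snd y)" unfolding AE_completion_iff .
  then have "AE y in (lebesgue :: ('a \<times> 'a) measure). (\<lambda>y. P (fst y) \<and> P (snd y)) ((x, x) - y)"
    by (rule AE_lebesgue_preimage[where g="\<lambda>y. (x, x) - y"]) (auto intro!: derivative_intros)
  then show ?thesis by simp
qed

text \<open>
  The uniform distribution on \<open>S\<close>, with its density explicit and real so that products and integrals
  reduce to Lebesgue integrals.
\<close>

definition unif :: "'a::euclidean_space set \<Rightarrow> 'a measure" where
  "unif S = density lborel (\<lambda>x. ennreal (indicator S x / measure lborel S))"

lemma sets_unif [simp, measurable_cong]: "sets (unif S) = sets borel"
  by (simp add: unif_def)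

lemma space_unif [simp]: "space (unif S) = UNIV"
  by (simp add: unif_def)

lemma unif_integral:
  fixes f :: "'a::euclidean_space \<Rightarrow> 'b::{banach, second_countable_topology}"
  assumes "S \<in> sets borel" and "f \<in> borel_measurable borel"
  shows "integrable (unif S) f \<longleftrightarrow> integrable lborel (\<lambda>x. (indicator S x / measure lborel S) *\<^sub>R f x)"
    and "integral\<^sup>L (unif S) f = (LINT x|lborel. (indicator S x / measure lborel S) *\<^sub>R f x)"
  unfolding unif_def using assms by (subst integrable_density integral_density; simp)+

lemma emeasure_unif:
  assumes "S \<in> sets borel" "A \<in> sets borel" "emeasure lborel S < \<infinity>" "0 < measure lborel S"
  shows "emeasure (unif S) A = emeasure lborel (S \<inter> A) / emeasure lborel S"
proof -
  have e: "emeasure lborel S = ennreal (measure lborel S)" using assms by (simp add: emeasure_eq_ennreal_measure)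
  have "emeasure (unif S) A = (\<integral>\<^sup>+x. ennreal (indicator S x / measure lborel S) * indicator A x \<partial>lborel)"
    unfolding unif_def using assms by (intro emeasure_density) simp_all
  also have "\<dots> = (\<integral>\<^sup>+x. ennreal (1 / measure lborel S) * indicator (S \<inter> A) x \<partial>lborel)"
    by (intro nn_integral_cong) (simp split: split_indicator)
  also have "\<dots> = ennreal (1 / measure lborel S) * emeasure lborel (S \<inter> A)"
    using assms by (subst nn_integral_cmult_indicator) auto
  also have "\<dots> = emeasure lborel (S \<inter> A) / emeasure lborel S"
    unfolding e divide_ennreal_def using assms
    by (simp add: inverse_ennreal inverse_eq_divide mult.commute)
  finally show ?thesis .
qed

lemma prob_space_unif:
  assumes "S \<in> sets borel" "emeasure lborel S < \<infinity>" "0 < measure lborel S"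
  shows "prob_space (unif S)"
proof
  have "emeasure lborel S = ennreal (measure lborel S)" using assms by (simp add: emeasure_eq_ennreal_measure)
  then show "emeasure (unif S) (space (unif S)) = 1"
    using emeasure_unif[of S UNIV] assms by (simp add: divide_self_if ennreal_divide_self)
qed

lemma unif_triple:
  fixes S' S :: "'a::euclidean_space set"
  assumes S: "S \<in> sets borel" "emeasure lborel S < \<infinity>" "0 < measure lborel S"
    and S': "S' \<in> sets borel" "emeasure lborel S' < \<infinity>" "0 < measure lborel S'"
  shows "unif S' \<Otimes>\<^sub>M (unif S \<Otimes>\<^sub>M unif S)
    = density lborel (\<lambda>w. ennreal (indicator (S' \<times> S \<times> S) w / (measure lborel S' * (measure lborel S * measure lborel S))))"
proof -
  interpret P: prob_space "unif S" by (rule prob_space_unif[OF S])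
  interpret PP: pair_prob_space "unif S" "unif S" ..
  have mS: "(\<lambda>x::'a. ennreal (indicator A x / c)) \<in> borel_measurable lborel" if "A \<in> sets borel" for A c
    using that by measurable
  have pair: "unif S \<Otimes>\<^sub>M unif S = density lborel (\<lambda>z. ennreal (indicator (S \<times> S) z / (measure lborel S * measure lborel S)))"
  proof -
    have "unif S \<Otimes>\<^sub>M unif S = density (lborel \<Otimes>\<^sub>M lborel) (\<lambda>(x, y). ennreal (indicator S x / measure lborel S) * ennreal (indicator S y / measure lborel S))"
      unfolding unif_def
      by (rule pair_measure_density) (use mS[OF S(1)] P.sigma_finite_measure_axioms in \<open>auto simp: unif_def lborel.sigma_finite_measure_axioms\<close>)
    also have "\<dots> = density lborel (\<lambda>z. ennreal (indicator (S \<times> S) z / (measure lborel S * measure lborel S)))"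
      unfolding lborel_prod by (intro arg_cong[of _ _ "density lborel"] ext)
        (auto simp: ennreal_mult[symmetric] indicator_def)
    finally show ?thesis .
  qed
  have mSS: "(\<lambda>z. ennreal (indicator (S \<times> S) z / (measure lborel S * measure lborel S))) \<in> borel_measurable lborel"
    using borel_Times[OF S(1) S(1)] by measurable
  have "unif S' \<Otimes>\<^sub>M (unif S \<Otimes>\<^sub>M unif S) = density (lborel \<Otimes>\<^sub>M lborel) (\<lambda>(x, z). ennreal (indicator S' x / measure lborel S')
      * ennreal (indicator (S \<times> S) z / (measure lborel S * measure lborel S)))"
    unfolding pair unif_def[of S']
    by (rule pair_measure_density)
       (use mS[OF S'(1)] mSS PP.sigma_finite_measure_axioms[unfolded pair] in \<open>auto simp: lborel.sigma_finite_measure_axioms\<close>)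
  also have "\<dots> = density lborel (\<lambda>w. ennreal (indicator (S' \<times> S \<times> S) w / (measure lborel S' * (measure lborel S * measure lborel S))))"
    unfolding lborel_prod by (intro arg_cong[of _ _ "density lborel"] ext)
      (auto simp: ennreal_mult[symmetric] indicator_def)
  finally show ?thesis .
qed

lemma ennreal_inverse_2: "inverse (2::ennreal) = ennreal (1/2)"
  using inverse_ennreal[of 2] by (simp add: inverse_eq_divide)

lemma conj_exponent_1: "conj_exponent 1 = \<infinity>"
  by (simp add: conj_exponent_def)

lemma conj_exponent_2: "conj_exponent 2 = 2"
proof -
  have "1 - inverse (2::ennreal) = ennreal (1/2)"
    unfolding ennreal_inverse_2 using ennreal_minus[of "1/2" 1] by simp
  then show ?thesis using inverse_ennreal[of "1/2"] by (simp add: conj_exponent_def)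
qed

lemma Lp_norm_2:
  fixes f :: "'a::euclidean_space \<Rightarrow> complex"
  assumes "square_integrable lborel f"
  shows "Lp_norm 2 f = ennreal (l2norm lborel f)"
proof -
  have i: "integrable lborel (\<lambda>x. (cmod (f x))\<^sup>2)" using assms by (simp add: square_integrable_def)
  have "(\<integral>\<^sup>+x. ennreal (cmod (f x) powr enn2real 2) \<partial>lebesgue) = (\<integral>\<^sup>+x. ennreal ((cmod (f x))\<^sup>2) \<partial>lborel)"
    unfolding nn_integral_completion by (simp add: powr_numeral)
  also have "\<dots> = ennreal (\<integral>x. (cmod (f x))\<^sup>2 \<partial>lborel)"
    by (rule nn_integral_eq_integral[OF i]) simp
  finally show ?thesis
    by (simp add: Lp_norm_def ennreal_rpow_def l2norm_def powr_half_sqrt)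
qed

lemma Lp_norm_infty_le:
  fixes h :: "'a::euclidean_space \<Rightarrow> complex"
  assumes "h \<in> borel_measurable borel" "\<And>x. cmod (h x) \<le> s"
  shows "Lp_norm \<infinity> h \<le> ennreal s"
proof -
  have "(\<lambda>x. ennreal (cmod (h x))) \<in> borel_measurable lborel" using assms(1) by simp
  then have "(\<lambda>x. ennreal (cmod (h x))) \<in> borel_measurable lebesgue" by (rule measurable_completion)
  then show ?thesis unfolding Lp_norm_def
    using assms(2) by (auto intro!: esssup_I ennreal_leI)
qed

lemma nn_integral_unif:
  fixes g :: "'a::euclidean_space \<Rightarrow> ennreal"
  assumes S: "S \<in> sets borel" "emeasure lborel S < \<infinity>" "0 < measure lborel S" and g: "g \<in> borel_measurable borel"
  shows "(\<integral>\<^sup>+x. g x \<partial>unif S) = (\<integral>\<^sup>+x\<in>S. g x \<partial>lborel) / emeasure lborel S"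
proof -
  have e: "emeasure lborel S = ennreal (measure lborel S)" using S by (simp add: emeasure_eq_ennreal_measure)
  have "(\<integral>\<^sup>+x. g x \<partial>unif S) = (\<integral>\<^sup>+x. ennreal (indicator S x / measure lborel S) * g x \<partial>lborel)"
    unfolding unif_def using S g by (intro nn_integral_density) simp_all
  also have "\<dots> = (\<integral>\<^sup>+x. ennreal (1 / measure lborel S) * (g x * indicator S x) \<partial>lborel)"
    by (intro nn_integral_cong) (simp split: split_indicator)
  also have "\<dots> = ennreal (1 / measure lborel S) * (\<integral>\<^sup>+x\<in>S. g x \<partial>lborel)"
    using S g by (intro nn_integral_cmult) simp
  also have "\<dots> = (\<integral>\<^sup>+x\<in>S. g x \<partial>lborel) / emeasure lborel S"
    unfolding e divide_ennreal_def using S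
    by (simp add: inverse_ennreal inverse_eq_divide mult.commute)
  finally show ?thesis .
qed

lemma avg_abs_unif:
  fixes F F' :: "'a::euclidean_space \<Rightarrow> complex"
  assumes S: "S \<in> sets borel" "emeasure lborel S < \<infinity>" "0 < measure lborel S"
    and F': "F' \<in> borel_measurable borel" "AE x in lebesgue. F x = F' x"
    and i: "integrable (unif S) (\<lambda>x. cmod (F' x) powr r)"
  shows "avg_abs r F S = ennreal ((\<integral>x. cmod (F' x) powr r \<partial>unif S) powr (1 / r))"
proof -
  have "(\<integral>\<^sup>+x\<in>S. ennreal (cmod (F x) powr r) \<partial>lebesgue) = (\<integral>\<^sup>+x\<in>S. ennreal (cmod (F' x) powr r) \<partial>lebesgue)"
  proof (rule nn_integral_cong_AE)
    show "AE x in lebesgue. ennreal (cmod (F x) powr r) * indicator S x = ennreal (cmod (F' x) powr r) * indicator S x"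
      using F'(2) by eventually_elim simp
  qed
  also have "\<dots> = (\<integral>\<^sup>+x\<in>S. ennreal (cmod (F' x) powr r) \<partial>lborel)"
    by (rule nn_integral_completion)
  finally have "(\<integral>\<^sup>+x\<in>S. ennreal (cmod (F x) powr r) \<partial>lebesgue) / emeasure lebesgue S
      = (\<integral>\<^sup>+x. ennreal (cmod (F' x) powr r) \<partial>unif S)"
    using nn_integral_unif[OF S, of "\<lambda>x. ennreal (cmod (F' x) powr r)"] F'(1) S(1) by simp
  also have "\<dots> = ennreal (\<integral>x. cmod (F' x) powr r \<partial>unif S)"
    by (rule nn_integral_eq_integral[OF i]) simp
  finally show ?thesis
    by (simp add: avg_abs_def ennreal_rpow_def)
qed

lemma avg_abs_2_unif:
  fixes F F' :: "'a::euclidean_space \<Rightarrow> complex"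
  assumes S: "S \<in> sets borel" "emeasure lborel S < \<infinity>" "0 < measure lborel S"
    and F': "square_integrable (unif S) F'" "AE x in lebesgue. F x = F' x"
  shows "avg_abs 2 F S = ennreal (l2norm (unif S) F')"
proof -
  have b: "F' \<in> borel_measurable borel"
    using F'(1) by (auto simp: square_integrable_def cong: measurable_cong_sets)
  have "integrable (unif S) (\<lambda>x. cmod (F' x) powr 2)" using F'(1) by (simp add: square_integrable_def powr_numeral)
  from avg_abs_unif[OF S b F'(2) this] show ?thesis
    by (simp add: l2norm_def powr_numeral powr_half_sqrt)
qed

lemma avg_abs_1_unif:
  fixes F F' :: "'a::euclidean_space \<Rightarrow> complex"
  assumes S: "S \<in> sets borel" "emeasure lborel S < \<infinity>" "0 < measure lborel S"
    and F': "integrable (unif S) F'" "AE x in lebesgue. F x = F' x"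
  shows "avg_abs 1 F S = ennreal (\<integral>x. cmod (F' x) \<partial>unif S)"
proof -
  have "F' \<in> borel_measurable (unif S)" using F'(1) by auto
  then have b: "F' \<in> borel_measurable borel" by (simp cong: measurable_cong_sets)
  have "integrable (unif S) (\<lambda>x. cmod (F' x) powr 1)" using F'(1) by simp
  from avg_abs_unif[OF S b F'(2) this] show ?thesis by simp
qed

lemma avg_unif:
  fixes F F' :: "'a::euclidean_space \<Rightarrow> complex"
  assumes S: "S \<in> sets borel" and F': "F' \<in> borel_measurable borel" "AE x in lebesgue. F x = F' x"
  shows "avg F S = (\<integral>x. F' x \<partial>unif S)"
proof -
  have "(LINT x:S|lebesgue. F x) = (LINT x|lborel. indicator S x *\<^sub>R F' x)"
    unfolding set_lebesgue_integral_def
  proof (rule integral_lebesgue_AE_borel)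
    show "AE x in lebesgue. indicat_real S x *\<^sub>R F x = indicat_real S x *\<^sub>R F' x"
      using F'(2) by eventually_elim simp
  qed (use S F'(1) in simp)
  moreover have "(\<integral>x. F' x \<partial>unif S) = (1 / measure lborel S) *\<^sub>R (LINT x|lborel. indicator S x *\<^sub>R F' x)"
  proof -
    have "(\<lambda>x. (indicator S x / measure lborel S) *\<^sub>R F' x) = (\<lambda>x. (1 / measure lborel S) *\<^sub>R (indicator S x *\<^sub>R F' x))"
      by auto
    then show ?thesis unfolding unif_integral(2)[OF S F'(1)] by (simp only: integral_scaleR_right)
  qed
  ultimately show ?thesis using S by (simp add: avg_def inverse_eq_divide)
qed

lemma L2_loc_borel_version:
  fixes b :: "'a::euclidean_space \<Rightarrow> complex"
  assumes "L2_loc b"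
  obtains b' where "b' \<in> borel_measurable borel" "AE x in lebesgue. b x = b' x"
proof -
  have "b \<in> borel_measurable (completion lborel)" using assms by (simp add: L2_loc_def)
  then obtain b' where "b' \<in> borel_measurable lborel" "AE x in lborel. b x = b' x"
    by (rule completion_ex_borel_measurable_complex)
  then show thesis using that[of b'] by (simp add: AE_completion)
qed

lemma L2_loc_square_integrable:
  fixes b b' :: "'a::euclidean_space \<Rightarrow> complex"
  assumes b: "L2_loc b" and b': "b' \<in> borel_measurable borel" "AE x in lebesgue. b x = b' x"
    and S: "compact S"
  shows "square_integrable (unif S) b'"
proof -
  have Sb: "S \<in> sets borel" using S by (simp add: borel_compact)
  let ?G = "\<lambda>x. indicat_real S x *\<^sub>R (cmod (b' x))\<^sup>2"
  have i: "integrable lebesgue (\<lambda>x. indicator S x *\<^sub>R (cmod (b x))\<^sup>2)"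
    using b S by (simp add: L2_loc_def set_integrable_def)
  have m: "?G \<in> borel_measurable borel"
  proof -
    note [measurable] = Sb b'(1)
    show ?thesis by measurable
  qed
  then have m1: "?G \<in> borel_measurable lborel" by simp
  have ae: "AE x in lebesgue. indicat_real S x *\<^sub>R (cmod (b x))\<^sup>2 = ?G x"
    using b'(2) by eventually_elim simp
  have "integrable lebesgue ?G"
    by (rule integrable_cong_AE[THEN iffD1, OF borel_measurable_lebesgue_AE[OF m ae] measurable_completion[OF m1] ae i])
  then have "integrable lborel ?G" by (rule integrable_completion[OF m1, THEN iffD1])
  then have "integrable lborel (\<lambda>x. (1 / measure lborel S) *\<^sub>R (indicator S x *\<^sub>R (cmod (b' x))\<^sup>2))"
    by (rule integrable_scaleR_right)
  then have "integrable (unif S) (\<lambda>x. (cmod (b' x))\<^sup>2)"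
    using b'(1) by (subst unif_integral(1)[OF Sb]) auto
  then show ?thesis using b'(1) by (simp add: square_integrable_def cong: measurable_cong_sets)
qed

section \<open>The form on functions with separated supports\<close>

text \<open>
  The scales that matter are \<open>2\<^sup>\<nu> \<ge> 4 \<rho>2\<close> and \<open>2\<^sup>\<mu> \<le> 2 \<rho>1\<close>: then the first cutoff is \<open>1\<close> and the second
  is \<open>0\<close> on the whole annulus.
\<close>

lemma cutoff_window:
  fixes \<rho>1 \<rho>2 :: real
  assumes \<eta>: "is_cutoff \<eta>" and "0 < \<rho>1"
  shows "eventually (\<lambda>(\<mu>, \<nu>). \<forall>t. \<rho>1 \<le> t \<and> t \<le> \<rho>2 \<longrightarrow> \<eta> (2 powi (- \<nu>) * t) - \<eta> (2 powi (- \<mu>) * t) = 1)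
    (at_bot \<times>\<^sub>F at_top)"
proof -
  have one: "\<eta> s = 1" if "0 \<le> s" "s \<le> 1/4" for s using \<eta> that by (simp add: is_cutoff_def)
  have zero: "\<eta> s = 0" if "1/2 \<le> s" for s using \<eta> that by (simp add: is_cutoff_def)
  obtain m where m: "1 / \<rho>1 < 2 ^ m" using real_arch_pow[of 2 "1 / \<rho>1"] by auto
  obtain n where n: "4 * \<rho>2 < 2 ^ n" using real_arch_pow[of 2 "4 * \<rho>2"] by auto
  have "eventually (\<lambda>\<mu>. \<forall>t. \<rho>1 \<le> t \<longrightarrow> \<eta> (2 powi (- \<mu>) * t) = 0) at_bot"
    unfolding eventually_at_bot_linorder
  proof (intro exI[of _ "- int m"] allI impI)
    fix \<mu> t assume \<mu>: "\<mu> \<le> - int m" and t: "\<rho>1 \<le> t"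
    have "1 / \<rho>1 \<le> 2 powi (- \<mu>)"
      using m power_int_increasing[of "int m" "- \<mu>" "2::real"] \<mu> by simp
    then have "1 / \<rho>1 * \<rho>1 \<le> 2 powi (- \<mu>) * t" using t \<open>0 < \<rho>1\<close> by (intro mult_mono) auto
    then show "\<eta> (2 powi (- \<mu>) * t) = 0" using \<open>0 < \<rho>1\<close> by (intro zero) simp
  qed
  moreover have "eventually (\<lambda>\<nu>. \<forall>t. 0 \<le> t \<and> t \<le> \<rho>2 \<longrightarrow> \<eta> (2 powi (- \<nu>) * t) = 1) at_top"
    unfolding eventually_at_top_linorder
  proof (intro exI[of _ "int n"] allI impI)
    fix \<nu> t assume \<nu>: "int n \<le> \<nu>" and t: "0 \<le> t \<and> t \<le> \<rho>2"
    have "(2::real) powi (- \<nu>) \<le> 2 powi (- int n)"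
      using \<nu> by (intro power_int_increasing) auto
    also have "\<dots> = 1 / (2::real) ^ n" by (simp add: power_int_minus inverse_eq_divide)
    finally have "2 powi (- \<nu>) * t \<le> 1 / (2::real) ^ n * \<rho>2" using t by (intro mult_mono) auto
    also have "\<dots> \<le> 1/4" using n by (simp add: field_simps)
    finally show "\<eta> (2 powi (- \<nu>) * t) = 1" using t by (intro one) auto
  qed
  ultimately have "eventually (\<lambda>p. (\<forall>t. \<rho>1 \<le> t \<longrightarrow> \<eta> (2 powi (- fst p) * t) = 0) \<and>
      (\<forall>t. 0 \<le> t \<and> t \<le> \<rho>2 \<longrightarrow> \<eta> (2 powi (- snd p) * t) = 1)) (at_bot \<times>\<^sub>F at_top)"
    by (rule eventually_prodI)
  then show ?thesis by eventually_elim (use \<open>0 < \<rho>1\<close> in auto)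
qed

text \<open>
  For \<open>x \<in> Q'\<close> and \<open>z1, z2 \<in> Q\<close> the argument of the kernel stays in an annulus, where the kernel is
  bounded and only finitely many scales are seen. The function \<open>\<omega>\<close> is a Borel representative of
  \<open>\<Omega>\<close>, extended homogeneously.
\<close>

locale separated_sets =
  fixes \<Omega> :: "'a::euclidean_space \<times> 'a \<Rightarrow> complex" and \<omega> :: "'a \<times> 'a \<Rightarrow> complex" and B :: real
    and \<eta> :: "real \<Rightarrow> real" and Q Q' :: "'a set" and \<rho>1 \<rho>2 :: real
  assumes \<omega>_borel: "\<omega> \<in> borel_measurable borel" and \<omega>_bound: "cmod (\<omega> y) \<le> B"
    and \<omega>_AE: "AE y in lebesgue. hom0 \<Omega> y = \<omega> y" and \<eta>: "is_cutoff \<eta>"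
    and Q: "Q \<in> sets borel" "bounded Q" and Q': "Q' \<in> sets borel" "bounded Q'"
    and \<rho>1: "0 < \<rho>1"
    and separated: "x \<in> Q' \<Longrightarrow> z1 \<in> Q \<Longrightarrow> z2 \<in> Q \<Longrightarrow> \<rho>1 \<le> norm (x - z1, x - z2) \<and> norm (x - z1, x - z2) \<le> \<rho>2"
begin

definition K :: "'a \<times> 'a \<Rightarrow> complex" where
  "K y = \<omega> y / of_real (norm y ^ (2 * DIM('a)))"

text \<open>
  A triple \<open>w = (x, z1, z2)\<close> consists of the output point and the two input points.
\<close>

definition Kw :: "'a \<times> 'a \<times> 'a \<Rightarrow> complex" where
  "Kw w = K (fst w - fst (snd w), fst w - snd (snd w))"

definition box :: "('a \<times> 'a \<times> 'a) set" where "box = Q' \<times> Q \<times> Q"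

definition tri :: "('a \<Rightarrow> complex) \<Rightarrow> ('a \<Rightarrow> complex) \<Rightarrow> ('a \<Rightarrow> complex) \<Rightarrow> 'a \<times> 'a \<times> 'a \<Rightarrow> complex" where
  "tri f1 f2 h w = f1 (fst (snd w)) * f2 (snd (snd w)) * h (fst w)"

lemma K_borel: "K \<in> borel_measurable borel"
  unfolding K_def[abs_def] using \<omega>_borel by measurable

lemma Kw_borel: "Kw \<in> borel_measurable borel"
  unfolding Kw_def[abs_def] by (intro borel_measurable_comp_continuous[OF K_borel] continuous_intros)

lemma tri_borel:
  assumes "f1 \<in> borel_measurable borel" "f2 \<in> borel_measurable borel" "h \<in> borel_measurable borel"
  shows "tri f1 f2 h \<in> borel_measurable borel"
  unfolding tri_def[abs_def]
  by (intro borel_measurable_times assms[THEN borel_measurable_comp_continuous] continuous_intros)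

lemma Kw_bound: "w \<in> box \<Longrightarrow> cmod (Kw w) \<le> B / \<rho>1 ^ (2 * DIM('a))"
proof -
  assume "w \<in> box"
  then have "\<rho>1 \<le> norm (fst w - fst (snd w), fst w - snd (snd w))"
    using separated[of "fst w" "fst (snd w)" "snd (snd w)"] by (auto simp: box_def)
  then show ?thesis
    unfolding Kw_def K_def norm_divide norm_of_real using \<omega>_bound \<rho>1
    by (intro frac_le) (auto intro!: power_mono order_trans[OF norm_ge_zero \<omega>_bound])
qed

lemma box_borel: "box \<in> sets borel" unfolding box_def using Q Q' by (intro borel_Times) auto

lemma box_finite: "emeasure lborel box < \<infinity>"
  unfolding box_def using Q Q' by (intro emeasure_bounded_finite bounded_Times) auto

text \<open>
  The form is applied to \<open>F\<close>, a Lebesgue measurable function such as a product with a symbol, while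
  integrals over products of spaces require the Borel function \<open>F'\<close>. Both vanish off \<open>S\<close> at every
  point, which keeps all arguments of the kernel in the annulus.
\<close>

definition represents :: "'a set \<Rightarrow> ('a \<Rightarrow> complex) \<Rightarrow> ('a \<Rightarrow> complex) \<Rightarrow> bool" where
  "represents S F F' \<longleftrightarrow> F' \<in> borel_measurable borel \<and> (\<forall>z. z \<notin> S \<longrightarrow> F z = 0 \<and> F' z = 0) \<and>
     (\<exists>M. \<forall>z. cmod (F' z) \<le> M) \<and> (AE z in lebesgue. F z = F' z)"

lemma tri_integrable:
  assumes "represents Q F1 F1'" "represents Q F2 F2'" "represents Q' H H'"
  shows "integrable lborel (\<lambda>w. Kw w * tri F1' F2' H' w)"
proof -
  obtain M1 M2 M3 where M: "\<And>z. cmod (F1' z) \<le> M1" "\<And>z. cmod (F2' z) \<le> M2" "\<And>z. cmod (H' z) \<le> M3"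
    using assms unfolding represents_def by metis
  have M0: "0 \<le> M1" "0 \<le> M2" "0 \<le> M3" using M[THEN order_trans[OF norm_ge_zero]] by auto
  show ?thesis
  proof (rule integrable_dominated[of lborel "\<lambda>w. B / \<rho>1 ^ (2 * DIM('a)) * (M1 * M2 * M3) * indicator box w"])
    show "integrable lborel (\<lambda>w. B / \<rho>1 ^ (2 * DIM('a)) * (M1 * M2 * M3) * indicat_real box w)"
      by (intro integrable_mult_right integrable_real_indicator) (use box_borel box_finite in auto)
    show "(\<lambda>w. Kw w * tri F1' F2' H' w) \<in> borel_measurable lborel"
      using borel_measurable_times[OF Kw_borel tri_borel[of F1' F2' H']] assms unfolding represents_def by simp
    fix w :: "'a \<times> 'a \<times> 'a"
    show "norm (Kw w * tri F1' F2' H' w) \<le> B / \<rho>1 ^ (2 * DIM('a)) * (M1 * M2 * M3) * indicator box w"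
    proof (cases "w \<in> box")
      case True
      have "cmod (tri F1' F2' H' w) \<le> M1 * M2 * M3"
        unfolding tri_def norm_mult using M M0 by (intro mult_mono) auto
      moreover have "indicator box w = (1::real)" using True by simp
      ultimately show ?thesis using Kw_bound[OF True] by (simp only: norm_mult mult_1_right) (rule mult_mono', auto)
    next
      case False
      then have "tri F1' F2' H' w = 0" using assms by (auto simp: box_def tri_def represents_def mem_Times_iff)
      then show ?thesis using False by simp
    qed
  qed
qed

lemma T_trunc_pairing:
  assumes F1: "represents Q F1 F1'" and F2: "represents Q F2 F2'" and H: "represents Q' H H'"
    and win: "\<And>t. \<rho>1 \<le> t \<Longrightarrow> t \<le> \<rho>2 \<Longrightarrow> \<eta> (2 powi (- \<nu>) * t) - \<eta> (2 powi (- \<mu>) * t) = 1"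
  shows "pairing (T_trunc \<eta> \<Omega> \<mu> \<nu> F1 F2) H = (LINT w|lborel. Kw w * tri F1' F2' H' w)"
proof -
  have [measurable]: "F1' \<in> borel_measurable borel" "F2' \<in> borel_measurable borel" "H' \<in> borel_measurable borel"
    using assms by (auto simp: represents_def)
  define g where "g x y = K y * (F1' (x - fst y) * F2' (x - snd y))" for x y
  have g_pair: "(\<lambda>w. g (fst w) (snd w)) \<in> borel_measurable (borel :: ('a \<times> 'a \<times> 'a) measure)"
  proof -
    have "(\<lambda>w::'a \<times> 'a \<times> 'a. K (snd w)) \<in> borel_measurable borel"
      by (rule borel_measurable_comp_continuous[OF K_borel]) (intro continuous_intros)
    moreover have "(\<lambda>w::'a \<times> 'a \<times> 'a. F1' (fst w - fst (snd w))) \<in> borel_measurable borel"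
      by (rule borel_measurable_comp_continuous[of F1'], fact) (intro continuous_intros)
    moreover have "(\<lambda>w::'a \<times> 'a \<times> 'a. F2' (fst w - snd (snd w))) \<in> borel_measurable borel"
      by (rule borel_measurable_comp_continuous[of F2'], fact) (intro continuous_intros)
    ultimately show ?thesis unfolding g_def by (rule borel_measurable_times[OF _ borel_measurable_times])
  qed
  have g_borel: "g x \<in> borel_measurable borel" for x
    using borel_measurable_comp_continuous[OF g_pair, of "\<lambda>y. (x, y)"]
    by (simp add: continuous_on_Pair continuous_on_id)
  have T_trunc_eq: "T_trunc \<eta> \<Omega> \<mu> \<nu> F1 F2 x = (LINT y|lborel. g x y)" if x: "x \<in> Q'" for x
    unfolding T_trunc_def
  proof (rule integral_lebesgue_AE_borel[OF g_borel])
    have "AE z in lebesgue. F1 z = F1' z \<and> F2 z = F2' z" using F1 F2 by (auto simp: represents_def)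
    from AE_lebesgue_coordinates[OF this, of x] \<omega>_AE
    show "AE y in lebesgue. kernel \<Omega> y * complex_of_real (\<eta> (2 powi - \<nu> * norm y) - \<eta> (2 powi - \<mu> * norm y)) *
        F1 (x - fst y) * F2 (x - snd y) = g x y"
    proof eventually_elim
      case (elim y)
      show ?case
      proof (cases "x - fst y \<in> Q \<and> x - snd y \<in> Q")
        case True
        then have "\<rho>1 \<le> norm y" "norm y \<le> \<rho>2"
          using separated[OF x, of "x - fst y" "x - snd y"] by simp_all
        then show ?thesis using elim win[of "norm y"] by (simp add: g_def K_def kernel_def)
      next
        case False
        then have "F1 (x - fst y) * F2 (x - snd y) = 0" "F1' (x - fst y) * F2' (x - snd y) = 0"
          using F1 F2 by (auto simp: represents_def)
        then show ?thesis unfolding g_def mult.assoc by (simp only: mult_zero_right)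
      qed
    qed
  qed
  have "pairing (T_trunc \<eta> \<Omega> \<mu> \<nu> F1 F2) H = (LINT x|lborel. (LINT y|lborel. g x y) * H' x)"
    unfolding pairing_def
  proof (rule integral_lebesgue_AE_borel)
    have "(\<lambda>(x, y). g x y) \<in> borel_measurable (lborel \<Otimes>\<^sub>M lborel :: ('a \<times> 'a \<times> 'a) measure)"
      unfolding lborel_prod using g_pair by (simp add: split_def)
    then have "(\<lambda>x. LINT y|lborel. g x y) \<in> borel_measurable lborel"
      by (rule lborel.borel_measurable_lebesgue_integral)
    then show "(\<lambda>x. (LINT y|lborel. g x y) * H' x) \<in> borel_measurable borel" by simp
    have "AE x in lebesgue. H x = H' x" using H by (simp add: represents_def)
    then show "AE x in lebesgue. T_trunc \<eta> \<Omega> \<mu> \<nu> F1 F2 x * H x = (LINT y|lborel. g x y) * H' x"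
    proof eventually_elim
      case (elim x)
      show ?case
      proof (cases "x \<in> Q'")
        case True then show ?thesis using T_trunc_eq elim by simp
      next
        case False then show ?thesis using H by (simp add: represents_def)
      qed
    qed
  qed
  also have "\<dots> = (LINT x|lborel. (LINT z|lborel. Kw (x, z) * tri F1' F2' H' (x, z)))"
  proof (rule Bochner_Integration.integral_cong[OF refl])
    fix x
    have "(LINT y|lborel. g x y) = (LINT z|lborel. g x ((x, x) - z))"
      using integral_lborel_reflect[OF g_borel, of x "(x, x)"] by simp
    then have "(LINT y|lborel. g x y) * H' x = (LINT z|lborel. g x ((x, x) - z) * H' x)" by simp
    also have "\<dots> = (LINT z|lborel. Kw (x, z) * tri F1' F2' H' (x, z))"
      by (intro Bochner_Integration.integral_cong) (auto simp: g_def Kw_def tri_def)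
    finally show "(LINT y|lborel. g x y) * H' x = (LINT z|lborel. Kw (x, z) * tri F1' F2' H' (x, z))" .
  qed
  also have "\<dots> = (LINT w|lborel. Kw w * tri F1' F2' H' w)"
    using lborel_pair.integral_fst'[of "\<lambda>w. Kw w * tri F1' F2' H' w"] tri_integrable[OF assms(1-3)]
    unfolding lborel_prod by simp
  finally show ?thesis .
qed

text \<open>
  All truncated forms whose scales cover the annulus have the same value, which is therefore the
  limit.
\<close>

lemma T_form_separated:
  assumes "represents Q F1 F1'" "represents Q F2 F2'" "represents Q' H H'"
  shows "T_form \<eta> \<Omega> F1 F2 H = (LINT w|lborel. Kw w * tri F1' F2' H' w)"
  unfolding T_form_def
proof (rule tendsto_Lim)
  show "((\<lambda>(\<mu>, \<nu>). pairing (T_trunc \<eta> \<Omega> \<mu> \<nu> F1 F2) H) \<longlongrightarrow> (LINT w|lborel. Kw w * tri F1' F2' H' w)) (at_bot \<times>\<^sub>F at_top)"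
    by (rule tendsto_eventually, rule eventually_mono[OF cutoff_window[OF \<eta> \<rho>1, of \<rho>2]])
       (auto intro!: T_trunc_pairing[OF assms])
qed (simp add: prod_filter_eq_bot)

end

text \<open>
  The primed symbols are Borel representatives.
\<close>

locale separated_symbols = separated_sets \<Omega> \<omega> B \<eta> Q Q' \<rho>1 \<rho>2
  for \<Omega> :: "'a::euclidean_space \<times> 'a \<Rightarrow> complex" and \<omega> B \<eta> Q Q' \<rho>1 \<rho>2 +
  fixes b1 b2 b1' b2' :: "'a \<Rightarrow> complex"
  assumes b1': "b1' \<in> borel_measurable borel" "AE z in lebesgue. b1 z = b1' z"
    and b2': "b2' \<in> borel_measurable borel" "AE z in lebesgue. b2 z = b2' z"
begin

text \<open>
  Where both symbols are bounded on the support, a product with a symbol is again of this kind. Hence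
  such functions are admissible, and the four terms of the expansion of a commutator fall under
  \<open>T_form_separated\<close>.
\<close>

definition truncated :: "'a set \<Rightarrow> ('a \<Rightarrow> complex) \<Rightarrow> ('a \<Rightarrow> complex) \<Rightarrow> bool" where
  "truncated S F F' \<longleftrightarrow> represents S F F' \<and> (\<exists>n. \<forall>z. F' z \<noteq> 0 \<longrightarrow> cmod (b1' z) \<le> n \<and> cmod (b2' z) \<le> n)"

lemma truncated_mult:
  assumes "truncated S F F'"
  shows "truncated S (\<lambda>z. b1 z * F z) (\<lambda>z. b1' z * F' z)" "truncated S (\<lambda>z. b2 z * F z) (\<lambda>z. b2' z * F' z)"
proof -
  have "truncated S (\<lambda>z. b z * F z) (\<lambda>z. b' z * F' z)"
    if b': "b' \<in> borel_measurable borel" "AE z in lebesgue. b z = b' z"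
      and bd: "\<And>n. \<forall>z. F' z \<noteq> 0 \<longrightarrow> cmod (b1' z) \<le> n \<and> cmod (b2' z) \<le> n \<Longrightarrow> \<forall>z. F' z \<noteq> 0 \<longrightarrow> cmod (b' z) \<le> n" for b b'
  proof -
    obtain n where n: "\<forall>z. F' z \<noteq> 0 \<longrightarrow> cmod (b1' z) \<le> n \<and> cmod (b2' z) \<le> n" using assms by (auto simp: truncated_def)
    obtain M where M: "\<And>z. cmod (F' z) \<le> M" using assms by (auto simp: truncated_def represents_def)
    have M0: "0 \<le> M" using M[THEN order_trans[OF norm_ge_zero]] by auto
    have le: "cmod (b' z * F' z) \<le> max n 0 * M" for z
      using bd[OF n] M M0 by (cases "F' z = 0") (auto simp: norm_mult intro!: mult_mono)
    have ae: "AE z in lebesgue. F z = F' z" using assms by (simp add: truncated_def represents_def)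
    have "AE z in lebesgue. b z * F z = b' z * F' z" using b'(2) ae by eventually_elim simp
    then show ?thesis using assms b' le n unfolding truncated_def represents_def by auto
  qed
  from this[OF b1'] this[OF b2']
  show "truncated S (\<lambda>z. b1 z * F z) (\<lambda>z. b1' z * F' z)" "truncated S (\<lambda>z. b2 z * F z) (\<lambda>z. b2' z * F' z)" by simp_all
qed

lemma represents_Linf: "represents S F F' \<Longrightarrow> Linf lebesgue F"
  unfolding Linf_def
proof
  assume r: "represents S F F'"
  then show "F \<in> borel_measurable lebesgue" by (auto simp: represents_def intro: borel_measurable_lebesgue_AE)
  obtain M where M: "\<And>z. cmod (F' z) \<le> M" using r by (auto simp: represents_def)
  have "AE z in lebesgue. F z = F' z" using r by (simp add: represents_def)
  then have "AE z in lebesgue. cmod (F z) \<le> M" by eventually_elim (simp add: M)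
  then show "\<exists>B. AE z in lebesgue. cmod (F z) \<le> B" by blast
qed

lemma truncated_admissible:
  assumes f: "truncated S f f" and S: "bounded S"
  shows "admissible b1 b2 f"
proof -
  have t: "truncated S (\<lambda>z. b1 z * (b2 z * f z)) (\<lambda>z. b1' z * (b2' z * f z))"
    by (intro truncated_mult f)
  have "Linf lebesgue (\<lambda>z. b1 z * f z)" "Linf lebesgue (\<lambda>z. b2 z * f z)"
    "Linf lebesgue (\<lambda>z. b1 z * (b2 z * f z))" "Linf lebesgue f"
    using truncated_mult[OF f] t f by (auto simp: truncated_def intro: represents_Linf)
  moreover have "\<exists>K. compact K \<and> (AE x in lebesgue. x \<notin> K \<longrightarrow> f x = 0)"
  proof (intro exI conjI)
    show "compact (closure S)" using S by simp
    have "f x = 0" if "x \<notin> closure S" for x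
      using that f closure_subset[of S] by (auto simp: truncated_def represents_def)
    then show "AE x in lebesgue. x \<notin> closure S \<longrightarrow> f x = 0" by simp
  qed
  ultimately show ?thesis by (simp add: admissible_def Linf_c_def mult.assoc)
qed

text \<open>
  The factors that the four-term expansions produce. The first commutator compares each input with the
  output. In the second one the transpose puts the output of the commutator into the slot of the second
  input of \<open>T\<close>, so that the two points of \<open>Q\<close> are compared with each other.
\<close>

definition W12 :: "'a \<times> 'a \<times> 'a \<Rightarrow> complex" where
  "W12 w = (b1' (fst w) - b1' (fst (snd w))) * (b2' (fst w) - b2' (snd (snd w)))"

definition W11 :: "'a \<times> 'a \<times> 'a \<Rightarrow> complex" where
  "W11 w = (b1' (snd (snd w)) - b1' (fst (snd w))) * (b2' (snd (snd w)) - b2' (fst (snd w)))"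

lemma integral_alternating4:
  fixes g1 g2 g3 g4 :: "'b \<Rightarrow> complex"
  assumes "integrable M g1" "integrable M g2" "integrable M g3" "integrable M g4"
    "\<And>w. g w = g1 w - g2 w - (g3 w - g4 w)"
  shows "(LINT w|M. g1 w) - (LINT w|M. g2 w) - ((LINT w|M. g3 w) - (LINT w|M. g4 w)) = (LINT w|M. g w)"
  using assms by simp

lemma comm12_separated:
  assumes f1: "truncated Q f1 f1" and f2: "truncated Q f2 f2" and h: "truncated Q' h h"
  shows "comm1 b1 (comm2 b2 (T_form \<eta> \<Omega>)) f1 f2 h = (LINT w|lborel. Kw w * W12 w * tri f1 f2 h w)"
proof -
  note m = truncated_mult
  have r: "represents S F F'" if "truncated S F F'" for S F F' using that by (simp add: truncated_def)
  note a1 = r[OF f1] r[OF f2] r[OF m(2)[OF m(1)[OF h]]]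
    and a2 = r[OF f1] r[OF m(2)[OF f2]] r[OF m(1)[OF h]]
    and a3 = r[OF m(1)[OF f1]] r[OF f2] r[OF m(2)[OF h]]
    and a4 = r[OF m(1)[OF f1]] r[OF m(2)[OF f2]] r[OF h]
  show ?thesis
    unfolding comm1_def comm2_def T_form_separated[OF a1] T_form_separated[OF a2] T_form_separated[OF a3] T_form_separated[OF a4]
    by (rule integral_alternating4[OF tri_integrable[OF a1] tri_integrable[OF a2] tri_integrable[OF a3] tri_integrable[OF a4]])
       (simp add: W12_def tri_def algebra_simps)
qed

lemma comm11_separated:
  assumes f1: "truncated Q f1 f1" and f2: "truncated Q' f2 f2" and h: "truncated Q h h"
  shows "comm1 b1 (comm1 b2 (transpose2 (T_form \<eta> \<Omega>))) f1 f2 h = (LINT w|lborel. Kw w * W11 w * tri f1 h f2 w)"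
proof -
  note m = truncated_mult
  have r: "represents S F F'" if "truncated S F F'" for S F F' using that by (simp add: truncated_def)
  note a1 = r[OF f1] r[OF m(2)[OF m(1)[OF h]]] r[OF f2]
    and a2 = r[OF m(2)[OF f1]] r[OF m(1)[OF h]] r[OF f2]
    and a3 = r[OF m(1)[OF f1]] r[OF m(2)[OF h]] r[OF f2]
    and a4 = r[OF m(2)[OF m(1)[OF f1]]] r[OF h] r[OF f2]
  show ?thesis
    unfolding comm1_def transpose2_def T_form_separated[OF a1] T_form_separated[OF a2] T_form_separated[OF a3] T_form_separated[OF a4]
    by (rule integral_alternating4[OF tri_integrable[OF a1] tri_integrable[OF a2] tri_integrable[OF a3] tri_integrable[OF a4]])
       (simp add: W11_def tri_def algebra_simps)
qed

lemma W_borel: "W12 \<in> borel_measurable borel" "W11 \<in> borel_measurable borel"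
  unfolding W12_def[abs_def] W11_def[abs_def]
  by (intro borel_measurable_times borel_measurable_diff b1'(1)[THEN borel_measurable_comp_continuous]
      b2'(1)[THEN borel_measurable_comp_continuous] continuous_intros)+

definition truncation :: "'a set \<Rightarrow> ('a \<Rightarrow> complex) \<Rightarrow> nat \<Rightarrow> 'a \<Rightarrow> complex" where
  "truncation S f n z = (if z \<in> S \<and> cmod (f z) \<le> n \<and> cmod (b1' z) \<le> n \<and> cmod (b2' z) \<le> n then f z else 0)"

lemma truncation_truncated:
  assumes "f \<in> borel_measurable borel" "S \<in> sets borel"
  shows "truncated S (truncation S f n) (truncation S f n)"
proof -
  note [measurable] = assms b1'(1) b2'(1)
  have "truncation S f n \<in> borel_measurable borel" unfolding truncation_def[abs_def] by measurable
  moreover have "cmod (truncation S f n z) \<le> n" for z by (simp add: truncation_def)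
  ultimately show ?thesis unfolding truncated_def represents_def
    by (auto simp: truncation_def intro!: exI[of _ "real n"])
qed

lemma truncation_le: "cmod (truncation S f n z) \<le> cmod (f z)" by (simp add: truncation_def)

lemma truncation_limit: "z \<in> S \<Longrightarrow> (\<lambda>n. truncation S f n z) \<longlonglongrightarrow> f z"
proof (rule tendsto_eventually)
  assume z: "z \<in> S"
  obtain m where "max (cmod (f z)) (max (cmod (b1' z)) (cmod (b2' z))) \<le> real m"
    using real_arch_simple by blast
  then show "eventually (\<lambda>n. truncation S f n z = f z) sequentially"
    unfolding eventually_sequentially using z by (intro exI[of _ m]) (auto simp: truncation_def)
qed

end

context separated_sets begin

text \<open>
  The value \<open>1\<close> outside \<open>Q' \<times> Q \<times> Q\<close>, which the uniform distributions do not see, extends the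
  bounds demanded by \<open>averaged_kernel\<close> to all triples.
\<close>

definition normalized_kernel :: "complex \<Rightarrow> 'a \<times> 'a \<times> 'a \<Rightarrow> complex" where
  "normalized_kernel c w = (if w \<in> box then c * Kw w else 1)"

lemma normalized_kernel_borel: "normalized_kernel c \<in> borel_measurable borel"
  unfolding normalized_kernel_def[abs_def] using box_borel Kw_borel by measurable

end

context separated_symbols begin

text \<open>
  Admissible functions are bounded, whereas the test functions of the lower bounds are merely square
  integrable. Truncation and dominated convergence lead from the former to the latter. The measures of
  \<open>Q\<close> and \<open>Q'\<close> in the constant come from the passage to uniform distributions.
\<close>

lemma trilinear_bound_of_truncated:
  assumes W: "W \<in> borel_measurable borel" and n: "0 \<le> n"
    and Qp: "emeasure lborel Q < \<infinity>" "0 < measure lborel Q"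
    and Q'p: "emeasure lborel Q' < \<infinity>" "0 < measure lborel Q'"
    and bound: "\<And>f1 f2 h s. truncated Q f1 f1 \<Longrightarrow> truncated Q f2 f2 \<Longrightarrow> truncated Q' h h \<Longrightarrow>
      square_integrable lborel f1 \<Longrightarrow> square_integrable lborel f2 \<Longrightarrow> (\<And>x. cmod (h x) \<le> s) \<Longrightarrow>
      cmod (LINT w|lborel. Kw w * W w * tri f1 f2 h w) \<le> n * l2norm lborel f1 * l2norm lborel f2 * s"
  shows "trilinear_bound (unif Q') (unif Q) (\<lambda>w. normalized_kernel c w * W w)
      (cmod c * n / (measure lborel Q' * measure lborel Q))"
  unfolding trilinear_bound_def
proof (intro allI impI)
  fix f1 f2 h s
  assume f1: "square_integrable (unif Q) f1" and f2: "square_integrable (unif Q) f2"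
    and h: "h \<in> borel_measurable (unif Q')" and hs: "\<forall>x. cmod (h x) \<le> s"
  let ?G = "\<lambda>w. normalized_kernel c w * W w * (f1 (fst (snd w)) * f2 (snd (snd w)) * h (fst w))"
  assume int: "integrable (unif Q' \<Otimes>\<^sub>M (unif Q \<Otimes>\<^sub>M unif Q)) ?G"
  define q q' where "q = measure lborel Q" and "q' = measure lborel Q'"
  have q: "0 < q" "0 < q'" using Qp Q'p by (simp_all add: q_def q'_def)
  have fm: "f1 \<in> borel_measurable borel" "f2 \<in> borel_measurable borel" "h \<in> borel_measurable borel"
    using f1 f2 h by (auto simp: square_integrable_def cong: measurable_cong_sets)
  have tri_eq: "?G w = normalized_kernel c w * W w * tri f1 f2 h w" for w by (simp add: tri_def)
  have Gb: "?G \<in> borel_measurable borel"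
    unfolding tri_eq by (intro borel_measurable_times normalized_kernel_borel W tri_borel fm)
  have dens: "(\<lambda>w. indicator box w / (q' * (q * q))) \<in> borel_measurable lborel" using box_borel by measurable
  have T: "unif Q' \<Otimes>\<^sub>M (unif Q \<Otimes>\<^sub>M unif Q) = density lborel (\<lambda>w. ennreal (indicator box w / (q' * (q * q))))"
    unfolding box_def q_def q'_def by (rule unif_triple[OF Q(1) Qp Q'(1) Q'p])
  let ?S = "\<lambda>w. (indicator box w / (q' * (q * q))) *\<^sub>R ?G w"
  have Si: "integrable lborel ?S" and SI: "integral\<^sup>L (unif Q' \<Otimes>\<^sub>M (unif Q \<Otimes>\<^sub>M unif Q)) ?G = integral\<^sup>L lborel ?S"
  proof -
    have nn: "AE w in lborel. 0 \<le> indicator box w / (q' * (q * q))" using q by simp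
    have Gl: "?G \<in> borel_measurable lborel" using Gb by simp
    show "integrable lborel ?S"
      using int unfolding T integrable_density[OF Gl dens nn] .
    show "integral\<^sup>L (unif Q' \<Otimes>\<^sub>M (unif Q \<Otimes>\<^sub>M unif Q)) ?G = integral\<^sup>L lborel ?S"
      unfolding T integral_density[OF Gl dens nn] ..
  qed
  define g1 where "g1 m = truncation Q f1 m" for m :: nat
  define g2 where "g2 m = truncation Q f2 m" for m :: nat
  define gh where "gh m = truncation Q' h m" for m :: nat
  let ?s = "\<lambda>m w. (c / of_real (q' * (q * q))) * (Kw w * W w * tri (g1 m) (g2 m) (gh m) w)"
  have tr: "truncated Q (g1 m) (g1 m)" "truncated Q (g2 m) (g2 m)" "truncated Q' (gh m) (gh m)" for m
    unfolding g1_def g2_def gh_def using fm by (simp_all add: truncation_truncated Q(1) Q'(1))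
  have bor: "g1 m \<in> borel_measurable borel" "g2 m \<in> borel_measurable borel" "gh m \<in> borel_measurable borel" for m
    using tr by (auto simp: truncated_def represents_def)
  have out: "tri (g1 m) (g2 m) (gh m) w = 0" if "w \<notin> box" for m w
    using that by (auto simp: tri_def box_def mem_Times_iff g1_def g2_def gh_def truncation_def)
  have lim: "(\<lambda>m. integral\<^sup>L lborel (?s m)) \<longlonglongrightarrow> integral\<^sup>L lborel ?S"
  proof (rule integral_dominated_convergence)
    show "?S \<in> borel_measurable lborel" using Si by auto
    show "?s m \<in> borel_measurable lborel" for m
      using borel_measurable_times[OF borel_measurable_times[OF Kw_borel W] tri_borel[OF bor]] by simp
    show "integrable lborel (\<lambda>w. norm (?S w))" using Si by (rule integrable_norm)
    show "AE w in lborel. (\<lambda>m. ?s m w) \<longlonglongrightarrow> ?S w"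
    proof (rule AE_I2)
      fix w :: "'a \<times> 'a \<times> 'a"
      show "(\<lambda>m. ?s m w) \<longlonglongrightarrow> ?S w"
      proof (cases "w \<in> box")
        case True
        then have m: "fst w \<in> Q'" "fst (snd w) \<in> Q" "snd (snd w) \<in> Q" by (auto simp: box_def)
        have "(\<lambda>m. ?s m w) \<longlonglongrightarrow> (c / of_real (q' * (q * q))) * (Kw w * W w * tri f1 f2 h w)"
          unfolding tri_def g1_def g2_def gh_def
          by (intro tendsto_mult tendsto_const truncation_limit m)
        also have "(c / of_real (q' * (q * q))) * (Kw w * W w * tri f1 f2 h w) = ?S w"
          using True by (simp add: normalized_kernel_def tri_def scaleR_conv_of_real)
        finally show ?thesis .
      next
        case False then show ?thesis by (simp add: out)
      qed
    qed
    fix m show "AE w in lborel. norm (?s m w) \<le> norm (?S w)"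
    proof (rule AE_I2)
      fix w :: "'a \<times> 'a \<times> 'a"
      show "norm (?s m w) \<le> norm (?S w)"
      proof (cases "w \<in> box")
        case True
        have le: "cmod (tri (g1 m) (g2 m) (gh m) w) \<le> cmod (tri f1 f2 h w)"
          unfolding tri_def norm_mult g1_def g2_def gh_def
          by (intro mult_mono truncation_le mult_nonneg_nonneg norm_ge_zero)
        have "norm (?s m w) \<le> cmod (c / of_real (q' * (q * q))) * (cmod (Kw w * W w) * cmod (tri f1 f2 h w))"
          using le by (simp only: norm_mult) (intro mult_left_mono; simp)
        also have "\<dots> = norm (?S w)"
          using True by (simp add: normalized_kernel_def tri_def scaleR_conv_of_real norm_mult norm_divide)
        finally show ?thesis .
      next
        case False then show ?thesis by (simp add: out)
      qed
    qed
  qed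
  have l2: "square_integrable lborel (truncation Q f m)" "l2norm lborel (truncation Q f m) \<le> sqrt q * l2norm (unif Q) f"
    if f: "square_integrable (unif Q) f" for f m
  proof -
    have fb [measurable]: "f \<in> borel_measurable borel"
      using f by (auto simp: square_integrable_def cong: measurable_cong_sets)
    have sq: "(\<lambda>z. (cmod (f z))\<^sup>2) \<in> borel_measurable borel" by measurable
    have i: "integrable lborel (\<lambda>z. (indicator Q z / q) *\<^sub>R (cmod (f z))\<^sup>2)"
      and I: "(l2norm (unif Q) f)\<^sup>2 = (LINT z|lborel. (indicator Q z / q) *\<^sub>R (cmod (f z))\<^sup>2)"
      using f unfolding square_integrable_def l2norm_squared unif_integral[OF Q(1) sq] q_def by auto
    have gb: "truncation Q f m \<in> borel_measurable borel"
      using truncation_truncated[OF fb Q(1)] by (simp add: truncated_def represents_def)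
    have le: "(cmod (truncation Q f m z))\<^sup>2 \<le> q * ((indicator Q z / q) *\<^sub>R (cmod (f z))\<^sup>2)" for z
      using q by (auto simp: truncation_def)
    have iq: "integrable lborel (\<lambda>z. q * ((indicator Q z / q) *\<^sub>R (cmod (f z))\<^sup>2))" using i by (rule integrable_mult_right)
    have ic: "integrable lborel (\<lambda>z. (cmod (truncation Q f m z))\<^sup>2)"
      by (rule integrable_dominated[OF iq]) (use gb le in simp_all)
    then show "square_integrable lborel (truncation Q f m)" using gb by (simp add: square_integrable_def)
    have "(l2norm lborel (truncation Q f m))\<^sup>2 \<le> (LINT z|lborel. q * ((indicator Q z / q) *\<^sub>R (cmod (f z))\<^sup>2))"
      unfolding l2norm_squared by (rule integral_mono[OF ic iq le])
    also have "\<dots> = (sqrt q * l2norm (unif Q) f)\<^sup>2" using q I by (simp add: power_mult_distrib)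
    finally show "l2norm lborel (truncation Q f m) \<le> sqrt q * l2norm (unif Q) f"
      by (rule power2_le_imp_le) (use q in simp)
  qed
  have s0: "0 \<le> s" using hs norm_ge_zero order_trans by blast
  have each: "norm (integral\<^sup>L lborel (?s m)) \<le> cmod c * n / (q' * q) * l2norm (unif Q) f1 * l2norm (unif Q) f2 * s" for m
  proof -
    have "cmod (LINT w|lborel. Kw w * W w * tri (g1 m) (g2 m) (gh m) w) \<le> n * l2norm lborel (g1 m) * l2norm lborel (g2 m) * s"
    proof (rule bound[OF tr])
      show "cmod (gh m x) \<le> s" for x using truncation_le[of Q' h m x] hs order_trans by (auto simp: gh_def)
    qed (use l2[OF f1] l2[OF f2] in \<open>simp_all add: g1_def g2_def\<close>)
    also have "\<dots> \<le> n * (sqrt q * l2norm (unif Q) f1) * (sqrt q * l2norm (unif Q) f2) * s"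
      unfolding g1_def g2_def using l2[OF f1] l2[OF f2] n s0 q
      by (intro mult_right_mono mult_mono mult_nonneg_nonneg) auto
    also have "\<dots> = q * (n * l2norm (unif Q) f1 * l2norm (unif Q) f2 * s)"
    proof -
      have "sqrt q * sqrt q = q" using q by simp
      then show ?thesis by (metis (no_types, opaque_lifting) mult.assoc mult.commute)
    qed
    finally have 1: "cmod (LINT w|lborel. Kw w * W w * tri (g1 m) (g2 m) (gh m) w) \<le> q * (n * l2norm (unif Q) f1 * l2norm (unif Q) f2 * s)" .
    have "norm (integral\<^sup>L lborel (?s m)) = cmod c / (q' * (q * q)) * cmod (LINT w|lborel. Kw w * W w * tri (g1 m) (g2 m) (gh m) w)"
      using q by (simp add: norm_mult norm_divide)
    also have "\<dots> \<le> cmod c / (q' * (q * q)) * (q * (n * l2norm (unif Q) f1 * l2norm (unif Q) f2 * s))"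
      using 1 q by (intro mult_left_mono) auto
    also have "\<dots> = cmod c * n / (q' * q) * l2norm (unif Q) f1 * l2norm (unif Q) f2 * s"
      using q by simp
    finally show ?thesis .
  qed
  have "norm (integral\<^sup>L lborel ?S) \<le> cmod c * n / (q' * q) * l2norm (unif Q) f1 * l2norm (unif Q) f2 * s"
    by (rule LIMSEQ_le_const2[OF tendsto_norm[OF lim]]) (use each in blast)
  then show "cmod (integral\<^sup>L (unif Q' \<Otimes>\<^sub>M (unif Q \<Otimes>\<^sub>M unif Q)) ?G)
      \<le> cmod c * n / (measure lborel Q' * measure lborel Q) * l2norm (unif Q) f1 * l2norm (unif Q) f2 * s"
    unfolding SI q_def q'_def .
qed

end

section \<open>A cube and a distant ball in a good direction\<close>

text \<open>
  The cube of side \<open>l\<close> with corner \<open>a\<close>, and the data that produce the distant ball. The bound \<open>L\<close> of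
  the normalised kernel involves neither \<open>\<rho>\<close> nor \<open>u0\<close>: they depend on \<open>e\<close>, which in turn depends
  on \<open>L\<close>. The number \<open>64 = 8\<^sup>2\<close> comes from \<open>\<rho>2 / \<rho>1 = 8\<close> and the degree \<open>-2d\<close> of the kernel.
\<close>

locale nondegenerate_cube =
  fixes \<Omega> :: "'a::euclidean_space \<times> 'a \<Rightarrow> complex" and \<omega> :: "'a \<times> 'a \<Rightarrow> complex" and B :: real
    and \<eta> :: "real \<Rightarrow> real" and G :: "'a set" and \<delta> \<kappa> :: real and \<zeta> :: complex
    and u0 :: 'a and \<rho> L e :: real and a :: 'a and l :: real
    and b1 b2 b1' b2' :: "'a \<Rightarrow> complex"
  assumes omega_borel: "\<omega> \<in> borel_measurable borel" and omega_bound: "\<And>y. cmod (\<omega> y) \<le> B"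
    and omega_AE: "AE y in lebesgue. hom0 \<Omega> y = \<omega> y" and cutoff_eta: "is_cutoff \<eta>"
    and G_borel: "G \<in> sets borel" and G_cone: "\<And>u t. u \<in> G \<Longrightarrow> 0 < t \<Longrightarrow> t *\<^sub>R u \<in> G"
    and nondegenerate: "\<And>u v. u \<in> G \<Longrightarrow> norm v < \<delta> * norm u \<Longrightarrow> \<kappa> \<le> Re (\<zeta> * \<omega> (u + v, u - v))"
    and \<kappa>: "0 < \<kappa>" "\<kappa> \<le> B" and \<zeta>: "cmod \<zeta> = 1" and \<delta>: "0 < \<delta>"
    and \<rho>: "0 < \<rho>" "\<rho> \<le> norm u0 / 8" "\<rho> \<le> \<delta> * norm u0"
    and e0: "0 \<le> e"
    and full: "emeasure lborel (ball u0 \<rho> - G) \<le> ennreal (e / 2 ^ DIM('a)) * emeasure lborel (ball u0 \<rho>)"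
    and L: "L = 64 ^ DIM('a) * B / \<kappa>" and l: "0 < l"
    and sym1: "b1' \<in> borel_measurable borel" "AE z in lebesgue. b1 z = b1' z"
    and sym2: "b2' \<in> borel_measurable borel" "AE z in lebesgue. b2 z = b2' z"
begin

text \<open>
  The radius \<open>\<tau>\<close> bounds the distance of points of \<open>Q\<close> from \<open>a\<close>. The dilation \<open>t\<close> satisfies
  \<open>t \<rho> = 2 \<tau>\<close>: one half of the dilated radius is used for \<open>Q'\<close>, the other half makes room for the
  midpoint of \<open>z1\<close> and \<open>z2\<close>. The factor \<open>c\<close> lifts the real part of the kernel to at least \<open>1\<close> at
  distances up to \<open>\<rho>2\<close>.
\<close>

definition \<tau> :: real where "\<tau> = real DIM('a) * l"
definition t :: real where "t = 2 * \<tau> / \<rho>"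
definition Q :: "'a set" where "Q = cbox a (a + l *\<^sub>R One)"
definition Q' :: "'a set" where "Q' = ball (a + t *\<^sub>R u0) \<tau>"
definition \<rho>1 :: real where "\<rho>1 = t * norm u0 / 2"
definition \<rho>2 :: real where "\<rho>2 = 4 * t * norm u0"
definition c :: complex where "c = \<zeta> * of_real (\<rho>2 ^ (2 * DIM('a)) / \<kappa>)"

lemma u0_pos: "0 < norm u0" using \<rho> by linarith
lemma \<tau>_pos: "0 < \<tau>" using l by (simp add: \<tau>_def)
lemma t_pos: "0 < t" using \<tau>_pos \<rho> by (simp add: t_def)
lemma \<tau>_eq: "\<tau> = t * \<rho> / 2" using \<rho> by (simp add: t_def)
lemma \<rho>12_pos: "0 < \<rho>1" "0 < \<rho>2" using t_pos u0_pos by (simp_all add: \<rho>1_def \<rho>2_def)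

lemma Q_radius: "z \<in> Q \<Longrightarrow> norm (z - a) \<le> \<tau>"
proof -
  assume z: "z \<in> Q"
  have "norm (z - a) \<le> (\<Sum>b\<in>Basis. \<bar>(z - a) \<bullet> b\<bar>)" by (rule norm_le_l1)
  also have "\<dots> \<le> (\<Sum>b\<in>(Basis::'a set). l)"
    using z by (intro sum_mono) (auto simp: Q_def mem_box inner_diff_left inner_add_left)
  finally show ?thesis by (simp add: \<tau>_def)
qed

lemma midpoint_geometry:
  fixes x z1 z2 :: 'a
  assumes "x \<in> Q'" "z1 \<in> Q" "z2 \<in> Q"
  defines "u \<equiv> x - (1/2) *\<^sub>R (z1 + z2)" and "v \<equiv> (1/2) *\<^sub>R (z2 - z1)"
  shows "x - z1 = u + v" "x - z2 = u - v" "norm (u - t *\<^sub>R u0) < t * \<rho>" "norm v < \<delta> * norm u"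
    "\<rho>1 \<le> norm (x - z1, x - z2)" "norm (x - z1, x - z2) \<le> \<rho>2"
proof -
  have half: "z = (1/2) *\<^sub>R z + (1/2) *\<^sub>R z" for z :: 'a by (simp flip: scaleR_add_left)
  show y1: "x - z1 = u + v" and y2: "x - z2 = u - v"
    using half[of z1] half[of z2] by (simp_all add: u_def v_def algebra_simps)
  have za: "norm (z1 - a) \<le> \<tau>" "norm (z2 - a) \<le> \<tau>" using Q_radius assms by auto
  have "u - t *\<^sub>R u0 = (x - (a + t *\<^sub>R u0)) - (1/2) *\<^sub>R ((z1 - a) + (z2 - a))"
    using half[of a] by (simp add: u_def algebra_simps)
  also have "norm \<dots> \<le> norm (x - (a + t *\<^sub>R u0)) + norm ((1/2) *\<^sub>R ((z1 - a) + (z2 - a)))"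
    by (rule norm_triangle_ineq4)
  also have "norm ((1/2) *\<^sub>R ((z1 - a) + (z2 - a))) \<le> \<tau>"
    using norm_triangle_ineq[of "z1 - a" "z2 - a"] za by simp
  also have "norm (x - (a + t *\<^sub>R u0)) < \<tau>" using assms(1) by (simp add: Q'_def dist_norm norm_minus_commute)
  finally show ut: "norm (u - t *\<^sub>R u0) < t * \<rho>" using \<tau>_eq by linarith
  have v: "norm v \<le> \<tau>"
    using norm_triangle_ineq4[of "z2 - a" "z1 - a"] za by (simp add: v_def)
  have t8: "t * \<rho> \<le> t * norm u0 / 8" using \<rho>(2) t_pos by simp
  have tn: "norm (t *\<^sub>R u0) = t * norm u0" using t_pos by simp
  have u: "t * norm u0 * (7/8) \<le> norm u" "norm u \<le> t * norm u0 * (9/8)"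
    using norm_triangle_ineq2[of "t *\<^sub>R u0" u, unfolded tn] norm_triangle_ineq2[of u "t *\<^sub>R u0", unfolded tn] ut t8
      norm_minus_commute[of u "t *\<^sub>R u0"] by linarith+
  have "t * \<rho> \<le> t * (\<delta> * norm u0)" using \<rho>(3) t_pos by simp
  then have "\<tau> < \<delta> * (t * norm u0 * (7/8))" using \<tau>_pos unfolding \<tau>_eq by (simp add: algebra_simps)
  also have "\<dots> \<le> \<delta> * norm u" using u(1) \<delta> by simp
  finally show "norm v < \<delta> * norm u" using v by simp
  have \<tau>8: "\<tau> \<le> t * norm u0 / 16" using t8 \<tau>_eq by linarith
  have tu: "0 < t * norm u0" using t_pos u0_pos by simp
  have "2 * norm u = norm ((x - z1) + (x - z2))"
    unfolding y1 y2 by (simp flip: scaleR_2)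
  also have "\<dots> \<le> norm (x - z1) + norm (x - z2)" by (rule norm_triangle_ineq)
  also have "\<dots> \<le> 2 * norm (x - z1, x - z2)"
    using norm_fst_le[of "x - z1" "x - z2"] norm_snd_le[of "x - z2" "x - z1"] by simp
  finally show "\<rho>1 \<le> norm (x - z1, x - z2)" using u(1) tu unfolding \<rho>1_def by linarith
  have "norm (x - z1, x - z2) \<le> norm (x - z1) + norm (x - z2)" by (rule norm_Pair_le)
  also have "\<dots> \<le> (norm u + norm v) + (norm u + norm v)"
    unfolding y1 y2 by (intro add_mono norm_triangle_ineq norm_triangle_ineq4)
  finally show "norm (x - z1, x - z2) \<le> \<rho>2" using u(2) v \<tau>8 tu unfolding \<rho>2_def by linarith
qed

sublocale separated_symbols \<Omega> \<omega> B \<eta> Q Q' \<rho>1 \<rho>2 b1 b2 b1' b2'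
  by unfold_locales
     (use omega_borel omega_bound omega_AE cutoff_eta \<rho>12_pos midpoint_geometry(5,6) sym1 sym2
      in \<open>auto simp: Q_def Q'_def\<close>)

lemma measure_Q: "emeasure lborel Q = ennreal (l ^ DIM('a))" "measure lborel Q = l ^ DIM('a)"
proof -
  show 1: "emeasure lborel Q = ennreal (l ^ DIM('a))"
    unfolding Q_def using l by (subst emeasure_lborel_cbox) (auto simp: inner_add_left)
  then show "measure lborel Q = l ^ DIM('a)" using l by (simp add: measure_def)
qed

lemma measure_Q': "emeasure lborel Q' = ennreal (unit_ball_vol (real DIM('a)) * \<tau> ^ DIM('a))"
    "measure lborel Q' = unit_ball_vol (real DIM('a)) * \<tau> ^ DIM('a)"
proof -
  show 1: "emeasure lborel Q' = ennreal (unit_ball_vol (real DIM('a)) * \<tau> ^ DIM('a))"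
    unfolding Q'_def using \<tau>_pos by (simp add: emeasure_ball)
  then show "measure lborel Q' = unit_ball_vol (real DIM('a)) * \<tau> ^ DIM('a)"
    using \<tau>_pos unit_ball_vol_pos[of "real DIM('a)"] by (simp add: measure_def)
qed

lemma Q_measure_pos: "emeasure lborel Q < \<infinity>" "0 < measure lborel Q"
  using l by (simp_all add: measure_Q)

lemma Q'_measure_pos: "emeasure lborel Q' < \<infinity>" "0 < measure lborel Q'"
  using \<tau>_pos unit_ball_vol_pos[of "real DIM('a)"] by (simp_all add: measure_Q')

lemma cmod_c: "cmod c = \<rho>2 ^ (2 * DIM('a)) / \<kappa>"
  using \<zeta> \<rho>12_pos \<kappa> by (simp add: c_def norm_mult norm_divide norm_power)

lemma L_ge_one: "1 \<le> L"
proof -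
  have "1 \<le> (64::real) ^ DIM('a)" by simp
  then have "1 * 1 \<le> 64 ^ DIM('a) * (B / \<kappa>)" using \<kappa> by (intro mult_mono) auto
  then show ?thesis by (simp add: L)
qed

lemma normalized_kernel_bound: "cmod (normalized_kernel c w) \<le> L"
proof (cases "w \<in> box")
  case True
  have "cmod (c * Kw w) \<le> \<rho>2 ^ (2 * DIM('a)) / \<kappa> * (B / \<rho>1 ^ (2 * DIM('a)))"
    unfolding norm_mult cmod_c using Kw_bound[OF True] \<rho>12_pos \<kappa> by (intro mult_left_mono) auto
  also have "\<dots> = (\<rho>2 / \<rho>1) ^ (2 * DIM('a)) * B / \<kappa>" by (simp add: power_divide)
  also have "\<rho>2 / \<rho>1 = 8" using t_pos u0_pos by (simp add: \<rho>2_def \<rho>1_def)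
  also have "(8::real) ^ (2 * DIM('a)) * B / \<kappa> = L" by (simp add: L power_mult)
  finally show ?thesis using True by (simp add: normalized_kernel_def)
next
  case False then show ?thesis using L_ge_one by (simp add: normalized_kernel_def)
qed

lemma normalized_kernel_large:
  assumes x: "x \<in> Q'" and z: "z1 \<in> Q" "z2 \<in> Q" and G: "x - (1/2) *\<^sub>R (z1 + z2) \<in> G"
  shows "1 \<le> Re (normalized_kernel c (x, z1, z2))"
proof -
  note geo = midpoint_geometry[OF x z]
  define y where "y = (x - z1, x - z2)"
  have y: "0 < norm y" "norm y \<le> \<rho>2" using geo(5,6) \<rho>12_pos by (auto simp: y_def)
  have nd: "\<kappa> \<le> Re (\<zeta> * \<omega> y)" unfolding y_def geo(1,2) by (rule nondegenerate[OF G geo(4)])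
  define r where "r = \<rho>2 ^ (2 * DIM('a)) / (\<kappa> * norm y ^ (2 * DIM('a)))"
  have "normalized_kernel c (x, z1, z2) = of_real r * (\<zeta> * \<omega> y)"
    using x z by (simp add: normalized_kernel_def box_def Kw_def K_def y_def c_def r_def)
  moreover have "Re (of_real r * (\<zeta> * \<omega> y)) = r * Re (\<zeta> * \<omega> y)" by simp
  moreover have "1 \<le> r * Re (\<zeta> * \<omega> y)"
  proof -
    have "0 < norm y ^ (2 * DIM('a))" using y(1) by (rule zero_less_power)
    then have "1 \<le> \<rho>2 ^ (2 * DIM('a)) / norm y ^ (2 * DIM('a))"
      using power_mono[OF y(2) norm_ge_zero, of "2 * DIM('a)"] by (simp only: le_divide_eq_1_pos)
    also have "\<dots> = r * \<kappa>" using \<kappa> by (simp add: r_def)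
    finally have "1 \<le> r * \<kappa>" .
    also have "r * \<kappa> \<le> r * Re (\<zeta> * \<omega> y)" using nd \<kappa> y \<rho>12_pos by (intro mult_left_mono) (auto simp: r_def)
    finally show ?thesis .
  qed
  ultimately show ?thesis by simp
qed

text \<open>
  For fixed \<open>z1\<close> and \<open>z2\<close> the exceptional points lie in a translate of \<open>t\<close> times \<open>ball u0 \<rho> - G\<close>,
  as \<open>G\<close> is a cone. The ball \<open>Q'\<close> has half the radius of the dilated ball, which costs the factor
  \<open>2\<^sup>d\<close> provided for in \<open>full\<close>.
\<close>

lemma bad_directions:
  assumes z: "z1 \<in> Q" "z2 \<in> Q"
  shows "measure (unif Q') {x. Re (normalized_kernel c (x, z1, z2)) < 1} \<le> e"
proof -
  define m where "m = (1/2) *\<^sub>R (z1 + z2)"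
  let ?A = "{x. Re (normalized_kernel c (x, z1, z2)) < 1}"
  have nk: "(\<lambda>x. normalized_kernel c (x, z1, z2)) \<in> borel_measurable borel"
    by (rule borel_measurable_comp_continuous[OF normalized_kernel_borel]) (intro continuous_intros)
  have A: "?A \<in> sets borel" using nk by measurable
  have Vb: "ball (t *\<^sub>R u0) (t * \<rho>) - G \<in> sets borel" using G_borel by simp
  have sub: "Q' \<inter> ?A \<subseteq> {x. x + - m \<in> ball (t *\<^sub>R u0) (t * \<rho>) - G}"
  proof
    fix x assume x: "x \<in> Q' \<inter> ?A"
    then have "x - m \<notin> G" using normalized_kernel_large[of x z1 z2] z by (force simp: m_def)
    moreover have "norm (x - m - t *\<^sub>R u0) < t * \<rho>" using midpoint_geometry(3)[of x z1 z2] x z by (simp add: m_def)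
    ultimately show "x \<in> {x. x + - m \<in> ball (t *\<^sub>R u0) (t * \<rho>) - G}" by (simp add: dist_norm norm_minus_commute)
  qed
  have meas: "{x. x + - m \<in> ball (t *\<^sub>R u0) (t * \<rho>) - G} \<in> sets borel"
  proof -
    have "(\<lambda>x. x + - m) -` (ball (t *\<^sub>R u0) (t * \<rho>) - G) \<inter> space borel \<in> sets borel"
      by (rule measurable_sets[OF _ Vb]) simp
    then show ?thesis by (simp add: vimage_def)
  qed
  have "emeasure lborel (Q' \<inter> ?A) \<le> emeasure lborel {x. x + - m \<in> ball (t *\<^sub>R u0) (t * \<rho>) - G}"
    using meas by (intro emeasure_mono sub) simp
  also have "\<dots> = emeasure lborel (ball (t *\<^sub>R u0) (t * \<rho>) - G)" by (rule emeasure_lborel_translate[OF Vb])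
  also have "\<dots> = emeasure lebesgue (ball (t *\<^sub>R u0) (t * \<rho>) - G)" using Vb by simp
  also have "\<dots> \<le> emeasure lebesgue ((\<lambda>u. t *\<^sub>R u + 0) ` (ball u0 \<rho> - G))"
  proof (rule emeasure_mono)
    show "ball (t *\<^sub>R u0) (t * \<rho>) - G \<subseteq> (\<lambda>u. t *\<^sub>R u + 0) ` (ball u0 \<rho> - G)"
    proof
      fix y assume y: "y \<in> ball (t *\<^sub>R u0) (t * \<rho>) - G"
      define u where "u = (1/t) *\<^sub>R y"
      have yu: "y = t *\<^sub>R u" using t_pos by (simp add: u_def)
      have "norm (t *\<^sub>R u0 - t *\<^sub>R u) = t * norm (u0 - u)"
        unfolding scaleR_diff_right[symmetric] using t_pos by simp
      then have "u \<in> ball u0 \<rho>" using y t_pos by (simp add: yu dist_norm)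
      moreover have "u \<notin> G" using y G_cone[of u t] t_pos by (auto simp: yu)
      ultimately show "y \<in> (\<lambda>u. t *\<^sub>R u + 0) ` (ball u0 \<rho> - G)"
        unfolding yu by (intro image_eqI[of _ _ u]) simp_all
    qed
    have "(\<lambda>y. (1/t) *\<^sub>R y) -` (ball u0 \<rho> - G) \<inter> space borel \<in> sets borel"
      by (rule measurable_sets[of _ borel borel]) (use G_borel in auto)
    moreover have "(\<lambda>u. t *\<^sub>R u + 0) ` (ball u0 \<rho> - G) = (\<lambda>y. (1/t) *\<^sub>R y) -` (ball u0 \<rho> - G)"
      using t_pos by (force simp: image_iff)
    ultimately have "(\<lambda>u. t *\<^sub>R u + 0) ` (ball u0 \<rho> - G) \<in> sets borel" by simp
    then show "(\<lambda>u. t *\<^sub>R u + 0) ` (ball u0 \<rho> - G) \<in> sets lebesgue" by simp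
  qed
  also have "\<dots> = ennreal (t ^ DIM('a)) * emeasure lebesgue (ball u0 \<rho> - G)"
    using t_pos emeasure_lebesgue_affine[of t 0 "ball u0 \<rho> - G"] by (simp add: ennreal_power)
  also have "\<dots> = ennreal (t ^ DIM('a)) * emeasure lborel (ball u0 \<rho> - G)" using G_borel by simp
  also have "\<dots> \<le> ennreal (t ^ DIM('a)) * (ennreal (e / 2 ^ DIM('a)) * emeasure lborel (ball u0 \<rho>))"
    by (intro mult_left_mono full) simp
  also have "\<dots> = ennreal (e * measure lborel Q')"
    unfolding emeasure_ball[OF less_imp_le[OF \<rho>(1)]] measure_Q' \<tau>_eq
    using t_pos e0 \<rho>(1) unit_ball_vol_pos[of "real DIM('a)"]
    by (simp add: ennreal_mult[symmetric] power_mult_distrib power_divide mult_ac)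
  finally have le: "emeasure lborel (Q' \<inter> ?A) \<le> ennreal (e * measure lborel Q')" .
  have "emeasure (unif Q') ?A = emeasure lborel (Q' \<inter> ?A) / emeasure lborel Q'"
    using Q'(1) A Q'_measure_pos by (intro emeasure_unif)
  also have "\<dots> \<le> ennreal (e * measure lborel Q') / ennreal (measure lborel Q')"
    using le Q'_measure_pos by (simp add: divide_right_mono_ennreal emeasure_eq_ennreal_measure)
  also have "\<dots> = ennreal e" using Q'_measure_pos e0 by (simp add: divide_ennreal)
  finally show ?thesis unfolding measure_def by (rule enn2real_leI[OF e0])
qed

sublocale averaged_kernel "unif Q" "unif Q'" "normalized_kernel c" L e
proof -
  interpret P: prob_space "unif Q" by (rule prob_space_unif[OF Q(1) Q_measure_pos])
  interpret P': prob_space "unif Q'" by (rule prob_space_unif[OF Q'(1) Q'_measure_pos])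
  have s: "sets (unif Q' \<Otimes>\<^sub>M (unif Q \<Otimes>\<^sub>M unif Q)) = sets borel"
    unfolding unif_triple[OF Q(1) Q_measure_pos Q'(1) Q'_measure_pos] by simp
  show "averaged_kernel (unif Q) (unif Q') (normalized_kernel c) L e"
  proof
    show "normalized_kernel c \<in> borel_measurable (unif Q' \<Otimes>\<^sub>M (unif Q \<Otimes>\<^sub>M unif Q))"
      using normalized_kernel_borel measurable_cong_sets[OF s refl] by blast
    fix z :: "'a \<times> 'a"
    show "measure (unif Q') {x \<in> space (unif Q'). Re (normalized_kernel c (x, z)) < 1} \<le> e"
    proof (cases "fst z \<in> Q \<and> snd z \<in> Q")
      case True then show ?thesis using bad_directions[of "fst z" "snd z"] by simp
    next
      case False
      then have "normalized_kernel c (x, z) = 1" for x by (auto simp: normalized_kernel_def box_def mem_Times_iff)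
      then show ?thesis using e0 by simp
    qed
  qed (rule normalized_kernel_bound L_ge_one)+
qed

text \<open>
  The constant of the test inequality on uniform distributions. The powers of \<open>l\<close> cancel, so that it is
  the same for all cubes.
\<close>

definition A :: real where
  "A = (8 * real DIM('a) * norm u0 / \<rho>) ^ (2 * DIM('a)) / (\<kappa> * unit_ball_vol (real DIM('a)) * real DIM('a) ^ DIM('a))"

lemma normalization_constant: "cmod c / (measure lborel Q' * measure lborel Q) = A"
proof -
  have "\<rho>2 = (8 * real DIM('a) * norm u0 / \<rho>) * l" by (simp add: \<rho>2_def t_def \<tau>_def)
  moreover have "(x * l) ^ (2 * n) = x ^ (2 * n) * (l ^ n * l ^ n)" for x n
    by (simp add: power_mult_distrib flip: power_add mult_2)
  ultimately have "\<rho>2 ^ (2 * DIM('a)) = (8 * real DIM('a) * norm u0 / \<rho>) ^ (2 * DIM('a)) * (l ^ DIM('a) * l ^ DIM('a))"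
    by (simp only:)
  moreover have "measure lborel Q' * measure lborel Q
      = unit_ball_vol (real DIM('a)) * real DIM('a) ^ DIM('a) * (l ^ DIM('a) * l ^ DIM('a))"
    by (simp add: measure_Q measure_Q' \<tau>_def power_mult_distrib)
  ultimately show ?thesis using l unfolding cmod_c A_def by simp
qed

end

section \<open>Lower bounds for the commutator norms\<close>

lemma ennreal_le_cmult_Inf:
  fixes x :: ennreal
  assumes "0 < C" and le: "\<And>N. N \<in> X \<Longrightarrow> x \<le> ennreal C * N"
  shows "x \<le> ennreal C * Inf X"
proof -
  have one: "ennreal C * ennreal (1 / C) = 1" using \<open>0 < C\<close> by (simp add: ennreal_mult[symmetric])
  have "ennreal (1 / C) * x \<le> Inf X"
  proof (rule Inf_greatest)
    fix N assume "N \<in> X"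
    then have "ennreal (1 / C) * x \<le> ennreal (1 / C) * (ennreal C * N)" by (intro mult_left_mono le) simp_all
    also have "\<dots> = (ennreal C * ennreal (1 / C)) * N" by (simp only: mult_ac)
    finally show "ennreal (1 / C) * x \<le> N" by (simp add: one)
  qed
  then have "ennreal C * (ennreal (1 / C) * x) \<le> ennreal C * Inf X" by (intro mult_left_mono) simp_all
  then show ?thesis by (simp add: mult.assoc[symmetric] one)
qed

lemma finite_disc_net:
  fixes R :: real
  assumes "0 < R"
  obtains C0 :: "complex set" where "finite C0" "C0 \<subseteq> cball 0 R" "cball 0 R \<subseteq> (\<Union>c\<in>C0. cball c (1 / R))"
proof -
  have "seq_compact (cball (0::complex) R)" using compact_cball compact_eq_seq_compact_metric by blast
  then have net: "\<forall>e>0. \<exists>k. finite k \<and> k \<subseteq> cball (0::complex) R \<and> cball 0 R \<subseteq> (\<Union>x\<in>k. ball x e)"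
    by (rule seq_compact_imp_totally_bounded)
  have "0 < 1 / R" using assms by simp
  with net have "\<exists>k. finite k \<and> k \<subseteq> cball (0::complex) R \<and> cball 0 R \<subseteq> (\<Union>x\<in>k. ball x (1 / R))"
    by simp
  then show thesis
  proof (elim exE conjE)
    fix k :: "complex set"
    assume k: "finite k" "k \<subseteq> cball 0 R" "cball 0 R \<subseteq> (\<Union>x\<in>k. ball x (1 / R))"
    have "(\<Union>x\<in>k. ball x (1 / R)) \<subseteq> (\<Union>x\<in>k. cball x (1 / R))" by (intro UN_mono ball_subset_cball order_refl)
    with k(3) have "cball 0 R \<subseteq> (\<Union>x\<in>k. cball x (1 / R))" by (rule order_trans)
    with k(1,2) show thesis by (rule that)
  qed
qed

lemma product_of_centred_factors:
  assumes "prob_space P" and b1: "square_integrable P b1" and b2: "square_integrable P b2"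
    and b12: "square_integrable P (\<lambda>z. b1 z * b2 z)"
  shows "square_integrable P (\<lambda>z. (b1 z - c1) * (b2 z - c2))"
    and "l2norm P (\<lambda>z. b1 z - c1) = 0 \<or> l2norm P (\<lambda>z. b2 z - c2) = 0 \<Longrightarrow> l2norm P (\<lambda>z. (b1 z - c1) * (b2 z - c2)) = 0"
proof -
  interpret P: prob_space P by fact
  have "square_integrable P (\<lambda>z. b1 z * b2 z + ((- c2) * b1 z + ((- c1) * b2 z + c1 * c2)))"
    by (intro square_integrable_add square_integrable_cmult P.square_integrable_const b1 b2 b12)
  then show "square_integrable P (\<lambda>z. (b1 z - c1) * (b2 z - c2))" by (simp add: algebra_simps)
  have vanish: "AE z in P. f z = 0" if "square_integrable P f" "l2norm P f = 0" for f
  proof -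
    have "(\<integral>z. (cmod (f z))\<^sup>2 \<partial>P) = 0" using that(2) by (simp add: l2norm_def)
    then have "AE z in P. (cmod (f z))\<^sup>2 = 0"
      using that(1) by (subst (asm) integral_nonneg_eq_0_iff_AE) (auto simp: square_integrable_def)
    then show ?thesis by simp
  qed
  assume "l2norm P (\<lambda>z. b1 z - c1) = 0 \<or> l2norm P (\<lambda>z. b2 z - c2) = 0"
  then have "(AE z in P. b1 z - c1 = 0) \<or> (AE z in P. b2 z - c2 = 0)"
    using vanish[OF P.square_integrable_diff_const[OF b1]] vanish[OF P.square_integrable_diff_const[OF b2]] by blast
  then have "AE z in P. (b1 z - c1) * (b2 z - c2) = 0"
    by (elim disjE) (erule eventually_mono, simp)+
  then have "(\<integral>z. (cmod ((b1 z - c1) * (b2 z - c2)))\<^sup>2 \<partial>P) = (\<integral>z. 0 \<partial>P)"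
    using b1 b2 by (intro integral_cong_AE) (auto simp: square_integrable_def)
  then show "l2norm P (\<lambda>z. (b1 z - c1) * (b2 z - c2)) = 0" unfolding l2norm_def by simp
qed

context nondegenerate_cube begin

lemma test_function_norms:
  assumes f: "square_integrable lborel f1" "square_integrable lborel f2" and h: "truncated S h h" "\<And>x. cmod (h x) \<le> s" and n: "0 \<le> n"
    and le: "ennreal (cmod v) \<le> ennreal n * Lp_norm 2 f1 * Lp_norm 2 f2 * Lp_norm \<infinity> h"
  shows "cmod v \<le> n * l2norm lborel f1 * l2norm lborel f2 * s"
proof -
  have s0: "0 \<le> s" using h(2) norm_ge_zero order_trans by blast
  have "Lp_norm \<infinity> h \<le> ennreal s" using h by (intro Lp_norm_infty_le) (auto simp: truncated_def represents_def)
  then have "ennreal n * Lp_norm 2 f1 * Lp_norm 2 f2 * Lp_norm \<infinity> h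
      \<le> ennreal n * ennreal (l2norm lborel f1) * ennreal (l2norm lborel f2) * ennreal s"
    unfolding Lp_norm_2[OF f(1)] Lp_norm_2[OF f(2)] by (intro mult_left_mono) auto
  also have "\<dots> = ennreal (n * l2norm lborel f1 * l2norm lborel f2 * s)"
    using n s0 by (simp add: ennreal_mult)
  finally have "ennreal (cmod v) \<le> ennreal (n * l2norm lborel f1 * l2norm lborel f2 * s)" using le by (rule order_trans[rotated])
  then show ?thesis using n s0 by (subst (asm) ennreal_le_iff) auto
qed

lemma symbol_means:
  assumes "L2_loc b1" "L2_loc b2"
  shows "square_integrable (unif Q) b1'" "square_integrable (unif Q) b2'"
    "avg b1 Q = (\<integral>z. b1' z \<partial>unif Q)" "avg b2 Q = (\<integral>z. b2' z \<partial>unif Q)"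
    "avg_abs 2 (\<lambda>x. b1 x - avg b1 Q) Q = ennreal (l2norm (unif Q) (\<lambda>z. b1' z - (\<integral>z. b1' z \<partial>unif Q)))"
    "avg_abs 2 (\<lambda>x. b2 x - avg b2 Q) Q = ennreal (l2norm (unif Q) (\<lambda>z. b2' z - (\<integral>z. b2' z \<partial>unif Q)))"
proof -
  have Qc: "compact Q" by (simp add: Q_def)
  show s1: "square_integrable (unif Q) b1'" and s2: "square_integrable (unif Q) b2'"
    using L2_loc_square_integrable[OF assms(1) sym1 Qc] L2_loc_square_integrable[OF assms(2) sym2 Qc] .
  show a1: "avg b1 Q = (\<integral>z. b1' z \<partial>unif Q)" and a2: "avg b2 Q = (\<integral>z. b2' z \<partial>unif Q)"
    using avg_unif[OF Q(1) sym1] avg_unif[OF Q(1) sym2] .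
  show "avg_abs 2 (\<lambda>x. b1 x - avg b1 Q) Q = ennreal (l2norm (unif Q) (\<lambda>z. b1' z - (\<integral>z. b1' z \<partial>unif Q)))"
    unfolding a1 using sym1(2)
    by (intro avg_abs_2_unif[OF Q(1) Q_measure_pos] P.square_integrable_diff_const s1) (auto elim: eventually_mono)
  show "avg_abs 2 (\<lambda>x. b2 x - avg b2 Q) Q = ennreal (l2norm (unif Q) (\<lambda>z. b2' z - (\<integral>z. b2' z \<partial>unif Q)))"
    unfolding a2 using sym2(2)
    by (intro avg_abs_2_unif[OF Q(1) Q_measure_pos] P.square_integrable_diff_const s2) (auto elim: eventually_mono)
qed

lemma A_pos: "0 < A"
  using \<rho> u0_pos \<kappa> unit_ball_vol_pos[of "real DIM('a)"] by (simp add: A_def)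

text \<open>
  The second inequality follows from the first one by the Cauchy-Schwarz inequality. When one of the
  oscillations vanishes there is nothing to test, and both left sides are zero.
\<close>

lemma cube_oscillation_12:
  fixes C0 :: "complex set"
  assumes b: "L2_loc b1" "L2_loc b2"
    and R: "96 * L\<^sup>2 \<le> R" and net: "finite C0" "cball 0 R \<subseteq> (\<Union>c\<in>C0. cball c (1 / R))"
    and p: "p = 1 / (real (card C0) + 1)\<^sup>2" and e: "(1 + L) * e \<le> p / 4" and n: "0 \<le> n"
    and bound: "\<And>f1 f2 h. admissible b1 b2 f1 \<Longrightarrow> admissible b1 b2 f2 \<Longrightarrow> admissible b1 b2 h \<Longrightarrow>
      ennreal (cmod (comm1 b1 (comm2 b2 (T_form \<eta> \<Omega>)) f1 f2 h))
        \<le> ennreal n * Lp_norm 2 f1 * Lp_norm 2 f2 * Lp_norm (conj_exponent 1) h"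
  shows "avg_abs 2 (\<lambda>x. b1 x - avg b1 Q) Q * avg_abs 2 (\<lambda>x. b2 x - avg b2 Q) Q \<le> ennreal (2 * (A * n) / p)"
    and "avg_abs 1 (\<lambda>x. (b1 x - avg b1 Q) * (b2 x - avg b2 Q)) Q \<le> ennreal (2 * (A * n) / p)"
proof -
  note sm = symbol_means[OF b]
  define r1 where "r1 = l2norm (unif Q) (\<lambda>z. b1' z - (\<integral>z. b1' z \<partial>unif Q))"
  define r2 where "r2 = l2norm (unif Q) (\<lambda>z. b2' z - (\<integral>z. b2' z \<partial>unif Q))"
  have r0: "0 \<le> r1" "0 \<le> r2" by (simp_all add: r1_def r2_def)
  have p0: "0 < p" by (simp add: p)
  have tb: "trilinear_bound (unif Q') (unif Q) (\<lambda>w. normalized_kernel c w * W12 w) (A * n)"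
  proof -
    have "trilinear_bound (unif Q') (unif Q) (\<lambda>w. normalized_kernel c w * W12 w) (cmod c * n / (measure lborel Q' * measure lborel Q))"
    proof (rule trilinear_bound_of_truncated[OF W_borel(1) n Q_measure_pos Q'_measure_pos])
      fix f1 f2 h s
      assume tr: "truncated Q f1 f1" "truncated Q f2 f2" "truncated Q' h h"
        and sq: "square_integrable lborel f1" "square_integrable lborel f2" and hs: "\<And>x. cmod (h x) \<le> s"
      show "cmod (LINT w|lborel. Kw w * W12 w * tri f1 f2 h w) \<le> n * l2norm lborel f1 * l2norm lborel f2 * s"
        using bound[of f1 f2 h, unfolded comm12_separated[OF tr] conj_exponent_1] tr Q(2) Q'(2)
        by (intro test_function_norms[OF sq tr(3) hs n]) (auto intro: truncated_admissible)
    qed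
    then show ?thesis unfolding normalization_constant[symmetric] times_divide_eq_left .
  qed
  have prod: "r1 * r2 \<le> 2 * (A * n) / p"
  proof (cases "r1 = 0 \<or> r2 = 0")
    case True then show ?thesis using A_pos n p0 by auto
  next
    case False
    then have "0 < r1" "0 < r2" using r0 by auto
    then show ?thesis
      using separated_oscillation_bound[OF sm(1,2) _ _ r1_def _ r2_def _ R net p e _ tb[unfolded W12_def]]
        b1'(1) b2'(1) A_pos n by simp
  qed
  then show S: "avg_abs 2 (\<lambda>x. b1 x - avg b1 Q) Q * avg_abs 2 (\<lambda>x. b2 x - avg b2 Q) Q \<le> ennreal (2 * (A * n) / p)"
    unfolding sm(5,6) r1_def[symmetric] r2_def[symmetric] using r0 by (simp add: ennreal_mult[symmetric] ennreal_leI)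
  note d1 = P.square_integrable_diff_const[OF sm(1)] and d2 = P.square_integrable_diff_const[OF sm(2)]
  have ae: "AE x in lebesgue. (b1 x - avg b1 Q) * (b2 x - avg b2 Q)
      = (b1' x - (\<integral>z. b1' z \<partial>unif Q)) * (b2' x - (\<integral>z. b2' z \<partial>unif Q))"
    using sym1(2) sym2(2) unfolding sm(3,4) by eventually_elim simp
  have "avg_abs 1 (\<lambda>x. (b1 x - avg b1 Q) * (b2 x - avg b2 Q)) Q
      = ennreal (\<integral>x. cmod ((b1' x - (\<integral>z. b1' z \<partial>unif Q)) * (b2' x - (\<integral>z. b2' z \<partial>unif Q))) \<partial>unif Q)"
    by (rule avg_abs_1_unif[OF Q(1) Q_measure_pos square_integrable_mult(1)[OF d1 d2] ae])
  also have "\<dots> \<le> ennreal (r1 * r2)"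
    using square_integrable_mult(2)[OF d1 d2] by (intro ennreal_leI) (simp add: norm_mult r1_def r2_def)
  also have "\<dots> \<le> ennreal (2 * (A * n) / p)" using prod by (rule ennreal_leI)
  finally show "avg_abs 1 (\<lambda>x. (b1 x - avg b1 Q) * (b2 x - avg b2 Q)) Q \<le> ennreal (2 * (A * n) / p)" .
qed

lemma cube_oscillation_11:
  fixes C0 :: "complex set"
  assumes b: "L2_loc b1" "L2_loc b2" and b12: "L2_loc (\<lambda>x. b1 x * b2 x)"
    and R: "96 * L\<^sup>2 \<le> R" and net: "finite C0" "C0 \<subseteq> cball 0 R" "cball 0 R \<subseteq> (\<Union>c\<in>C0. cball c (1 / R))"
    and p: "p = 1 / (real (card C0) + 1)\<^sup>2" and e: "(1 + L) * e \<le> p / 4" and n: "0 \<le> n"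
    and bound: "\<And>f1 f2 h. admissible b1 b2 f1 \<Longrightarrow> admissible b1 b2 f2 \<Longrightarrow> admissible b1 b2 h \<Longrightarrow>
      ennreal (cmod (comm1 b1 (comm1 b2 (transpose2 (T_form \<eta> \<Omega>))) f1 f2 h))
        \<le> ennreal n * Lp_norm 2 f1 * Lp_norm \<infinity> f2 * Lp_norm (conj_exponent 2) h"
  shows "avg_abs 2 (\<lambda>x. b1 x - avg b1 Q) Q * avg_abs 2 (\<lambda>x. b2 x - avg b2 Q) Q \<le> ennreal (52 * L / p * (A * n))"
    and "avg_abs 2 (\<lambda>x. (b1 x - avg b1 Q) * (b2 x - avg b2 Q)) Q \<le> ennreal (212 * R\<^sup>2 * L / p * (A * n))"
proof -
  note sm = symbol_means[OF b]
  define r1 where "r1 = l2norm (unif Q) (\<lambda>z. b1' z - (\<integral>z. b1' z \<partial>unif Q))"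
  define r2 where "r2 = l2norm (unif Q) (\<lambda>z. b2' z - (\<integral>z. b2' z \<partial>unif Q))"
  define r12 where "r12 = l2norm (unif Q) (\<lambda>z. (b1' z - (\<integral>z. b1' z \<partial>unif Q)) * (b2' z - (\<integral>z. b2' z \<partial>unif Q)))"
  have r0: "0 \<le> r1" "0 \<le> r2" by (simp_all add: r1_def r2_def)
  have p0: "0 < p" by (simp add: p)
  have Qc: "compact Q" by (simp add: Q_def)
  have "AE x in lebesgue. b1 x * b2 x = b1' x * b2' x" using sym1(2) sym2(2) by eventually_elim simp
  then have s12: "square_integrable (unif Q) (\<lambda>z. b1' z * b2' z)"
    using L2_loc_square_integrable[OF b12 _ _ Qc, of "\<lambda>z. b1' z * b2' z"] sym1(1) sym2(1) by simp
  have tb: "trilinear_bound (unif Q') (unif Q) (\<lambda>w. normalized_kernel c w * W11 w) (A * n)"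
  proof -
    have "trilinear_bound (unif Q') (unif Q) (\<lambda>w. normalized_kernel c w * W11 w) (cmod c * n / (measure lborel Q' * measure lborel Q))"
    proof (rule trilinear_bound_of_truncated[OF W_borel(2) n Q_measure_pos Q'_measure_pos])
      fix f1 f2 h s
      assume tr: "truncated Q f1 f1" "truncated Q f2 f2" "truncated Q' h h"
        and sq: "square_integrable lborel f1" "square_integrable lborel f2" and hs: "\<And>x. cmod (h x) \<le> s"
      have "ennreal (cmod (LINT w|lborel. Kw w * W11 w * tri f1 f2 h w)) \<le> ennreal n * Lp_norm 2 f1 * Lp_norm \<infinity> h * Lp_norm 2 f2"
        using bound[of f1 h f2, unfolded comm11_separated[OF tr(1,3,2)] conj_exponent_2] tr Q(2) Q'(2)
        by (auto intro: truncated_admissible)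
      then show "cmod (LINT w|lborel. Kw w * W11 w * tri f1 f2 h w) \<le> n * l2norm lborel f1 * l2norm lborel f2 * s"
        by (intro test_function_norms[OF sq tr(3) hs n]) (simp add: mult_ac)
    qed
    then show ?thesis unfolding normalization_constant[symmetric] times_divide_eq_left .
  qed
  have An: "0 \<le> A * n" using A_pos n by simp
  note pz = product_of_centred_factors[OF P.prob_space_axioms sm(1,2) s12]
  have both: "r1 * r2 \<le> 52 * L / p * (A * n) \<and> r12 \<le> 212 * R\<^sup>2 * L / p * (A * n)"
  proof (cases "r1 = 0 \<or> r2 = 0")
    case True
    then have "r12 = 0" unfolding r12_def by (intro pz(2)) (simp add: r1_def r2_def)
    moreover have "0 \<le> 52 * L / p * (A * n)" "0 \<le> 212 * R\<^sup>2 * L / p * (A * n)" using An p0 L_ge_one by simp_all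
    ultimately show ?thesis using True by auto
  next
    case False
    then have "0 < r1" "0 < r2" using r0 by auto
    from diagonal_oscillation_bound[OF sm(1,2) s12 r1_def this(1) r2_def this(2) R net p e An tb[unfolded W11_def]]
    show ?thesis by (simp add: r12_def)
  qed
  then show "avg_abs 2 (\<lambda>x. b1 x - avg b1 Q) Q * avg_abs 2 (\<lambda>x. b2 x - avg b2 Q) Q \<le> ennreal (52 * L / p * (A * n))"
    unfolding sm(5,6) r1_def[symmetric] r2_def[symmetric] using r0 by (simp add: ennreal_mult[symmetric] ennreal_leI)
  have ae: "AE x in lebesgue. (b1 x - avg b1 Q) * (b2 x - avg b2 Q)
      = (b1' x - (\<integral>z. b1' z \<partial>unif Q)) * (b2' x - (\<integral>z. b2' z \<partial>unif Q))"
    using sym1(2) sym2(2) unfolding sm(3,4) by eventually_elim simp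
  show "avg_abs 2 (\<lambda>x. (b1 x - avg b1 Q) * (b2 x - avg b2 Q)) Q \<le> ennreal (212 * R\<^sup>2 * L / p * (A * n))"
    unfolding avg_abs_2_unif[OF Q(1) Q_measure_pos pz(1) ae] using both by (intro ennreal_leI) (simp add: r12_def)
qed

end

text \<open>
  The two forms agree after a permutation of their arguments, and the exponents are permuted in the
  same way because \<open>2\<close> is its own conjugate.
\<close>

lemma form_norm_transposes:
  "form_norm b1 b2 2 \<infinity> 2 (comm1 b1 (comm1 b2 (transpose2 \<Lambda>)))
    = form_norm b1 b2 \<infinity> 2 2 (comm2 b1 (comm2 b2 (transpose1 \<Lambda>)))"
proof -
  have eq: "comm1 b1 (comm1 b2 (transpose2 \<Lambda>)) f1 f2 h = comm2 b1 (comm2 b2 (transpose1 \<Lambda>)) f2 h f1" for f1 f2 h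
    by (simp add: comm1_def comm2_def transpose1_def transpose2_def)
  have perm: "N * Lp_norm 2 f1 * Lp_norm \<infinity> f2 * Lp_norm 2 h = N * Lp_norm \<infinity> f2 * Lp_norm 2 h * Lp_norm 2 f1"
    for N and f1 f2 h :: "'a \<Rightarrow> complex" by (simp only: mult_ac)
  show ?thesis
    unfolding form_norm_def conj_exponent_2 eq perm by (rule arg_cong[where f=Inf]) blast
qed

lemma oscillation_le_form_norm:
  assumes H: "0 < H"
    and cube: "\<And>n S. 0 \<le> n \<Longrightarrow> S \<in> cubes \<Longrightarrow>
      (\<And>f1 f2 h. admissible b1 b2 f1 \<Longrightarrow> admissible b1 b2 f2 \<Longrightarrow> admissible b1 b2 h \<Longrightarrow>
        ennreal (cmod (\<Lambda> f1 f2 h)) \<le> ennreal n * Lp_norm p1 f1 * Lp_norm p2 f2 * Lp_norm (conj_exponent p) h) \<Longrightarrow>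
      avg_abs 2 (\<lambda>x. b1 x - avg b1 S) S * avg_abs 2 (\<lambda>x. b2 x - avg b2 S) S \<le> ennreal (H * n) \<and>
      avg_abs u (\<lambda>x. (b1 x - avg b1 S) * (b2 x - avg b2 S)) S \<le> ennreal (H * n)"
  shows "osc_S 2 2 b1 b2 + osc_T u b1 b2 \<le> ennreal (2 * H) * form_norm b1 b2 p1 p2 p \<Lambda>"
  unfolding form_norm_def
proof (rule ennreal_le_cmult_Inf)
  fix N assume N: "N \<in> {N. \<forall>f1 f2 h. admissible b1 b2 f1 \<and> admissible b1 b2 f2 \<and> admissible b1 b2 h \<longrightarrow>
    ennreal (cmod (\<Lambda> f1 f2 h)) \<le> N * Lp_norm p1 f1 * Lp_norm p2 f2 * Lp_norm (conj_exponent p) h}"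
  show "osc_S 2 2 b1 b2 + osc_T u b1 b2 \<le> ennreal (2 * H) * N"
  proof (cases N)
    case (real n)
    have "ennreal (cmod (\<Lambda> f1 f2 h)) \<le> ennreal n * Lp_norm p1 f1 * Lp_norm p2 f2 * Lp_norm (conj_exponent p) h"
      if "admissible b1 b2 f1" "admissible b1 b2 f2" "admissible b1 b2 h" for f1 f2 h
      using N that unfolding real(2) by blast
    note c = cube[OF real(1) _ this]
    have "osc_S 2 2 b1 b2 + osc_T u b1 b2 \<le> ennreal (H * n) + ennreal (H * n)"
      unfolding osc_S_def osc_T_def using c by (intro add_mono SUP_least) blast+
    also have "\<dots> = ennreal (2 * H) * N" unfolding real(2)
      using real(1) H by (simp add: ennreal_mult[symmetric] ennreal_plus[symmetric] del: ennreal_plus)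
    finally show ?thesis .
  next
    case top then show ?thesis using H by (simp add: ennreal_mult_top)
  qed
qed (use H in simp)

theorem theorem1p10:
  fixes \<Omega> :: "(real ^ 'n) \<times> (real ^ 'n) \<Rightarrow> complex"
    and F :: "(real ^ 'n) set"
    and \<delta> \<kappa> :: real and \<zeta> :: complex
  assumes "Linf sphere_measure \<Omega>"
    and "(LINT \<omega>|sphere_measure. \<Omega> \<omega>) = 0"
    and "F \<in> sets sphere_measure" and "emeasure sphere_measure F > 0"
    and "\<delta> > 0" and "\<kappa> > 0" and "cmod \<zeta> = 1"
    and "AE (\<theta>, h) in sphere_measure \<Otimes>\<^sub>M lebesgue.
           \<theta> \<in> F \<and> h \<in> ball 0 \<delta> \<longrightarrow> Re (\<zeta> * hom0 \<Omega> (\<theta> + h, \<theta> - h)) \<ge> \<kappa>"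
  shows "\<exists>C::real. C > 0 \<and>
    (\<forall>\<eta> b1 b2. is_cutoff \<eta> \<and> L2_loc b1 \<and> L2_loc b2 \<longrightarrow>
      osc_S 2 2 b1 b2 + osc_T 1 b1 b2
        \<le> ennreal C * form_norm b1 b2 2 2 1 (comm1 b1 (comm2 b2 (T_form \<eta> \<Omega>)))
      \<and>
      (L2_loc (\<lambda>x. b1 x * b2 x) \<longrightarrow>
        osc_S 2 2 b1 b2 + osc_T 2 b1 b2
          \<le> ennreal C * form_norm b1 b2 2 \<infinity> 2 (comm1 b1 (comm1 b2 (transpose2 (T_form \<eta> \<Omega>))))
        \<and>
        form_norm b1 b2 2 \<infinity> 2 (comm1 b1 (comm1 b2 (transpose2 (T_form \<eta> \<Omega>))))
          = form_norm b1 b2 \<infinity> 2 2 (comm2 b1 (comm2 b2 (transpose1 (T_form \<eta> \<Omega>))))))"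
proof -
  obtain \<omega> B G where \<omega>: "\<omega> \<in> borel_measurable borel" "\<kappa> \<le> B" "\<And>y. cmod (\<omega> y) \<le> B" "AE y in lebesgue. hom0 \<Omega> y = \<omega> y"
    and G: "G \<in> sets (borel :: (real ^ 'n) measure)" "\<And>u. u \<in> G \<Longrightarrow> u \<noteq> 0"
      "\<And>u t. u \<in> G \<Longrightarrow> 0 < t \<Longrightarrow> t *\<^sub>R u \<in> G" "emeasure lborel (G \<inter> ball 0 1) > 0"
    and nd: "\<And>u v. u \<in> G \<Longrightarrow> norm v < \<delta> * norm u \<Longrightarrow> \<kappa> \<le> Re (\<zeta> * \<omega> (u + v, u - v))"
    by (rule nondegenerate_borel_symbol[OF assms(1,3-8)]) blast
  define d where "d = DIM(real ^ 'n)"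
  define L where "L = 64 ^ d * B / \<kappa>"
  have L1: "1 \<le> L"
  proof -
    have "1 \<le> (64::real) ^ d" by simp
    then have "1 * 1 \<le> 64 ^ d * (B / \<kappa>)" using \<omega>(2) assms(6) by (intro mult_mono) auto
    then show ?thesis by (simp add: L_def)
  qed
  \<comment> \<open>the constants are chosen in the order \<open>L\<close>, \<open>R\<close>, net, \<open>p\<close>, \<open>e\<close>, \<open>(u0, \<rho>)\<close>;
    each depends only on its predecessors and the kernel\<close>
  define R where "R = 96 * L\<^sup>2"
  have R1: "1 \<le> R" using one_le_power[OF L1, of 2] by (simp add: R_def)
  obtain C0 :: "complex set" where C0: "finite C0" "C0 \<subseteq> cball 0 R" "cball 0 R \<subseteq> (\<Union>c\<in>C0. cball c (1 / R))"
    using finite_disc_net[of R] R1 by (metis less_le_trans zero_less_one)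
  define p where "p = 1 / (real (card C0) + 1)\<^sup>2"
  have p0: "0 < p" by (simp add: p_def)
  define e where "e = p / 4 / (1 + L)"
  have e0: "0 < e" using p0 L1 by (simp add: e_def)
  have "x * (y / x) = y" if "x \<noteq> 0" for x y :: real using that by simp
  then have eL: "(1 + L) * e \<le> p / 4" unfolding e_def using L1 by (metis add_nonneg_eq_0_iff order_refl order_trans zero_le_one zero_neq_one)
  have "0 \<notin> G" using G(2) by blast
  then obtain u0 \<rho> where u0: "u0 \<in> G" "0 < \<rho>" "\<rho> \<le> min (1/8) \<delta> * norm u0"
    "emeasure lborel (ball u0 \<rho> - G) \<le> ennreal (e / 2 ^ d) * emeasure lborel (ball u0 \<rho>)"
    using almost_full_ball[OF G(1) _ G(4), of "e / 2 ^ d" "min (1/8) \<delta>"] e0 assms(5) by auto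
  have \<rho>: "\<rho> \<le> norm u0 / 8" "\<rho> \<le> \<delta> * norm u0"
    using u0(3) mult_right_mono[OF min.cobounded1 norm_ge_zero, of "1/8" \<delta> u0]
      mult_right_mono[OF min.cobounded2 norm_ge_zero, of "1/8" \<delta> u0] by linarith+
  define A where "A = (8 * real d * norm u0 / \<rho>) ^ (2 * d) / (\<kappa> * unit_ball_vol (real d) * real d ^ d)"
  have cube: "nondegenerate_cube \<Omega> \<omega> B \<eta> G \<delta> \<kappa> \<zeta> u0 \<rho> L e l b1 b2 b1' b2'"
    if "is_cutoff \<eta>" "0 < l" "b1' \<in> borel_measurable borel" "AE z in lebesgue. b1 z = b1' z"
      "b2' \<in> borel_measurable borel" "AE z in lebesgue. b2 z = b2' z" for \<eta> l b1 b2 b1' b2'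
    by unfold_locales
       (use that \<omega> G nd assms(5-7) u0 \<rho> e0 in \<open>auto simp: L_def d_def\<close>)
  define H where "H = 212 * R\<^sup>2 * L / p * A"
  have A0: "0 < A"
  proof -
    have "0 < norm u0" using u0(1) G(2) by simp
    moreover have "0 < real d" by (simp add: d_def)
    ultimately show ?thesis
      unfolding A_def using u0(2) assms(6) unit_ball_vol_pos[of "real d"]
      by (intro divide_pos_pos mult_pos_pos zero_less_power) simp_all
  qed
  have H0: "0 < H" using A0 L1 R1 p0 by (simp add: H_def)
  have R2: "1 \<le> R\<^sup>2" using R1 by simp
  have RL: "1 \<le> R\<^sup>2 * L" using mult_mono[OF R2 L1] by simp
  have H_ge: "2 * (A * n) / p \<le> H * n" "52 * L / p * (A * n) \<le> H * n" "212 * R\<^sup>2 * L / p * (A * n) = H * n" if "0 \<le> n" for n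
  proof -
    have An: "0 \<le> A * n / p" using that A0 p0 by simp
    have "2 * (A * n / p) \<le> (212 * (R\<^sup>2 * L)) * (A * n / p)" by (intro mult_right_mono) (use RL An in linarith)+
    then show "2 * (A * n) / p \<le> H * n" by (simp add: H_def mult_ac)
    have "1 * L \<le> R\<^sup>2 * L" using R2 L1 by (intro mult_right_mono) auto
    then have "(52 * L) * (A * n / p) \<le> (212 * (R\<^sup>2 * L)) * (A * n / p)" using RL An L1
      by (intro mult_right_mono) linarith+
    then show "52 * L / p * (A * n) \<le> H * n" by (simp add: H_def mult_ac)
    show "212 * R\<^sup>2 * L / p * (A * n) = H * n" by (simp add: H_def)
  qed
  have part_i: "osc_S 2 2 b1 b2 + osc_T 1 b1 b2 \<le> ennreal (2 * H) * form_norm b1 b2 2 2 1 (comm1 b1 (comm2 b2 (T_form \<eta> \<Omega>)))"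
    if hyp: "is_cutoff \<eta>" "L2_loc b1" "L2_loc b2" for \<eta> b1 b2
  proof (rule oscillation_le_form_norm[OF H0])
    fix n :: real and S :: "(real ^ 'n) set"
    assume n: "0 \<le> n" and "S \<in> cubes"
      and bound: "\<And>f1 f2 h. admissible b1 b2 f1 \<Longrightarrow> admissible b1 b2 f2 \<Longrightarrow> admissible b1 b2 h \<Longrightarrow>
        ennreal (cmod (comm1 b1 (comm2 b2 (T_form \<eta> \<Omega>)) f1 f2 h))
          \<le> ennreal n * Lp_norm 2 f1 * Lp_norm 2 f2 * Lp_norm (conj_exponent 1) h"
    then obtain a l where S: "S = cbox a (a + l *\<^sub>R One)" "0 < l" by (auto simp: cubes_def)
    obtain b1' where s1: "b1' \<in> borel_measurable borel" "AE z in lebesgue. b1 z = b1' z" by (rule L2_loc_borel_version[OF hyp(2)])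
    obtain b2' where s2: "b2' \<in> borel_measurable borel" "AE z in lebesgue. b2 z = b2' z" by (rule L2_loc_borel_version[OF hyp(3)])
    interpret N: nondegenerate_cube \<Omega> \<omega> B \<eta> G \<delta> \<kappa> \<zeta> u0 \<rho> L e a l b1 b2 b1' b2'
      by (rule cube[OF hyp(1) S(2) s1 s2])
    have NA: "N.A = A" by (simp add: N.A_def A_def d_def)
    have NQ: "N.Q = S" by (simp add: N.Q_def S(1))
    from N.cube_oscillation_12[OF hyp(2,3) _ C0(1,3) p_def eL n bound]
    show "avg_abs 2 (\<lambda>x. b1 x - avg b1 S) S * avg_abs 2 (\<lambda>x. b2 x - avg b2 S) S \<le> ennreal (H * n) \<and>
        avg_abs 1 (\<lambda>x. (b1 x - avg b1 S) * (b2 x - avg b2 S)) S \<le> ennreal (H * n)"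
      using H_ge(1)[OF n] unfolding NA NQ by (auto simp: R_def intro: order_trans[OF _ ennreal_leI])
  qed
  have part_ii: "osc_S 2 2 b1 b2 + osc_T 2 b1 b2
      \<le> ennreal (2 * H) * form_norm b1 b2 2 \<infinity> 2 (comm1 b1 (comm1 b2 (transpose2 (T_form \<eta> \<Omega>))))"
    if hyp: "is_cutoff \<eta>" "L2_loc b1" "L2_loc b2" "L2_loc (\<lambda>x. b1 x * b2 x)" for \<eta> b1 b2
  proof (rule oscillation_le_form_norm[OF H0])
    fix n :: real and S :: "(real ^ 'n) set"
    assume n: "0 \<le> n" and "S \<in> cubes"
      and bound: "\<And>f1 f2 h. admissible b1 b2 f1 \<Longrightarrow> admissible b1 b2 f2 \<Longrightarrow> admissible b1 b2 h \<Longrightarrow>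
        ennreal (cmod (comm1 b1 (comm1 b2 (transpose2 (T_form \<eta> \<Omega>))) f1 f2 h))
          \<le> ennreal n * Lp_norm 2 f1 * Lp_norm \<infinity> f2 * Lp_norm (conj_exponent 2) h"
    then obtain a l where S: "S = cbox a (a + l *\<^sub>R One)" "0 < l" by (auto simp: cubes_def)
    obtain b1' where s1: "b1' \<in> borel_measurable borel" "AE z in lebesgue. b1 z = b1' z" by (rule L2_loc_borel_version[OF hyp(2)])
    obtain b2' where s2: "b2' \<in> borel_measurable borel" "AE z in lebesgue. b2 z = b2' z" by (rule L2_loc_borel_version[OF hyp(3)])
    interpret N: nondegenerate_cube \<Omega> \<omega> B \<eta> G \<delta> \<kappa> \<zeta> u0 \<rho> L e a l b1 b2 b1' b2'
      by (rule cube[OF hyp(1) S(2) s1 s2])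
    have NA: "N.A = A" by (simp add: N.A_def A_def d_def)
    have NQ: "N.Q = S" by (simp add: N.Q_def S(1))
    from N.cube_oscillation_11[OF hyp(2-4) _ C0 p_def eL n bound]
    show "avg_abs 2 (\<lambda>x. b1 x - avg b1 S) S * avg_abs 2 (\<lambda>x. b2 x - avg b2 S) S \<le> ennreal (H * n) \<and>
        avg_abs 2 (\<lambda>x. (b1 x - avg b1 S) * (b2 x - avg b2 S)) S \<le> ennreal (H * n)"
      using H_ge(2,3)[OF n] unfolding NA NQ by (auto simp: R_def intro: order_trans[OF _ ennreal_leI])
  qed
  show ?thesis
  proof (intro exI[of _ "2 * H"] conjI allI impI)
    show "0 < 2 * H" using H0 by simp
  qed (use part_i part_ii form_norm_transposes in blast)+
qed

end
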